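(* Let $S_E^{(2)}$ be the $O(\kappa^2)$ term (quartic in $h$) in the expansion of the classical Einstein Lagrangian density $S_E$ in powers of $\kappa$, where $\sqrt{-g}\,g^{\mu\nu}=\eta^{\mu\nu}+\kappa h^{\mu\nu}$, and let $L_2[h]$ be defined by $\tfrac{\kappa^2}{2}L_2[h]=S_E^{(2)}$. When the classical metric deviation field $h^{\mu\nu}(x)$ is replaced by the string-localized quantum field $h^{\mu\nu}(x;c)$, $L_2[h]$ coincides, up to total divergences, with the induced graviton self-interaction, i.e. with the Wick polynomial $$L_2=-2\,(\partial_\nu h\,h\,h\,\partial_\mu h)^{\mu\nu}-\tfrac12\,\mathrm{tr}(h\,\partial_\mu h)\,\mathrm{tr}(h\,\partial^\mu h)-2\,\mathrm{tr}(h\,\partial_\mu h\,\partial_\nu h)\,h^{\mu\nu}.$$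
   Context: **Classical side.** For a Lorentzian metric $g_{\mu\nu}$ on $\mathbb R^{1+3}$ (mostly negative signature, $-g=-\det g>0$) with Christoffel symbols $\Gamma^\tau_{\kappa\lambda}=\tfrac12g^{\tau\mu}(\partial_\kappa g_{\lambda\mu}+\partial_\lambda g_{\kappa\mu}-\partial_\mu g_{\kappa\lambda})$, the Einstein Lagrangian density $S_E$ is defined by $$\tfrac12\kappa^2S_E=\sqrt{-g}\,g^{\mu\nu}\big(\Gamma^\alpha_{\mu\nu}\Gamma^\beta_{\alpha\beta}-\Gamma^\alpha_{\mu\beta}\Gamma^\beta_{\nu\alpha}\big),\qquad\kappa^2=32\pi G.$$ One sets $\mathfrak g^{\mu\nu}=\sqrt{-g}g^{\mu\nu}=\eta^{\mu\nu}+\kappa h^{\mu\nu}$ with $\eta$ the flat metric and $h^{\mu\nu}$ the metric deviation (indices of $h$ are moved with $\eta$), and expands $S_E$ as a power series in $\kappa$; $S_E$ starts at order $\kappa^0$ with a term quadratic in $h$. **Quantum side.** $h_{\mu\nu}(x;c)$ is the string-localized graviton potential: $h_{\mu\nu}(x;c)=I_c^\kappa I_c^\lambda F_{[\mu\kappa][\nu\lambda]}(x)$, where $F$ is the free massless helicity-$\pm2$ field strength (linearized curvature) on the physical Fock space, and $I_c^\mu f(x)=\int d^4e\,c(e)e^\mu\int_0^\infty ds\,f(x+se)$ with $c\in C_c^\infty(\{e^2<0\})$, $\int c=1$. It satisfies as operator identities $h_{\mu\nu}=h_{\nu\mu}$, $\eta^{\mu\nu}h_{\mu\nu}=0$, $\partial^\mu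 h_{\mu\nu}=0$, $\square h_{\mu\nu}=0$. Products of quantum fields at a point are Wick ordered. The displayed $L_2$ is the second-order interaction induced by string-independence of the $\mathbb S$-matrix with first-order interaction $L_1=h^{\mu\nu}[\tfrac12\partial_\mu h_{\kappa\lambda}\partial_\nu h^{\kappa\lambda}+\partial^\kappa h_{\mu\lambda}\partial^\lambda h_{\nu\kappa}-\partial_\kappa h_{\mu\lambda}\partial^\kappa h^\lambda{}_\nu]$ (total interaction $\kappa L_1+\tfrac{\kappa^2}2L_2+\dots$); it is defined only up to total divergences. **Notation.** Products of symmetric tensors are matrix products: $(AB)_{\mu\nu}=A_{\mu\kappa}B^\kappa{}_\nu$, $\mathrm{tr}(AB)=A_{\kappa\lambda}B^{\kappa\lambda}$, similarly for more factors, with $(\partial_\mu h)_{\kappa\lambda}=\partial_\mu h_{\kappa\lambda}$; e.g. $(\partial_\nu h\,h\,h\,\partial_\mu h)^{\mu\nu}=\partial_\nu h^{\mu\alpha}h_{\alpha\beta}h^{\beta\gamma}\partial_\mu h_\gamma{}^\nu$. "Total divergence" means an expression $\partial_\mu Q^\mu$ with $Q^\mu$ a Wick polynomial, where the free field identities $h_{\mu\nu}=h_{\nu\mu}$, $\eta^{\mu\nu}h_{\mu\nu}=0$, $\partial^\mu h_{\mu\nu}=0$, $\square h_{\mu\nu}=0$ are used. *)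

theory Defs
  imports "HOL-Analysis.Analysis" "HOL-Library.Poly_Mapping" "HOL-Library.Multiset"
begin

text \<open>Space-time indices are the elements of the four-element type \<^typ>\<open>4\<close>, with \<open>0\<close> the time
  index and \<open>1, 2, 3\<close> the space indices. A point \<open>x :: real^4\<close> has contravariant components
  \<open>x $ \<mu>\<close>. The matrix \<open>eta\<close> below serves both as \<open>\<eta>\<^sub>\<mu>\<^sub>\<nu>\<close> and as \<open>\<eta>\<^sup>\<mu>\<^sup>\<nu>\<close>.\<close>

definition eta :: "'a::ring_1^4^4" where
  "eta = (\<chi> \<mu> \<nu>. if \<mu> = \<nu> then (if \<mu> = 0 then 1 else - 1) else 0)"

definition mdot :: "real^4 \<Rightarrow> real^4 \<Rightarrow> real" where
  "mdot p x = (\<Sum>\<mu>\<in>UNIV. \<Sum>\<nu>\<in>UNIV. eta $ \<mu> $ \<nu> * p $ \<mu> * x $ \<nu>)"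

definition partial :: "4 \<Rightarrow> (real^4 \<Rightarrow> 'a::real_normed_vector) \<Rightarrow> real^4 \<Rightarrow> 'a" where
  "partial \<mu> f x = frechet_derivative f (at x) (axis \<mu> 1)"

definition partials :: "4 list \<Rightarrow> (real^4 \<Rightarrow> 'a::real_normed_vector) \<Rightarrow> real^4 \<Rightarrow> 'a" where
  "partials \<alpha>s f = foldr partial \<alpha>s f"

definition smooth :: "(real^4 \<Rightarrow> 'a::real_normed_vector) \<Rightarrow> bool" where
  "smooth f \<longleftrightarrow> (\<forall>\<alpha>s x. partials \<alpha>s f differentiable (at x))"


section \<open>The classical Einstein Lagrangian\<close>

text \<open>\<open>christoffel g x \<tau> \<kappa> \<rho>\<close> is \<open>\<Gamma>\<^sup>\<tau>\<^sub>\<kappa>\<^sub>\<rho>\<close>; the metric field \<open>g\<close> has lower indices.\<close>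

definition christoffel :: "(real^4 \<Rightarrow> real^4^4) \<Rightarrow> real^4 \<Rightarrow> 4 \<Rightarrow> 4 \<Rightarrow> 4 \<Rightarrow> real" where
  "christoffel g x \<tau> \<kappa> \<rho> = 1 / 2 * (\<Sum>\<mu>\<in>UNIV. matrix_inv (g x) $ \<tau> $ \<mu> *
     (partial \<kappa> (\<lambda>y. g y $ \<rho> $ \<mu>) x + partial \<rho> (\<lambda>y. g y $ \<kappa> $ \<mu>) x
      - partial \<mu> (\<lambda>y. g y $ \<kappa> $ \<rho>) x))"

definition gothic :: "real^4^4 \<Rightarrow> real^4^4" where
  "gothic g = sqrt (- det g) *\<^sub>R matrix_inv g"

definition einstein_density :: "(real^4 \<Rightarrow> real^4^4) \<Rightarrow> real^4 \<Rightarrow> real" where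
  "einstein_density g x = sqrt (- det (g x)) * (\<Sum>\<mu>\<in>UNIV. \<Sum>\<nu>\<in>UNIV. matrix_inv (g x) $ \<mu> $ \<nu> *
     (\<Sum>\<alpha>\<in>UNIV. \<Sum>\<beta>\<in>UNIV. christoffel g x \<alpha> \<mu> \<nu> * christoffel g x \<beta> \<alpha> \<beta>
                            - christoffel g x \<alpha> \<mu> \<beta> * christoffel g x \<beta> \<nu> \<alpha>))"

text \<open>Since \<open>det (gothic g) = det g\<close>, the equation \<open>gothic g = G\<close> has exactly one solution with
  \<open>det g < 0\<close> when \<open>det G < 0\<close>. For \<open>G\<close> symmetric and close to \<open>eta\<close> this solution is
  close to \<open>eta\<close>, hence Lorentzian.\<close>

definition metric_of_gothic :: "real^4^4 \<Rightarrow> real^4^4" where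
  "metric_of_gothic G = (THE g. det g < 0 \<and> gothic g = G)"

lemma matrix_inv_props:
  fixes A :: "real^4^4"
  assumes "det A < 0"
  shows "A ** matrix_inv A = mat 1" "matrix_inv A ** A = mat 1"
proof -
  have "\<exists>B. A ** B = mat 1 \<and> B ** A = mat 1"
    using assms by (metis invertible_def invertible_det_nz less_irrefl)
  then have "A ** matrix_inv A = mat 1 \<and> matrix_inv A ** A = mat 1"
    unfolding matrix_inv_def by (rule someI_ex)
  then show "A ** matrix_inv A = mat 1" "matrix_inv A ** A = mat 1" by auto
qed

lemma matrix_inv_eqI:
  fixes A B :: "real^4^4"
  assumes "det A < 0" "A ** B = mat 1"
  shows "matrix_inv A = B"
  by (metis assms matrix_inv_props(2) matrix_mul_assoc matrix_mul_lid matrix_mul_rid)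

lemma det_gothic:
  fixes A :: "real^4^4"
  assumes "det A < 0"
  shows "det (gothic A) = det A"
proof -
  have *: "det (s *\<^sub>R B) = s ^ 4 * det B" for s and B :: "real^4^4"
  proof -
    have "s *\<^sub>R B = (\<chi> i. s *s (B $ i))"
      by (simp add: vec_eq_iff)
    then show ?thesis by (simp add: det_rows_mul)
  qed
  have "det A * det (matrix_inv A) = 1"
    using matrix_inv_props(1)[OF assms] by (metis det_I det_mul)
  moreover have "sqrt (- det A) ^ 4 = det A * det A"
    using assms by (simp add: power4_eq_xxxx mult.assoc)
  ultimately show ?thesis
    by (simp add: gothic_def * mult.assoc)
qed

lemma gothic_gothic:
  fixes A :: "real^4^4"
  assumes "det A < 0"
  shows "gothic (gothic A) = A"
proof -
  define s where "s = sqrt (- det A)"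
  have s: "s > 0" using assms by (simp add: s_def)
  have "gothic A ** ((1 / s) *\<^sub>R A) = mat 1"
    using s matrix_inv_props(2)[OF assms]
    by (simp add: gothic_def s_def[symmetric] matrix_scalar_ac flip: scalar_matrix_assoc)
  then have "matrix_inv (gothic A) = (1 / s) *\<^sub>R A"
    using matrix_inv_eqI[of "gothic A"] assms by (simp add: det_gothic)
  then show ?thesis
    using s assms by (simp add: gothic_def[of "gothic A"] det_gothic flip: s_def)
qed

lemma metric_of_gothic_eq:
  assumes "det G < 0"
  shows "metric_of_gothic G = sqrt (- det G) *\<^sub>R matrix_inv G"
  unfolding metric_of_gothic_def gothic_def[of G, symmetric]
  by (rule the_equality) (use assms det_gothic gothic_gothic in auto)

definition metric_of_deviation :: "real \<Rightarrow> (real^4 \<Rightarrow> real^4^4) \<Rightarrow> real^4 \<Rightarrow> real^4^4" where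
  "metric_of_deviation \<kappa> h x = metric_of_gothic (eta + \<kappa> *\<^sub>R h x)"

definition einstein_lagrangian :: "real \<Rightarrow> (real^4 \<Rightarrow> real^4^4) \<Rightarrow> real^4 \<Rightarrow> real" where
  "einstein_lagrangian \<kappa> h x = 2 / \<kappa>\<^sup>2 * einstein_density (metric_of_deviation \<kappa> h) x"

text \<open>The punctured neighbourhood accounts for the prefactor \<open>2 / \<kappa>\<^sup>2\<close>; the coefficients \<open>a\<close> are
  uniquely determined by \<open>f\<close>.\<close>

definition has_kappa_expansion :: "(real \<Rightarrow> real) \<Rightarrow> (nat \<Rightarrow> real) \<Rightarrow> bool" where
  "has_kappa_expansion f a \<longleftrightarrow> (\<forall>\<^sub>F \<kappa> in at 0. (\<lambda>n. a n * \<kappa> ^ n) sums f \<kappa>)"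


section \<open>Polynomials in a symmetric tensor field and its derivatives\<close>

text \<open>The jet variable \<open>([\<alpha>\<^sub>1, \<dots>, \<alpha>\<^sub>r], \<mu>, \<nu>)\<close> stands for \<open>\<partial>\<^sub>\<alpha>\<^sub>1 \<dots> \<partial>\<^sub>\<alpha>\<^sub>r h\<^sup>\<mu>\<^sup>\<nu>\<close>. A monomial is a multiset of
  jet variables, so \<open>jet_poly\<close> is the commutative polynomial ring over \<open>\<real>\<close> in
  the jet variables. Relations between the variables (such as \<open>h\<^sup>\<mu>\<^sup>\<nu> = h\<^sup>\<nu>\<^sup>\<mu>\<close>) are not built
  in; they hold after evaluation on a field that satisfies them.\<close>

type_synonym jet = "4 list \<times> 4 \<times> 4"
type_synonym jet_poly = "jet multiset \<Rightarrow>\<^sub>0 real"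

definition jvar :: "jet \<Rightarrow> jet_poly" where
  "jvar j = Poly_Mapping.single {#j#} 1"

definition jconst :: "real \<Rightarrow> jet_poly" where
  "jconst r = Poly_Mapping.single {#} r"

definition hvar :: "jet_poly^4^4" where
  "hvar = (\<chi> \<mu> \<nu>. jvar ([], \<mu>, \<nu>))"

definition dhvar :: "4 \<Rightarrow> jet_poly^4^4" where
  "dhvar \<alpha> = (\<chi> \<mu> \<nu>. jvar ([\<alpha>], \<mu>, \<nu>))"

text \<open>Matrix product of tensors with two upper indices: \<open>A\<^sup>\<mu>\<^sup>\<kappa> \<eta>\<^sub>\<kappa>\<^sub>\<lambda> B\<^sup>\<lambda>\<^sup>\<nu>\<close>, and its trace
  \<open>\<eta>\<^sub>\<mu>\<^sub>\<nu> A\<^sup>\<mu>\<^sup>\<nu>\<close>.\<close>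

definition tprod :: "jet_poly^4^4 \<Rightarrow> jet_poly^4^4 \<Rightarrow> jet_poly^4^4" (infixl "\<diamondop>" 70) where
  "A \<diamondop> B = A ** eta ** B"

definition ttrace :: "jet_poly^4^4 \<Rightarrow> jet_poly" where
  "ttrace A = (\<Sum>\<mu>\<in>UNIV. \<Sum>\<nu>\<in>UNIV. eta $ \<mu> $ \<nu> * A $ \<mu> $ \<nu>)"

definition L2_poly :: jet_poly where
  "L2_poly =
     - 2 * (\<Sum>\<mu>\<in>UNIV. \<Sum>\<nu>\<in>UNIV. (dhvar \<nu> \<diamondop> hvar \<diamondop> hvar \<diamondop> dhvar \<mu>) $ \<mu> $ \<nu>)
     - jconst (1 / 2) * (\<Sum>\<mu>\<in>UNIV. \<Sum>\<nu>\<in>UNIV. eta $ \<mu> $ \<nu> *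
         ttrace (hvar \<diamondop> dhvar \<mu>) * ttrace (hvar \<diamondop> dhvar \<nu>))
     - 2 * (\<Sum>\<mu>\<in>UNIV. \<Sum>\<nu>\<in>UNIV. ttrace (hvar \<diamondop> dhvar \<mu> \<diamondop> dhvar \<nu>) * hvar $ \<mu> $ \<nu>)"

definition classical_jet :: "(real^4 \<Rightarrow> real^4^4) \<Rightarrow> real^4 \<Rightarrow> jet \<Rightarrow> real" where
  "classical_jet h x = (\<lambda>(\<alpha>s, \<mu>, \<nu>). partials \<alpha>s (\<lambda>y. h y $ \<mu> $ \<nu>) x)"

definition classical_value :: "jet_poly \<Rightarrow> (real^4 \<Rightarrow> real^4^4) \<Rightarrow> real^4 \<Rightarrow> real" where
  "classical_value P h x =
     (\<Sum>m\<in>Poly_Mapping.keys P. Poly_Mapping.lookup P m * prod_mset (image_mset (classical_jet h x) m))"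

text \<open>\<open>P\<close> is the classical quartic self-interaction \<open>L\<^sub>2[h]\<close>, i.e. \<open>\<kappa>\<^sup>2/2 \<cdot> P[h]\<close> is the \<open>\<kappa>\<^sup>2\<close> term
  of the Einstein Lagrangian. This determines \<open>P\<close> up to \<open>h\<^sup>\<mu>\<^sup>\<nu> = h\<^sup>\<nu>\<^sup>\<mu>\<close> and the order of
  derivatives.\<close>

definition is_classical_L2 :: "jet_poly \<Rightarrow> bool" where
  "is_classical_L2 P \<longleftrightarrow> (\<forall>h x. smooth h \<longrightarrow> (\<forall>y. transpose (h y) = h y) \<longrightarrow>
     (\<exists>a. has_kappa_expansion (\<lambda>\<kappa>. einstein_lagrangian \<kappa> h x) a \<and>
          (\<forall>\<kappa>. \<kappa>\<^sup>2 / 2 * classical_value P h x = a 2 * \<kappa>\<^sup>2)))"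


section \<open>Fock space of massless particles of helicity \<open>\<plusminus>2\<close>\<close>

text \<open>A one-particle label is a momentum together with a helicity (\<open>True\<close> for \<open>+2\<close>, \<open>False\<close> for
  \<open>-2\<close>), with the Lorentz invariant measure \<open>d\<^sup>3p / ((2\<pi>)\<^sup>3 2|p|)\<close>.\<close>

type_synonym mode = "(real^3) \<times> bool"

definition shell_measure :: "mode measure" where
  "shell_measure = density (lborel \<Otimes>\<^sub>M count_space UNIV)
     (\<lambda>k. ennreal (1 / ((2 * pi) ^ 3 * (2 * norm (fst k)))))"

text \<open>The \<open>n\<close>-particle component of a Fock vector is a function of the configurations
  \<open>(k\<^sub>0, \<dots>, k\<^sub>n\<^sub>-\<^sub>1)\<close>, the elements of \<open>space (config n)\<close>.\<close>

type_synonym fock = "nat \<Rightarrow> (nat \<Rightarrow> mode) \<Rightarrow> complex"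

definition config :: "nat \<Rightarrow> (nat \<Rightarrow> mode) measure" where
  "config n = PiM {..<n} (\<lambda>_. shell_measure)"

text \<open>The dense domain of vectors with finitely many particles and bounded wave functions supported
  in a compact set of nonzero momenta. Wick polynomials at a point are sesquilinear forms on it.\<close>

definition fock_domain :: "fock set" where
  "fock_domain = {\<psi>.
     (\<exists>N. \<forall>n\<ge>N. \<forall>K\<in>space (config n). \<psi> n K = 0) \<and>
     (\<forall>n. \<psi> n \<in> borel_measurable (config n)) \<and>
     (\<forall>n \<pi>. \<pi> permutes {..<n} \<longrightarrow> (\<forall>K\<in>space (config n). \<psi> n (K \<circ> \<pi>) = \<psi> n K)) \<and>
     (\<exists>B. \<forall>n. \<forall>K\<in>space (config n). norm (\<psi> n K) \<le> B) \<and>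
     (\<exists>r R. 0 < r \<and> (\<forall>n. \<forall>K\<in>space (config n). \<psi> n K \<noteq> 0 \<longrightarrow>
        (\<forall>i<n. r \<le> norm (fst (K i)) \<and> norm (fst (K i)) \<le> R)))}"

definition fock_inner :: "fock \<Rightarrow> fock \<Rightarrow> complex" where
  "fock_inner \<phi> \<psi> = suminf (\<lambda>n. LINT K|config n. cnj (\<phi> n K) * \<psi> n K)"

text \<open>\<open>annihilate u\<close> is \<open>\<integral> u(k) a(k) dk\<close>; the configuration \<open>case_nat k K\<close> is \<open>(k, K\<^sub>0, K\<^sub>1, \<dots>)\<close>.\<close>

definition annihilate :: "(mode \<Rightarrow> complex) \<Rightarrow> fock \<Rightarrow> fock" where
  "annihilate u \<psi> = (\<lambda>n K. of_real (sqrt (real (Suc n))) *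
     (LINT k|shell_measure. u k * \<psi> (Suc n) (case_nat k K)))"

text \<open>\<open>wick_form [u\<^sub>1, \<dots>, u\<^sub>r] \<phi> \<psi>\<close> is the matrix element \<open>\<langle>\<phi>, :A\<^sub>1 \<dots> A\<^sub>r: \<psi>\<rangle>\<close> of the Wick
  product of the hermitian fields \<open>A\<^sub>i = annihilate u\<^sub>i + (annihilate u\<^sub>i)\<^sup>*\<close>. The recursion is
  \<open>:A X: = A\<^sup>+ :X: + :X: A\<^sup>-\<close> with the creation part \<open>A\<^sup>+\<close> moved to the left argument, where it
  acts as its adjoint \<open>A\<^sup>-\<close>.\<close>

fun wick_form :: "(mode \<Rightarrow> complex) list \<Rightarrow> fock \<Rightarrow> fock \<Rightarrow> complex" where
  "wick_form [] \<phi> \<psi> = fock_inner \<phi> \<psi>"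
| "wick_form (u # us) \<phi> \<psi> = wick_form us (annihilate u \<phi>) \<psi> + wick_form us \<phi> (annihilate u \<psi>)"


section \<open>The string-localized graviton field\<close>

definition spatial :: "real^3 \<Rightarrow> real^4" where
  "spatial v = (\<chi> \<mu>. if \<mu> = 0 then 0 else if \<mu> = 1 then v $ 1 else if \<mu> = 2 then v $ 2 else v $ 3)"

definition on_shell :: "real^3 \<Rightarrow> real^4" where
  "on_shell p = norm p *\<^sub>R axis 0 1 + spatial p"

text \<open>A measurable choice of a unit vector orthogonal to each momentum. It fixes the phases of the
  polarization vectors; different choices give unitarily equivalent fields.\<close>

definition transverse_frame :: "(real^3 \<Rightarrow> real^3) \<Rightarrow> bool" where
  "transverse_frame a \<longleftrightarrow> a \<in> borel_measurable borel \<and>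
     (\<forall>p. p \<noteq> 0 \<longrightarrow> norm (a p) = 1 \<and> a p \<bullet> p = 0)"

lemma ex_transverse_frame: "\<exists>a. transverse_frame a"
proof -
  define a :: "real^3 \<Rightarrow> real^3" where
    "a = (\<lambda>p. if p $ 1 = 0 \<and> p $ 2 = 0 then axis 1 1
              else (1 / sqrt ((p $ 1)\<^sup>2 + (p $ 2)\<^sup>2)) *\<^sub>R (p $ 1 *\<^sub>R axis 2 1 - p $ 2 *\<^sub>R axis 1 1))"
  have "a \<in> borel_measurable borel"
    unfolding a_def by measurable
  moreover have "norm (a p) = 1 \<and> a p \<bullet> p = 0" for p
  proof (cases "p $ 1 = 0 \<and> p $ 2 = 0")
    case True
    then show ?thesis by (simp add: a_def inner_axis' norm_axis_1)
  next
    case False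
    then have "(p $ 1)\<^sup>2 + (p $ 2)\<^sup>2 > 0"
      by (simp add: sum_power2_gt_zero_iff)
    with False show ?thesis
      by (simp add: a_def inner_vec_def sum_3 axis_def norm_eq_sqrt_inner power_divide add.commute
          flip: power2_eq_square add_divide_distrib)
  qed
  ultimately show ?thesis unfolding transverse_frame_def by blast
qed

text \<open>\<open>(0, a(p) \<plusminus> i p/|p| \<times> a(p)) / \<surd>2\<close>, the polarization vector of helicity \<open>\<plusminus>1\<close> (upper index).
  Its tensor square is the polarization tensor of helicity \<open>\<plusminus>2\<close>.\<close>

definition polarization :: "(real^3 \<Rightarrow> real^3) \<Rightarrow> mode \<Rightarrow> complex^4" where
  "polarization a = (\<lambda>(p, \<sigma>). \<chi> \<mu>.
     (of_real (spatial (a p) $ \<mu>)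
      + (if \<sigma> then \<i> else - \<i>) * of_real (spatial (cross3 ((1 / norm p) *\<^sub>R p) (a p)) $ \<mu>))
     / of_real (sqrt 2))"

text \<open>The coefficient of the annihilation operator \<open>a(k)\<close> in the field strength
  \<open>F\<^bsub>[\<mu>\<kappa>][\<nu>\<rho>]\<^esub>(x)\<close>: the linearized curvature
  \<open>\<partial>\<^sub>\<mu>\<partial>\<^sub>\<nu>A\<^sub>\<kappa>\<^sub>\<rho> - \<partial>\<^sub>\<kappa>\<partial>\<^sub>\<nu>A\<^sub>\<mu>\<^sub>\<rho> - \<partial>\<^sub>\<mu>\<partial>\<^sub>\<rho>A\<^sub>\<kappa>\<^sub>\<nu> + \<partial>\<^sub>\<kappa>\<partial>\<^sub>\<rho>A\<^sub>\<mu>\<^sub>\<nu>\<close> of the plane wave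
  \<open>A\<^sub>\<kappa>\<^sub>\<rho>(x) = e\<^sub>\<kappa> e\<^sub>\<rho> exp(-ipx)\<close>.\<close>

definition F_mode :: "(real^3 \<Rightarrow> real^3) \<Rightarrow> 4 \<Rightarrow> 4 \<Rightarrow> 4 \<Rightarrow> 4 \<Rightarrow> mode \<Rightarrow> real^4 \<Rightarrow> complex" where
  "F_mode a \<mu> \<kappa> \<nu> \<rho> k x =
     (let p = (\<lambda>\<mu>. of_real ((eta *v on_shell (fst k)) $ \<mu>) :: complex);
          e = (\<lambda>\<mu>. (eta *v polarization a k) $ \<mu>)
      in - (p \<mu> * e \<kappa> - p \<kappa> * e \<mu>) * (p \<nu> * e \<rho> - p \<rho> * e \<nu>) * cis (- mdot (on_shell (fst k)) x))"

definition string_smearing :: "(real^4 \<Rightarrow> real) \<Rightarrow> bool" where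
  "string_smearing c \<longleftrightarrow> smooth c \<and>
     (\<exists>S. compact S \<and> S \<subseteq> {e. mdot e e < 0} \<and> (\<forall>e. e \<notin> S \<longrightarrow> c e = 0)) \<and>
     (LINT e|lborel. c e) = 1"

text \<open>The string integration \<open>I\<^sub>c\<^sup>\<mu>\<close>. On a plane wave the integral over \<open>s\<close> exists only after
  smearing in the direction \<open>e\<close>, as usual for the distributional kernels of quantum fields. The
  integration over \<open>e\<close> is therefore performed first; it makes the integrand rapidly decreasing in
  \<open>s\<close>.\<close>

definition string_int ::
    "(real^4 \<Rightarrow> real) \<Rightarrow> 4 \<Rightarrow> (real^4 \<Rightarrow> complex) \<Rightarrow> real^4 \<Rightarrow> complex" where
  "string_int c \<mu> f x =
     (LINT s:{0..}|lborel. (LINT e|lborel. of_real (c e * e $ \<mu>) * f (x + s *\<^sub>R e)))"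

text \<open>The annihilation coefficients of \<open>h\<^sub>\<mu>\<^sub>\<nu>(x;c) = I\<^sub>c\<^sup>\<kappa> I\<^sub>c\<^sup>\<rho> F\<^bsub>[\<mu>\<kappa>][\<nu>\<rho>]\<^esub>(x)\<close>, of \<open>h\<^sup>\<mu>\<^sup>\<nu>(x;c)\<close>, and of
  the derivatives of the latter.\<close>

definition h_mode_lower ::
    "(real^4 \<Rightarrow> real) \<Rightarrow> (real^3 \<Rightarrow> real^3) \<Rightarrow> 4 \<Rightarrow> 4 \<Rightarrow> mode \<Rightarrow> real^4 \<Rightarrow> complex" where
  "h_mode_lower c a \<mu> \<nu> k x =
     (\<Sum>\<kappa>\<in>UNIV. \<Sum>\<rho>\<in>UNIV. string_int c \<kappa> (string_int c \<rho> (F_mode a \<mu> \<kappa> \<nu> \<rho> k)) x)"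

definition h_mode ::
    "(real^4 \<Rightarrow> real) \<Rightarrow> (real^3 \<Rightarrow> real^3) \<Rightarrow> 4 \<Rightarrow> 4 \<Rightarrow> mode \<Rightarrow> real^4 \<Rightarrow> complex" where
  "h_mode c a \<mu> \<nu> k x =
     (\<Sum>\<mu>'\<in>UNIV. \<Sum>\<nu>'\<in>UNIV. eta $ \<mu> $ \<mu>' * eta $ \<nu> $ \<nu>' * h_mode_lower c a \<mu>' \<nu>' k x)"

definition quantum_jet ::
    "(real^4 \<Rightarrow> real) \<Rightarrow> (real^3 \<Rightarrow> real^3) \<Rightarrow> real^4 \<Rightarrow> jet \<Rightarrow> mode \<Rightarrow> complex" where
  "quantum_jet c a x = (\<lambda>(\<alpha>s, \<mu>, \<nu>) k. partials \<alpha>s (h_mode c a \<mu> \<nu> k) x)"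

text \<open>\<open>wick_value c a P x \<phi> \<psi>\<close> is \<open>\<langle>\<phi>, :P[h(x;c)]: \<psi>\<rangle>\<close>. The factors of a monomial may be listed
  in any order, because Wick products are commutative.\<close>

definition wick_value ::
    "(real^4 \<Rightarrow> real) \<Rightarrow> (real^3 \<Rightarrow> real^3) \<Rightarrow> jet_poly \<Rightarrow> real^4 \<Rightarrow> fock \<Rightarrow> fock \<Rightarrow> complex" where
  "wick_value c a P x \<phi> \<psi> = (\<Sum>m\<in>Poly_Mapping.keys P. of_real (Poly_Mapping.lookup P m) *
     wick_form (map (quantum_jet c a x) (SOME js. mset js = m)) \<phi> \<psi>)"

definition equal_up_to_divergence ::
    "(real^4 \<Rightarrow> real) \<Rightarrow> (real^3 \<Rightarrow> real^3) \<Rightarrow> jet_poly \<Rightarrow> jet_poly \<Rightarrow> bool" where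
  "equal_up_to_divergence c a P P' \<longleftrightarrow> (\<exists>Q :: 4 \<Rightarrow> jet_poly.
     \<forall>\<phi>\<in>fock_domain. \<forall>\<psi>\<in>fock_domain. \<forall>x.
       (\<forall>\<mu>. (\<lambda>y. wick_value c a (Q \<mu>) y \<phi> \<psi>) differentiable (at x)) \<and>
       wick_value c a P x \<phi> \<psi> - wick_value c a P' x \<phi> \<psi>
         = (\<Sum>\<mu>\<in>UNIV. partial \<mu> (\<lambda>y. wick_value c a (Q \<mu>) y \<phi> \<psi>) x))"

end

theory Submission
  imports Defs
begin

text \<open>With the density \<open>M = \<surd>(-g) g\<^sup>\<mu>\<^sup>\<nu> = \<eta> + \<kappa>h\<close> and its inverse matrix \<open>G\<close>, the Christoffel symbols
  turn the Einstein Lagrangian into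
  \<open>1/2 (M\<^sup>a\<^sup>b tr(G \<partial>\<^sub>ah G \<partial>\<^sub>bh) - 1/2 M\<^sup>a\<^sup>b tr(G \<partial>\<^sub>ah) tr(G \<partial>\<^sub>bh) - 2 \<partial>\<^sub>ah\<^sup>b\<^sup>m G\<^sub>m\<^sub>n \<partial>\<^sub>bh\<^sup>n\<^sup>a)\<close>.
  Inserting \<open>G = \<eta> - \<kappa>h + \<kappa>\<^sup>2hh - \<dots>\<close> gives the quartic term. It is the asserted Wick polynomial plus
  terms with a factor \<open>tr(\<partial>h)\<close>, which vanish on the quantum field, plus
  \<open>2 tr(hh \<partial>\<^sub>\<rho>h \<partial>\<^sup>\<rho>h) + tr(h \<partial>\<^sub>\<rho>h h \<partial>\<^sup>\<rho>h) = \<partial>\<^sub>\<rho> tr(hhh \<partial>\<^sup>\<rho>h) - tr(hhh \<box>h)\<close>.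

  The modes of the string-localized field are plane waves whose amplitudes are tensor squares of
  null vectors, so tracelessness and the wave equation are algebraic. Wick products are sesquilinear
  forms in which a translation of the fields is a unitary multiplication operator on the Fock vectors;
  hence they are differentiable and obey the Leibniz rule as soon as the amplitudes are
  bounded on compact sets of nonzero momenta.\<close>

text \<open>Three obstacles shape the development. \<open>has_kappa_expansion\<close> demands a
  convergent series, so a Taylor estimate is not enough: analyticity of G in \<kappa> comes from
  Cramer's rule, the coefficients from the Neumann identity with a third-order remainder. Each of
  the two derivatives of the gothic metric in the density brings a factor \<kappa>, which cancels
  the prefactor 2 / \<kappa>^2, so second order in G is all that the quartic term needs. Next,
  string integration formally divides by a momentum and is controlled only away from p = 0. Bounds
  are therefore stated on shells r \<le> |p| \<le> R, with a particle cutoff N and a sup bound B;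
  annihilation, translations and their generators keep r, R and N and change at most B. Finally, jet
  polynomials are free of relations, so the field identities enter as an ideal of polynomials whose
  Wick value vanishes.\<close>

abbreviation sum_all :: "('a \<Rightarrow> 'b::comm_monoid_add) \<Rightarrow> 'b" (binder "\<Sum>\<^sub>U" 10) where
  "sum_all f \<equiv> sum f UNIV"

subsection \<open>The Einstein density as a function of the gothic metric\<close>

text \<open>The bilinear form that J induces on three-index tensors. With J the inverse metric,
  products of Christoffel symbols become pairings of index permutations of the derivatives of the
  metric.\<close>

definition contract3 :: "real^'n^'n \<Rightarrow> ('n \<Rightarrow> 'n \<Rightarrow> 'n \<Rightarrow> real) \<Rightarrow> ('n \<Rightarrow> 'n \<Rightarrow> 'n \<Rightarrow> real) \<Rightarrow> real" where
  "contract3 J f g = (\<Sum>\<^sub>U a b c. f a b c *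
     (\<Sum>\<^sub>U a' b' c'. J $ a $ a' * J $ b $ b' * J $ c $ c' * g a' b' c'))"

lemma contract3_linear:
  "contract3 J (\<lambda>a b c. f a b c + f' a b c) g = contract3 J f g + contract3 J f' g"
  "contract3 J (\<lambda>a b c. f a b c - f' a b c) g = contract3 J f g - contract3 J f' g"
  "contract3 J (\<lambda>a b c. k * f a b c) g = k * contract3 J f g"
  "contract3 J f (\<lambda>a b c. g a b c + g' a b c) = contract3 J f g + contract3 J f g'"
  "contract3 J f (\<lambda>a b c. g a b c - g' a b c) = contract3 J f g - contract3 J f g'"
  "contract3 J f (\<lambda>a b c. k * g a b c) = k * contract3 J f g"
  by (simp_all add: contract3_def algebra_simps sum.distrib sum_subtractf sum_distrib_left)

text \<open>As one sum over sextuples, a permutation of slots is a bijection of the index set and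
  \<open>sum.reindex_bij_witness\<close> applies at once.\<close>

lemma contract3_tuple:
  "contract3 J f g = (\<Sum>(a,b,c,a',b',c')\<in>UNIV. f a b c * (J $ a $ a' * J $ b $ b' * J $ c $ c' * g a' b' c'))"
  unfolding contract3_def sum_distrib_left by (simp only: sum.cartesian_product UNIV_Times_UNIV)

lemma contract3_swap12:
  "contract3 J (\<lambda>a b c. f b a c) (\<lambda>a b c. g b a c) = contract3 J f g"
  unfolding contract3_tuple
  by (rule sum.reindex_bij_witness[of _ "\<lambda>(a,b,c,a',b',c'). (b,a,c,b',a',c')" "\<lambda>(a,b,c,a',b',c'). (b,a,c,b',a',c')"])
    auto

lemma contract3_swap23:
  "contract3 J (\<lambda>a b c. f a c b) (\<lambda>a b c. g a c b) = contract3 J f g"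
  unfolding contract3_tuple
  by (rule sum.reindex_bij_witness[of _ "\<lambda>(a,b,c,a',b',c'). (a,c,b,a',c',b')" "\<lambda>(a,b,c,a',b',c'). (a,c,b,a',c',b')"])
    auto

lemma contract3_scaleR: "contract3 (k *\<^sub>R J) f g = k ^ 3 * contract3 J f g"
  by (simp add: contract3_def sum_distrib_left power3_eq_cube mult_ac)

lemma transpose_eq_self: "transpose A = A \<Longrightarrow> A $ a $ b = A $ b $ a"
  by (drule arg_cong[where f = "\<lambda>X. X $ b $ a"]) (simp add: transpose_def)

text \<open>By the symmetry of p its permutations are determined by the slot that holds the
  derivative index: \<open>p\<close>, \<open>?E2\<close>, \<open>?E3\<close>. Permuting the slots of
  both arguments preserves the pairing, so only two values occur, X for equal and Y for different
  arguments, and the product of E2 + E3 - p with E2 + p - E3 collects to 2Y - X.\<close>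

lemma contract3_christoffel:
  assumes p: "\<And>a b c. p a b c = p a c b"
  shows "contract3 J (\<lambda>a b c. p b c a + p c b a - p a b c) (\<lambda>a b c. p b a c + p a b c - p c b a)
       = 2 * contract3 J p (\<lambda>a b c. p b a c) - contract3 J p p"
proof -
  let ?E2 = "\<lambda>a b c. p b a c" and ?E3 = "\<lambda>a b c. p c a b"
  have 1: "(\<lambda>a b c. p b c a + p c b a - p a b c) = (\<lambda>a b c. ?E2 a b c + ?E3 a b c - p a b c)"
    by (intro ext) (metis p)
  have 2: "(\<lambda>a b c. p b a c + p a b c - p c b a) = (\<lambda>a b c. ?E2 a b c + p a b c - ?E3 a b c)"
    by (intro ext) (metis p)
  have e22: "contract3 J ?E2 ?E2 = contract3 J p p"
    by (rule contract3_swap12)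
  have e33: "contract3 J ?E3 ?E3 = contract3 J p p"
    using contract3_swap23[of J ?E2 ?E2] e22 by simp
  have e21: "contract3 J ?E2 p = contract3 J p ?E2"
    using contract3_swap12[of J p ?E2] by simp
  have e13: "contract3 J p ?E3 = contract3 J p ?E2"
    using contract3_swap23[of J p ?E2] p by simp
  have e31: "contract3 J ?E3 p = contract3 J p ?E2"
    using contract3_swap23[of J ?E2 p] p e21 by simp
  have e23: "contract3 J ?E2 ?E3 = contract3 J p ?E2"
    using contract3_swap12[of J p "\<lambda>a b c. p c b a"] p e13 by simp
  have e32: "contract3 J ?E3 ?E2 = contract3 J p ?E2"
    using contract3_swap23[of J ?E2 ?E3] e23 by simp
  show ?thesis
    unfolding 1 2
    by (simp only: contract3_linear e22 e33 e21 e13 e31 e23 e32)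
qed

text \<open>Raising the last two indices becomes a matrix product, so that M D M can collapse to -N
  when D is the derivative of the inverse of M and N that of M.\<close>

lemma contract3_raise:
  "contract3 J (\<lambda>a b c. F a $ b $ c) g =
     (\<Sum>\<^sub>U a a' b c. J $ a $ a' * (transpose J ** F a ** J) $ b $ c * g a' b c)"
proof -
  have "(\<Sum>\<^sub>U b c. F a $ b $ c *
     (\<Sum>\<^sub>U a' b' c'. J $ a $ a' * J $ b $ b' * J $ c $ c' * g a' b' c')) =
     (\<Sum>\<^sub>U a' b c. J $ a $ a' * (transpose J ** F a ** J) $ b $ c * g a' b c)" (is "?L = ?R") for a
  proof -
    have "?L = (\<Sum>(b,c,a',b',c')\<in>UNIV. F a $ b $ c * (J $ a $ a' * J $ b $ b' * J $ c $ c' * g a' b' c'))"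
      unfolding sum_distrib_left by (simp only: sum.cartesian_product UNIV_Times_UNIV)
    also have "\<dots> = (\<Sum>(a',b',c',c,b)\<in>UNIV. F a $ b $ c * (J $ a $ a' * J $ b $ b' * J $ c $ c' * g a' b' c'))"
      by (rule sum.reindex_bij_witness[of _ "\<lambda>(a',b',c',c,b). (b,c,a',b',c')" "\<lambda>(b,c,a',b',c'). (a',b',c',c,b)"]) auto
    also have "\<dots> = ?R"
      unfolding matrix_matrix_mult_def transpose_def vec_lambda_beta sum_distrib_left sum_distrib_right
      by (simp only: sum.cartesian_product UNIV_Times_UNIV mult_ac)
    finally show ?thesis .
  qed
  then show ?thesis by (simp add: contract3_def)
qed

text \<open>The upper index of each symbol meets a lower index of the other. Together with the
  explicit J these are three contractions between the two brackets of derivatives, that is, a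
  \<open>contract3\<close>.\<close>

lemma christoffel_quadratic:
  fixes J :: "real^'n^'n"
  assumes J: "transpose J = J" and p: "\<And>a b c. p a b c = p a c b"
    and \<Gamma>: "\<And>a m b. \<Gamma> a m b = 1 / 2 * (\<Sum>\<^sub>U d. J $ a $ d * (p m b d + p b m d - p d m b))"
  shows "(\<Sum>\<^sub>U m n. J $ m $ n * (\<Sum>\<^sub>U a b. \<Gamma> a m b * \<Gamma> b n a)) =
     1 / 2 * contract3 J p (\<lambda>a b c. p b a c) - 1 / 4 * contract3 J p p"
proof -
  have Js: "J $ a $ b = J $ b $ a" for a b
    using J by (rule transpose_eq_self)
  let ?f = "\<lambda>a b c. p b c a + p c b a - p a b c" and ?g = "\<lambda>a b c. p b a c + p a b c - p c b a"
  have "(\<Sum>\<^sub>U m n. J $ m $ n * (\<Sum>\<^sub>U a b. \<Gamma> a m b * \<Gamma> b n a)) =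
    (\<Sum>\<^sub>U m n a b. J $ m $ n * (\<Gamma> a m b * \<Gamma> b n a))"
    by (simp only: sum_distrib_left)
  also have "\<dots> = (\<Sum>\<^sub>U m n a b d e. J $ d $ a * J $ m $ n * J $ b $ e * (?f d m b * ?g a n e) / 4)"
  proof (intro sum.cong refl)
    fix m n a b
    have *: "J $ m $ n * (1/2 * (J $ a $ d * X) * (1/2 * (J $ b $ e * Y))) = J $ d $ a * J $ m $ n * J $ b $ e * (X * Y) / 4" for d e X Y
      by (simp add: Js[of a d])
    show "J $ m $ n * (\<Gamma> a m b * \<Gamma> b n a) = (\<Sum>\<^sub>U d e. J $ d $ a * J $ m $ n * J $ b $ e * (?f d m b * ?g a n e) / 4)"
      unfolding * [symmetric] unfolding \<Gamma> sum_distrib_left[of "1/2"] sum_product by (simp only: sum_distrib_left)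
  qed
  also have "\<dots> = (\<Sum>(m,n,a,b,d,e)\<in>UNIV. J $ d $ a * J $ m $ n * J $ b $ e * (?f d m b * ?g a n e) / 4)"
    by (simp only: sum.cartesian_product UNIV_Times_UNIV)
  \<comment> \<open>The order (d,m,b) against (a,n,e) lists the slots of the two brackets so that
    the three factors J join equal positions.\<close>
  also have "\<dots> = (\<Sum>(d,m,b,a,n,e)\<in>UNIV. J $ d $ a * J $ m $ n * J $ b $ e * (?f d m b * ?g a n e) / 4)"
    by (rule sum.reindex_bij_witness[of _ "\<lambda>(d,m,b,a,n,e). (m,n,a,b,d,e)" "\<lambda>(m,n,a,b,d,e). (d,m,b,a,n,e)"]) auto
  also have "\<dots> = (\<Sum>\<^sub>U d m b a n e. J $ d $ a * J $ m $ n * J $ b $ e * (?f d m b * ?g a n e) / 4)"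
    by (simp only: sum.cartesian_product UNIV_Times_UNIV)
  also have "\<dots> = 1 / 4 * contract3 J ?f ?g"
    unfolding contract3_def sum_distrib_left
    by (intro sum.cong refl) (simp only: mult_ac times_divide_eq_left times_divide_eq_right mult_1_left)
  finally show ?thesis
    unfolding contract3_christoffel[of p, OF p] by simp
qed

lemma trace_mult_conv: "trace (A ** B) = (\<Sum>\<^sub>U b c. A $ b $ c * B $ c $ b)"
  by (simp add: trace_def matrix_matrix_mult_def)

lemma sum_pair_trace:
  assumes "transpose B = B"
  shows "(\<Sum>\<^sub>U b c. A $ b $ c * B $ b $ c) = trace (A ** B)"
proof -
  have "B $ b $ c = B $ c $ b" for b c
    using assms by (rule transpose_eq_self)
  then show ?thesis by (simp add: trace_mult_conv)
qed

lemma sum_contract: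
  fixes A B :: "'a::comm_ring_1^'n^'n"
  shows "(\<Sum>\<^sub>U b. A $ a $ b * B $ b $ c) = (A ** B) $ a $ c"
  by (simp add: matrix_matrix_mult_def)

lemma matrix_mul_uminus:
  fixes A :: "'a::comm_ring_1^'n^'m" and B :: "'a^'k^'n"
  shows "A ** (- B) = - (A ** B)" "(- A) ** B = - (A ** B)"
  by (simp_all add: matrix_matrix_mult_def vec_eq_iff sum_negf)

lemma transpose_uminus: "transpose (- A) = - transpose (A :: 'a::ring_1^'n^'m)"
  by (simp add: transpose_def vec_eq_iff)

lemma trace_uminus: "trace (- A) = - trace (A :: 'a::ring_1^'n^'n)"
  by (simp add: trace_def sum_negf)

lemma sum_rotate3: "(\<Sum>a\<in>A. \<Sum>b\<in>B. \<Sum>c\<in>C. f a b c) = (\<Sum>c\<in>C. \<Sum>a\<in>A. \<Sum>b\<in>B. f a b c)"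
proof -
  have "(\<Sum>a\<in>A. \<Sum>b\<in>B. \<Sum>c\<in>C. f a b c) = (\<Sum>a\<in>A. \<Sum>c\<in>C. \<Sum>b\<in>B. f a b c)"
    by (intro sum.cong refl sum.swap)
  also have "\<dots> = (\<Sum>c\<in>C. \<Sum>a\<in>A. \<Sum>b\<in>B. f a b c)"
    by (rule sum.swap)
  finally show ?thesis .
qed

text \<open>Matrix algebra behind the Lagrangian. \<open>M\<close> plays the gothic metric and
  \<open>s\<close> the volume factor, so the metric is s G and its inverse M / s. \<open>N\<close>,
  \<open>D\<close>, \<open>l\<close> and \<open>p\<close> stand for the derivatives of M, of G, of
  log s and of the metric. Stating the rules of differentiation as hypotheses keeps calculus out of
  the contraction.\<close>

lemma einstein_contraction:
  fixes M G :: "real^4^4"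
  assumes MG: "M ** G = mat 1" "G ** M = mat 1"
    and sym: "transpose M = M" "transpose G = G" "\<And>a. transpose (N a) = N a"
    and D: "\<And>a. D a = - (G ** N a ** G)"
    and l: "\<And>a. l a = 1 / 2 * trace (G ** N a)"
    and s: "s > 0"
    and p: "\<And>a b c. p a b c = s * (D a $ b $ c + l a * G $ b $ c)"
    and \<Gamma>: "\<And>a m b. \<Gamma> a m b = 1 / 2 * (\<Sum>\<^sub>U d. ((1 / s) *\<^sub>R M) $ a $ d * (p m b d + p b m d - p d m b))"
  shows "s * (\<Sum>\<^sub>U m n. ((1 / s) *\<^sub>R M) $ m $ n *
      (\<Sum>\<^sub>U a b. \<Gamma> a m n * \<Gamma> b a b - \<Gamma> a m b * \<Gamma> b n a)) =
    1 / 4 * ((\<Sum>\<^sub>U a b. M $ a $ b * trace (G ** N a ** G ** N b))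
      - 1 / 2 * (\<Sum>\<^sub>U a b. M $ a $ b * (trace (G ** N a) * trace (G ** N b)))
      - 2 * (\<Sum>\<^sub>U a b. (N a ** G ** N b) $ b $ a))"
proof -
  define J where "J = (1 / s) *\<^sub>R M"
  have symD: "transpose (D a) = D a" for a
    by (simp add: D matrix_transpose_mul sym matrix_mul_assoc transpose_uminus)
  have symJ: "transpose J = J" by (simp add: J_def transpose_scalar sym)
  have Ms: "M $ a $ b = M $ b $ a" and Gs: "G $ a $ b = G $ b $ a" for a b
    using sym by (auto intro: transpose_eq_self)
  have Ns: "N d $ a $ b = N d $ b $ a" and Ds: "D d $ a $ b = D d $ b $ a" for a b d
    using sym symD by (auto intro: transpose_eq_self)
  have Js: "J $ a $ b = J $ b $ a" for a b by (simp add: J_def Ms[of a b])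
  have ps: "p a b c = p a c b" for a b c by (simp add: p Ds[of a b c] Gs[of b c])
  have MD: "M ** D a = - (N a ** G)" for a
    by (simp add: D matrix_mul_assoc MG matrix_mul_uminus)
  have MDM: "M ** D a ** M = - N a" for a
    by (simp add: MD MG matrix_mul_uminus flip: matrix_mul_assoc)
  have trMD: "trace (M ** D a) = - 2 * l a" for a
    by (simp add: MD l trace_uminus trace_mul_sym[of "N a"])
  \<comment> \<open>\<open>e\<close> is the divergence of G. It enters the result only through
    \<open>LE\<close>, which occurs in both products of symbols and cancels in the end.\<close>
  define e where "e = (\<lambda>d. \<Sum>\<^sub>U m n. M $ m $ n * D m $ n $ d)"
  define LE where "LE = (\<Sum>\<^sub>U a d. M $ a $ d * (l a * e d))"
  define LL where "LL = (\<Sum>\<^sub>U a d. M $ a $ d * (l a * l d))"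
  define DD where "DD = (\<Sum>\<^sub>U a b. M $ a $ b * trace (G ** N a ** G ** N b))"
  define DD' where "DD' = (\<Sum>\<^sub>U a b. (N a ** G ** N b) $ b $ a)"
  \<comment> \<open>The trace of the unit matrix brings in the dimension four.\<close>
  have tr_eq: "(\<Sum>\<^sub>U b c. M $ b $ c * G $ b $ c) = 4"
    using sum_pair_trace[OF sym(2), of M] by (simp add: MG trace_I)
  have trD_eq: "(\<Sum>\<^sub>U b c. M $ b $ c * D a $ b $ c) = - 2 * l a" for a
    using sum_pair_trace[OF symD, of M] by (simp add: trMD)
  have MGk: "(\<Sum>\<^sub>U b. M $ a $ b * G $ b $ c) = (if a = c then 1 else 0)" for a c
    by (simp add: sum_contract MG mat_def)
  have lMG: "(\<Sum>\<^sub>U m n. M $ m $ n * (l m * G $ n $ d)) = l d" for d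
  proof -
    have "(\<Sum>\<^sub>U m n. M $ m $ n * (l m * G $ n $ d)) = (\<Sum>\<^sub>U m. l m * (\<Sum>\<^sub>U n. M $ m $ n * G $ n $ d))"
      by (simp add: sum_distrib_left mult_ac)
    then show ?thesis by (simp add: MGk if_distrib cong: if_cong)
  qed

  \<comment> \<open>A contracted symbol is the logarithmic derivative of the volume factor: the two
    parts of p give (- 2 + 4) / 2 = 1 times \<open>l a\<close>.\<close>
  have q: "(\<Sum>\<^sub>U b. \<Gamma> b a b) = l a" for a
  proof -
    have "(\<Sum>\<^sub>U b d. J $ b $ d * p d a b) = (\<Sum>\<^sub>U b d. J $ b $ d * p b a d)"
      by (subst sum.swap, intro sum.cong refl) (metis Js ps)
    then have "(\<Sum>\<^sub>U b. \<Gamma> b a b) = 1 / 2 * (\<Sum>\<^sub>U b d. J $ b $ d * p a b d)"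
      by (simp add: \<Gamma> algebra_simps sum.distrib sum_subtractf sum_distrib_left flip: J_def sum_divide_distrib)
    also have "\<dots> = 1 / 2 * (\<Sum>\<^sub>U b d. M $ b $ d * D a $ b $ d + l a * (M $ b $ d * G $ b $ d))"
      using s by (simp add: p J_def algebra_simps)
    also have "\<dots> = l a"
      by (simp add: sum.distrib trD_eq tr_eq flip: sum_distrib_left)
    finally show ?thesis .
  qed
  \<comment> \<open>The parts proportional to \<open>l\<close> cancel as 1 + 1 - 2 = 0, leaving the
    divergence of G.\<close>
  have r: "(\<Sum>\<^sub>U m n. J $ m $ n * \<Gamma> a m n) = (\<Sum>\<^sub>U d. J $ a $ d * e d)" for a
  proof -
    have 1: "(\<Sum>\<^sub>U m n. J $ m $ n * p m n d) = e d + l d" for d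
    proof -
      have "(\<Sum>\<^sub>U m n. J $ m $ n * p m n d) = (\<Sum>\<^sub>U m n. M $ m $ n * D m $ n $ d + M $ m $ n * (l m * G $ n $ d))"
        using s by (simp add: p J_def algebra_simps)
      then show ?thesis by (simp add: sum.distrib e_def lMG)
    qed
    have 2: "(\<Sum>\<^sub>U m n. J $ m $ n * p n m d) = e d + l d" for d
      unfolding 1[symmetric] by (subst sum.swap, intro sum.cong refl) (metis Js)
    have 3: "(\<Sum>\<^sub>U m n. J $ m $ n * p d m n) = 2 * l d" for d
    proof -
      have "(\<Sum>\<^sub>U m n. J $ m $ n * p d m n) = (\<Sum>\<^sub>U b c. M $ b $ c * D d $ b $ c + l d * (M $ b $ c * G $ b $ c))"
        using s by (simp add: p J_def algebra_simps)
      then show ?thesis by (simp add: sum.distrib trD_eq tr_eq flip: sum_distrib_left)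
    qed
    have "(\<Sum>\<^sub>U m n. J $ m $ n * \<Gamma> a m n) = (\<Sum>\<^sub>U m n d. 1 / 2 * J $ a $ d * (J $ m $ n * (p m n d + p n m d - p d m n)))"
      by (simp add: \<Gamma> sum_distrib_left mult_ac flip: J_def)
    also have "\<dots> = (\<Sum>\<^sub>U d m n. 1 / 2 * J $ a $ d * (J $ m $ n * (p m n d + p n m d - p d m n)))"
      by (rule sum_rotate3)
    also have "\<dots> = (\<Sum>\<^sub>U d. 1 / 2 * J $ a $ d * ((e d + l d) + (e d + l d) - 2 * l d))"
      unfolding 3[symmetric] unfolding 1[symmetric] unfolding 2[unfolded 1[symmetric]]
    proof (rule sum.cong[OF refl])
      fix d
      show "(\<Sum>\<^sub>U m n. 1 / 2 * J $ a $ d * (J $ m $ n * (p m n d + p n m d - p d m n))) =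
         1 / 2 * J $ a $ d * ((\<Sum>\<^sub>U m n. J $ m $ n * p m n d) + (\<Sum>\<^sub>U m n. J $ m $ n * p m n d)
          - (\<Sum>\<^sub>U m n. J $ m $ n * p d m n))"
        using 1[of d] 2[of d]
        by (simp add: ring_distribs sum.distrib sum_subtractf flip: sum_distrib_left sum_divide_distrib)
    qed
    finally show ?thesis by simp
  qed
  have first: "s * (\<Sum>\<^sub>U m n. J $ m $ n * (\<Sum>\<^sub>U a b. \<Gamma> a m n * \<Gamma> b a b)) = LE"
  proof -
    have "(\<Sum>\<^sub>U m n. J $ m $ n * (\<Sum>\<^sub>U a b. \<Gamma> a m n * \<Gamma> b a b)) =
       (\<Sum>\<^sub>U m n a. l a * (J $ m $ n * \<Gamma> a m n))"
    proof (intro sum.cong refl)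
      fix m n
      have "(\<Sum>\<^sub>U b. \<Gamma> a m n * \<Gamma> b a b) = l a * \<Gamma> a m n" for a
        by (simp add: q flip: sum_distrib_left)
      then show "J $ m $ n * (\<Sum>\<^sub>U a b. \<Gamma> a m n * \<Gamma> b a b) = (\<Sum>\<^sub>U a. l a * (J $ m $ n * \<Gamma> a m n))"
        by (simp add: sum_distrib_left mult_ac)
    qed
    also have "\<dots> = (\<Sum>\<^sub>U a m n. l a * (J $ m $ n * \<Gamma> a m n))"
      by (rule sum_rotate3)
    also have "\<dots> = (\<Sum>\<^sub>U a. l a * (\<Sum>\<^sub>U d. J $ a $ d * e d))"
      by (simp add: r flip: sum_distrib_left)
    finally show ?thesis
      using s by (simp add: LE_def J_def sum_distrib_left mult_ac)
  qed

  have raiseD: "contract3 M (\<lambda>a b c. D a $ b $ c) g =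
     - (\<Sum>\<^sub>U a a'. M $ a $ a' * (\<Sum>\<^sub>U b c. N a $ b $ c * g a' b c))" for g
    by (simp add: contract3_raise sym MDM sum_negf sum_distrib_left mult_ac)
  have raiseG: "contract3 M (\<lambda>a b c. l a * G $ b $ c) g =
     (\<Sum>\<^sub>U a a'. M $ a $ a' * (l a * (\<Sum>\<^sub>U b c. M $ b $ c * g a' b c)))" for g
  proof -
    have "contract3 M (\<lambda>a b c. (l a *\<^sub>R G) $ b $ c) g =
     (\<Sum>\<^sub>U a a'. M $ a $ a' * (l a * (\<Sum>\<^sub>U b c. M $ b $ c * g a' b c)))"
      unfolding contract3_raise
      by (simp add: sym MG matrix_scalar_ac sum_distrib_left mult_ac flip: scalar_matrix_assoc)
    then show ?thesis by simp
  qed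
  have NG: "(\<Sum>\<^sub>U b c. N a $ b $ c * G $ b $ c) = 2 * l a" for a
    using sum_pair_trace[OF sym(2), of "N a"] by (simp add: l trace_mul_sym[of "N a"])
  \<comment> \<open>\<open>LL\<close> drops out because the pairing of the two G parts gives 4 and
    each mixed pairing gives - 2.\<close>
  have pp: "contract3 M (\<lambda>a b c. D a $ b $ c + l a * G $ b $ c) (\<lambda>a b c. D a $ b $ c + l a * G $ b $ c) = DD"
  proof -
    have "contract3 M (\<lambda>a b c. l a * G $ b $ c) (\<lambda>a b c. l a * G $ b $ c) = 4 * LL"
    proof -
      have "(\<Sum>\<^sub>U b c. M $ b $ c * (l a' * G $ b $ c)) = 4 * l a'" for a'
        using tr_eq by (simp add: mult.left_commute[of _ "l a'"] flip: sum_distrib_left)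
      then show ?thesis unfolding raiseG by (simp add: LL_def sum_distrib_left mult_ac)
    qed
    moreover have "contract3 M (\<lambda>a b c. l a * G $ b $ c) (\<lambda>a b c. D a $ b $ c) = - 2 * LL"
      unfolding raiseG by (simp add: trD_eq LL_def sum_distrib_left sum_negf mult_ac)
    moreover have "contract3 M (\<lambda>a b c. D a $ b $ c) (\<lambda>a b c. l a * G $ b $ c) = - 2 * LL"
    proof -
      have "(\<Sum>\<^sub>U b c. N a $ b $ c * (l a' * G $ b $ c)) = 2 * (l a * l a')" for a a'
        using NG[of a] by (simp add: mult.left_commute[of _ "l a'"] flip: sum_distrib_left)
      then show ?thesis unfolding raiseD by (simp add: LL_def sum_distrib_left mult_ac sum_negf)
    qed
    moreover have "contract3 M (\<lambda>a b c. D a $ b $ c) (\<lambda>a b c. D a $ b $ c) = DD"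
    proof -
      have "trace (N a ** (G ** N a' ** G)) = trace (G ** N a ** G ** N a')" for a a'
        using trace_mul_sym[of "N a ** G ** N a'" G] by (simp add: matrix_mul_assoc)
      then have "(\<Sum>\<^sub>U b c. N a $ b $ c * D a' $ b $ c) = - trace (G ** N a ** G ** N a')" for a a'
        using sum_pair_trace[OF symD, of "N a"] by (simp add: D matrix_mul_uminus trace_uminus)
      then show ?thesis unfolding raiseD by (simp add: DD_def sum_negf)
    qed
    ultimately show ?thesis by (simp add: contract3_linear)
  qed
  have pp': "contract3 M (\<lambda>a b c. D a $ b $ c + l a * G $ b $ c) (\<lambda>a b c. D b $ a $ c + l b * G $ a $ c) = DD' + 2 * LE + LL"
  proof -
    have "contract3 M (\<lambda>a b c. D a $ b $ c) (\<lambda>a b c. D b $ a $ c) = DD'"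
    proof -
      have "(\<Sum>\<^sub>U a a'. M $ a $ a' * (\<Sum>\<^sub>U b c. N a $ b $ c * D b $ a' $ c)) =
        (\<Sum>\<^sub>U a a' b c. N a $ b $ c * (M $ a $ a' * D b $ a' $ c))"
        by (simp add: sum_distrib_left mult_ac)
      also have "\<dots> = (\<Sum>\<^sub>U a b c a'. N a $ b $ c * (M $ a $ a' * D b $ a' $ c))"
        by (rule sum.cong[OF refl], subst sum.swap, rule sum.cong[OF refl], rule sum.swap)
      also have "\<dots> = - (\<Sum>\<^sub>U a b c. N a $ b $ c * (N b ** G) $ a $ c)"
        by (simp add: sum_contract MD sum_negf flip: sum_distrib_left)
      also have "\<dots> = - DD'"
      proof -
        have "(\<Sum>\<^sub>U c. N a $ b $ c * (N b ** G) $ a $ c) = (N a ** G ** N b) $ b $ a" for a b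
        proof -
          have "(N b ** G) $ a $ c = (G ** N b) $ c $ a" for c
            unfolding matrix_matrix_mult_def by (simp add: Ns[of b a] Gs[of c] mult.commute)
          then show ?thesis by (simp add: sum_contract matrix_mul_assoc)
        qed
        then show ?thesis by (simp add: DD'_def)
      qed
      finally show ?thesis unfolding raiseD by simp
    qed
    moreover have "contract3 M (\<lambda>a b c. D a $ b $ c) (\<lambda>a b c. l b * G $ a $ c) = LE"
    proof -
      have "(\<Sum>\<^sub>U a a'. M $ a $ a' * (\<Sum>\<^sub>U b c. N a $ b $ c * (l b * G $ a' $ c))) =
        (\<Sum>\<^sub>U a a' b c. l b * N a $ b $ c * (M $ a $ a' * G $ a' $ c))"
        by (simp add: sum_distrib_left mult_ac)
      also have "\<dots> = (\<Sum>\<^sub>U a b c a'. l b * N a $ b $ c * (M $ a $ a' * G $ a' $ c))"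
        by (rule sum.cong[OF refl], subst sum.swap, rule sum.cong[OF refl], rule sum.swap)
      also have "\<dots> = (\<Sum>\<^sub>U a b. l b * N a $ b $ a)"
        by (simp add: MGk if_distrib cong: if_cong flip: sum_distrib_left)
      finally have 1: "(\<Sum>\<^sub>U a a'. M $ a $ a' * (\<Sum>\<^sub>U b c. N a $ b $ c * (l b * G $ a' $ c))) =
        (\<Sum>\<^sub>U a b. l b * N a $ b $ a)" .
      have "e d = - (\<Sum>\<^sub>U m. (N m ** G) $ m $ d)" for d
        by (simp add: e_def sum_contract MD sum_negf)
      then have "LE = - (\<Sum>\<^sub>U a d m. l a * ((N m ** G) $ m $ d * M $ d $ a))"
        unfolding LE_def by (simp add: sum_distrib_left mult_ac Ms sum_negf)
      also have "\<dots> = - (\<Sum>\<^sub>U a m d. l a * ((N m ** G) $ m $ d * M $ d $ a))"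
        by (intro arg_cong[where f = uminus] sum.cong refl sum.swap)
      also have "\<dots> = - (\<Sum>\<^sub>U a m. l a * N m $ m $ a)"
        by (simp add: sum_contract MG flip: sum_distrib_left matrix_mul_assoc)
      also have "\<dots> = - (\<Sum>\<^sub>U a b. l b * N a $ b $ a)"
        by (subst sum.swap, intro arg_cong[where f = uminus] sum.cong refl) (metis Ns)
      finally show ?thesis unfolding raiseD 1 by simp
    qed
    moreover have "contract3 M (\<lambda>a b c. l a * G $ b $ c) (\<lambda>a b c. D b $ a $ c) = LE"
      unfolding raiseG by (simp add: LE_def e_def Ds)
    moreover have "contract3 M (\<lambda>a b c. l a * G $ b $ c) (\<lambda>a b c. l b * G $ a $ c) = LL"
      unfolding raiseG using lMG by (simp add: LL_def Gs)
    ultimately show ?thesis by (simp add: contract3_linear)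
  qed
  have p_eq: "p = (\<lambda>a b c. s * (D a $ b $ c + l a * G $ b $ c))"
    by (intro ext p)
  have c3p: "contract3 J p (\<lambda>a b c. s * g a b c) = 1 / s * contract3 M (\<lambda>a b c. D a $ b $ c + l a * G $ b $ c) g" for g
    unfolding p_eq J_def contract3_scaleR using s
    by (simp add: contract3_linear power3_eq_cube field_simps)
  have "s * (\<Sum>\<^sub>U m n. J $ m $ n * (\<Sum>\<^sub>U a b. \<Gamma> a m b * \<Gamma> b n a)) =
     s * (1 / 2 * contract3 J p (\<lambda>a b c. p b a c) - 1 / 4 * contract3 J p p)"
    by (subst christoffel_quadratic[OF symJ ps \<Gamma>[folded J_def]]) simp
  also have "\<dots> = 1 / 2 * (DD' + 2 * LE + LL) - 1 / 4 * DD"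
    using s c3p[of "\<lambda>a b c. D a $ b $ c + l a * G $ b $ c"] c3p[of "\<lambda>a b c. D b $ a $ c + l b * G $ a $ c"]
    by (simp add: pp pp' right_diff_distrib flip: p)
  finally have second: "s * (\<Sum>\<^sub>U m n. J $ m $ n * (\<Sum>\<^sub>U a b. \<Gamma> a m b * \<Gamma> b n a)) =
     1 / 2 * (DD' + 2 * LE + LL) - 1 / 4 * DD" .
  have "LL = 1 / 4 * (\<Sum>\<^sub>U a b. M $ a $ b * (trace (G ** N a) * trace (G ** N b)))"
    by (simp add: LL_def l sum_distrib_left field_simps)
  \<comment> \<open>\<open>LE\<close> from \<open>first\<close> cancels against 1 / 2 * (2 * LE)
    from \<open>second\<close>.\<close>
  with first second show ?thesis
    by (simp add: DD_def DD'_def sum_subtractf right_diff_distrib flip: J_def) (simp add: field_simps)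
qed

section \<open>Derivatives of the determinant, the inverse matrix and the gothic metric\<close>

lemma partialI: "(f has_derivative f') (at x) \<Longrightarrow> partial \<alpha> f x = f' (axis \<alpha> 1)"
  by (simp add: partial_def frechet_derivative_at[symmetric])

lemma has_derivative_cong_nhds:
  assumes "\<forall>\<^sub>F y in nhds x. f y = g y"
  shows "(f has_derivative f') (at x) \<longleftrightarrow> (g has_derivative f') (at x)"
proof -
  have "(g has_derivative f') (at x)" if "\<forall>\<^sub>F y in nhds x. f y = g y" "(f has_derivative f') (at x)" for f g
    by (rule has_derivative_transform_eventually[OF that(2)])
       (use that(1) eventually_nhds_x_imp_x[OF that(1)] in \<open>auto simp: eventually_at_filter elim: eventually_mono\<close>)
  from this[of f g] this[of g f] assms show ?thesis by (auto simp: eq_commute)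
qed

lemma partial_cong_nhds:
  assumes "\<forall>\<^sub>F y in nhds x. f y = g y"
  shows "partial \<alpha> f x = partial \<alpha> g x"
  by (simp add: partial_def frechet_derivative_def has_derivative_cong_nhds[OF assms])

lemma partial_const: "partial \<alpha> (\<lambda>y. c) x = 0"
  by (simp add: partial_def)

lemma partial_cmult:
  fixes f :: "real^4 \<Rightarrow> real"
  assumes "f differentiable (at x)"
  shows "partial \<alpha> (\<lambda>y. c * f y) x = c * partial \<alpha> f x"
proof -
  from assms obtain f' where "(f has_derivative f') (at x)" by (auto simp: differentiable_def)
  then show ?thesis
    by (subst (1 2) partialI) (auto intro!: derivative_eq_intros)
qed

lemma partial_mult:
  fixes f g :: "real^4 \<Rightarrow> real"
  assumes "f differentiable (at x)" "g differentiable (at x)"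
  shows "partial \<alpha> (\<lambda>y. f y * g y) x = f x * partial \<alpha> g x + partial \<alpha> f x * g x"
proof -
  from assms obtain f' g' where f: "(f has_derivative f') (at x)" and g: "(g has_derivative g') (at x)"
    by (auto simp: differentiable_def)
  show ?thesis
    using partialI[OF has_derivative_mult[OF f g]] partialI[OF f] partialI[OF g] by simp
qed

lemma partial_sum:
  assumes "\<And>i. i \<in> I \<Longrightarrow> f i differentiable (at x)"
  shows "partial \<alpha> (\<lambda>y. \<Sum>i\<in>I. f i y) x = (\<Sum>i\<in>I. partial \<alpha> (f i) x)"
proof -
  have f: "(f i has_derivative frechet_derivative (f i) (at x)) (at x)" if "i \<in> I" for i
    using assms[OF that] by (simp add: frechet_derivative_works)
  show ?thesis
    using partialI[OF has_derivative_sum[OF f]] by (simp add: partial_def)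
qed

lemma differentiable_prod:
  fixes f :: "'i \<Rightarrow> 'a::real_normed_vector \<Rightarrow> real"
  assumes "\<And>i. i \<in> I \<Longrightarrow> f i differentiable (at x)"
  shows "(\<lambda>y. \<Prod>i\<in>I. f i y) differentiable (at x)"
proof -
  have "(f i has_derivative frechet_derivative (f i) (at x)) (at x)" if "i \<in> I" for i
    using assms[OF that] by (simp add: frechet_derivative_works)
  then show ?thesis
    by (rule differentiableI[OF has_derivative_prod])
qed

lemma differentiable_det:
  fixes A :: "'a::real_normed_vector \<Rightarrow> real^'n^'n"
  assumes "\<And>i j. (\<lambda>y. A y $ i $ j) differentiable (at x)"
  shows "(\<lambda>y. det (A y)) differentiable (at x)"
proof -
  have "(\<lambda>y. \<Prod>i\<in>UNIV. A y $ i $ p i) differentiable (at x)" for p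
    by (rule differentiable_prod) (rule assms)
  then show ?thesis
    unfolding det_def by (intro differentiable_sum differentiable_mult differentiable_const ballI) auto
qed

text \<open>Once the factor from row i of a Leibniz product is differentiated, the other factors are
  entries of the unit matrix. A permutation other than the identity moves at least two points, hence
  one outside i, and its term vanishes.\<close>

lemma partial_det_at_one:
  fixes A :: "real^4 \<Rightarrow> real^'n^'n"
  assumes A: "\<And>i j. (\<lambda>y. A y $ i $ j) differentiable (at x)" and "A x = mat 1"
  shows "partial \<alpha> (\<lambda>y. det (A y)) x = (\<Sum>\<^sub>U i. partial \<alpha> (\<lambda>y. A y $ i $ i) x)"
proof -
  let ?A' = "\<lambda>i j. frechet_derivative (\<lambda>y. A y $ i $ j) (at x)"
  have A': "((\<lambda>y. A y $ i $ j) has_derivative ?A' i j) (at x)" for i j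
    using A by (simp add: frechet_derivative_works)
  have *: "(\<Prod>j\<in>UNIV - {i}. A x $ j $ p j) = (if p = id then 1 else 0)" if "p permutes UNIV" for p and i :: 'n
  proof (cases "p = id")
    case False
    obtain j where j: "j \<noteq> i" "p j \<noteq> j"
    proof (rule ccontr)
      assume "\<not> thesis"
      with that have *: "p j = j" if "j \<noteq> i" for j using that by blast
      then have "p i = i"
        using \<open>p permutes UNIV\<close> by (metis permutes_inj injD)
      with * have "p = id" by (intro ext) (metis id_apply)
      with False show False by simp
    qed
    then have "(\<Prod>j\<in>UNIV - {i}. A x $ j $ p j) = 0"
      by (intro prod_zero bexI[of _ j]) (auto simp: assms(2) mat_def)
    with False show ?thesis by simp
  qed (simp add: assms(2) mat_def)
  have "((\<lambda>y. det (A y)) has_derivative (\<lambda>v. \<Sum>p | p permutes UNIV. of_int (sign p) *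
      (\<Sum>\<^sub>U i. ?A' i (p i) v * (\<Prod>j\<in>UNIV - {i}. A x $ j $ p j)))) (at x)"
    unfolding det_def
    by (intro has_derivative_sum has_derivative_mult_right has_derivative_prod A')
  from partialI[OF this, of \<alpha>]
  have "partial \<alpha> (\<lambda>y. det (A y)) x = (\<Sum>p | p permutes UNIV. of_int (sign p) *
      (\<Sum>\<^sub>U i. ?A' i (p i) (axis \<alpha> 1) * (if p = id then 1 else 0)))"
    by (simp add: *)
  also have "\<dots> = (\<Sum>p | p permutes (UNIV :: 'n set). if p = id then (\<Sum>\<^sub>U i. ?A' i i (axis \<alpha> 1)) else 0)"
    by (rule sum.cong) (auto simp: sign_id)
  also have "\<dots> = (\<Sum>\<^sub>U i. ?A' i i (axis \<alpha> 1))"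
    by (simp add: sum.delta finite_permutations permutes_id)
  finally show ?thesis by (simp add: partial_def)
qed

lemma differentiable_sum_contract:
  fixes A B :: "'a::real_normed_vector \<Rightarrow> real^'n^'n"
  assumes "\<And>i j. (\<lambda>y. A y $ i $ j) differentiable (at x)" "\<And>i j. (\<lambda>y. B y $ i $ j) differentiable (at x)"
  shows "(\<lambda>y. (A y ** B y) $ i $ j) differentiable (at x)"
  unfolding matrix_matrix_mult_def
  by (simp add: assms differentiable_sum differentiable_mult)

definition partial_matrix :: "4 \<Rightarrow> (real^4 \<Rightarrow> real^'n^'m) \<Rightarrow> real^4 \<Rightarrow> real^'n^'m" where
  "partial_matrix \<alpha> A x = (\<chi> i j. partial \<alpha> (\<lambda>y. A y $ i $ j) x)"

lemma partial_matrix_mult: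
  fixes A B :: "real^4 \<Rightarrow> real^'n^'n"
  assumes "\<And>i j. (\<lambda>y. A y $ i $ j) differentiable (at x)" "\<And>i j. (\<lambda>y. B y $ i $ j) differentiable (at x)"
  shows "partial_matrix \<alpha> (\<lambda>y. A y ** B y) x = A x ** partial_matrix \<alpha> B x + partial_matrix \<alpha> A x ** B x"
  by (simp add: partial_matrix_def matrix_matrix_mult_def vec_eq_iff partial_sum partial_mult assms
      differentiable_mult sum.distrib)

text \<open>Jacobi's formula. The constant factor B moves the base point to the unit matrix: det (A
  y) = det (A x) det (B A y).\<close>

lemma partial_det:
  fixes A :: "real^4 \<Rightarrow> real^'n^'n"
  assumes A: "\<And>i j. (\<lambda>y. A y $ i $ j) differentiable (at x)" and B: "B ** A x = mat 1"
  shows "partial \<alpha> (\<lambda>y. det (A y)) x = det (A x) * trace (B ** partial_matrix \<alpha> A x)"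
proof -
  have "det B * det (A x) = 1"
    using B by (metis det_I det_mul)
  then have "det (A y) = det (A x) * det (B ** A y)" for y
    by (simp add: det_mul mult.commute)
  then have "partial \<alpha> (\<lambda>y. det (A y)) x = partial \<alpha> (\<lambda>y. det (A x) * det (B ** A y)) x"
    by (intro partial_cong_nhds always_eventually allI)
  also have "\<dots> = det (A x) * partial \<alpha> (\<lambda>y. det (B ** A y)) x"
    by (intro partial_cmult differentiable_det differentiable_sum_contract A) auto
  also have "partial \<alpha> (\<lambda>y. det (B ** A y)) x = trace (partial_matrix \<alpha> (\<lambda>y. B ** A y) x)"
    by (subst partial_det_at_one) (auto simp: trace_def partial_matrix_def B intro!: differentiable_sum_contract A)
  also have "\<dots> = trace (B ** partial_matrix \<alpha> A x)"
    by (subst partial_matrix_mult[where A = "\<lambda>_. B"])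
       (auto simp: A partial_matrix_def partial_const trace_def matrix_matrix_mult_def)
  finally show ?thesis .
qed

text \<open>Expressing the entries as quotients of determinants serves twice: for differentiability
  in x and for analyticity in the coupling.\<close>

lemma matrix_inv_cramer:
  fixes A :: "real^4^4"
  assumes "det A < 0"
  shows "matrix_inv A $ i $ j = det (\<chi> k l. if l = i then axis j 1 $ k else A $ k $ l) / det A"
proof -
  have "A *v column j (matrix_inv A) = axis j 1"
    using matrix_inv_props(1)[OF assms]
    by (auto simp: vec_eq_iff matrix_matrix_mult_def matrix_vector_mult_def column_def mat_def axis_def)
  then have "column j (matrix_inv A) = (\<chi> k. det (\<chi> i l. if l = k then axis j 1 $ i else A $ i $ l) / det A)"
    using assms by (subst (asm) cramer) auto
  then have "column j (matrix_inv A) $ i = (\<chi> k. det (\<chi> i l. if l = k then axis j 1 $ i else A $ i $ l) / det A) $ i"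
    by simp
  then show ?thesis by (simp add: column_def)
qed

lemma eventually_det_neg:
  fixes A :: "'a::real_normed_vector \<Rightarrow> real^'n^'n"
  assumes "\<And>i j. (\<lambda>y. A y $ i $ j) differentiable (at x)" "det (A x) < 0"
  shows "\<forall>\<^sub>F y in nhds x. det (A y) < 0"
proof -
  have "isCont (\<lambda>y. det (A y)) x"
    using differentiable_det[OF assms(1)] by (intro differentiable_imp_continuous_within)
  then show ?thesis
    using assms(2) unfolding isCont_def by (intro order_tendstoD(2)[OF tendsto_at_iff_tendsto_nhds[THEN iffD1]])
qed

lemma differentiable_cong_nhds:
  assumes "\<forall>\<^sub>F y in nhds x. f y = g y"
  shows "f differentiable (at x) \<longleftrightarrow> g differentiable (at x)"
  by (simp add: differentiable_def has_derivative_cong_nhds[OF assms])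

lemma differentiable_matrix_inv:
  fixes A :: "'a::real_normed_vector \<Rightarrow> real^4^4"
  assumes A: "\<And>i j. (\<lambda>y. A y $ i $ j) differentiable (at x)" and neg: "det (A x) < 0"
  shows "(\<lambda>y. matrix_inv (A y) $ i $ j) differentiable (at x)"
proof -
  have "\<forall>\<^sub>F y in nhds x. matrix_inv (A y) $ i $ j =
      det (\<chi> k l. if l = i then axis j 1 $ k else A y $ k $ l) / det (A y)"
    using eventually_det_neg[OF assms] by eventually_elim (rule matrix_inv_cramer)
  from differentiable_cong_nhds[OF this] show ?thesis
  proof (rule iffD2)
    show "(\<lambda>y. det (\<chi> k l. if l = i then axis j 1 $ k else A y $ k $ l) / det (A y)) differentiable (at x)"
    proof (intro differentiable_divide differentiable_det A)
      fix a b show "(\<lambda>y. (\<chi> k l. if l = i then axis j 1 $ k else A y $ k $ l) $ a $ b) differentiable (at x)"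
        using A by (cases "b = i") auto
    qed (use neg in auto)
  qed
qed

text \<open>Product rule for A times its inverse, which equals the unit matrix on the neighbourhood
  of x where the determinant stays negative.\<close>

lemma partial_matrix_inv:
  fixes A :: "real^4 \<Rightarrow> real^4^4"
  assumes A: "\<And>i j. (\<lambda>y. A y $ i $ j) differentiable (at x)" and neg: "det (A x) < 0"
  shows "partial_matrix \<alpha> (\<lambda>y. matrix_inv (A y)) x =
    - (matrix_inv (A x) ** partial_matrix \<alpha> A x ** matrix_inv (A x))"
proof -
  let ?G = "matrix_inv (A x)"
  have "partial \<alpha> (\<lambda>y. (A y ** matrix_inv (A y)) $ i $ j) x = partial \<alpha> (\<lambda>y. mat 1 $ i $ j) x" for i j
    using eventually_det_neg[OF assms]
    by (intro partial_cong_nhds) (auto simp: matrix_inv_props elim!: eventually_mono)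
  then have "partial_matrix \<alpha> (\<lambda>y. A y ** matrix_inv (A y)) x = 0"
    by (simp add: partial_matrix_def partial_const vec_eq_iff)
  then have "A x ** partial_matrix \<alpha> (\<lambda>y. matrix_inv (A y)) x = - (partial_matrix \<alpha> A x ** ?G)"
    using partial_matrix_mult[OF A differentiable_matrix_inv[OF A neg]] by (simp add: add_eq_0_iff2)
  then have "?G ** (A x ** partial_matrix \<alpha> (\<lambda>y. matrix_inv (A y)) x) = ?G ** - (partial_matrix \<alpha> A x ** ?G)"
    by simp
  then show ?thesis
    by (simp add: matrix_mul_assoc matrix_inv_props[OF neg] matrix_mul_uminus)
qed

text \<open>The right-hand side has the shape s (D + l G) that \<open>einstein_contraction\<close>
  expects for \<open>p\<close>.\<close>

lemma partial_matrix_gothic: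
  fixes A :: "real^4 \<Rightarrow> real^4^4"
  assumes A: "\<And>i j. (\<lambda>y. A y $ i $ j) differentiable (at x)" and neg: "det (A x) < 0"
  shows "partial \<alpha> (\<lambda>y. gothic (A y) $ b $ c) x = sqrt (- det (A x)) *
    ((- (matrix_inv (A x) ** partial_matrix \<alpha> A x ** matrix_inv (A x))) $ b $ c
     + 1 / 2 * trace (matrix_inv (A x) ** partial_matrix \<alpha> A x) * matrix_inv (A x) $ b $ c)"
proof -
  let ?s = "sqrt (- det (A x))" and ?t = "trace (matrix_inv (A x) ** partial_matrix \<alpha> A x)"
  obtain d' where d': "((\<lambda>y. det (A y)) has_derivative d') (at x)"
    using differentiable_det[OF A] by (auto simp: differentiable_def)
  have "d' (axis \<alpha> 1) = det (A x) * ?t"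
    using partialI[OF d'] partial_det[OF A matrix_inv_props(2)[OF neg]] by simp
  moreover have s: "((\<lambda>y. sqrt (- det (A y))) has_derivative (\<lambda>v. inverse ?s / 2 * - d' v)) (at x)"
    using neg d' by (auto intro!: derivative_eq_intros)
  ultimately have "partial \<alpha> (\<lambda>y. sqrt (- det (A y))) x = inverse ?s / 2 * (- det (A x) * ?t)"
    by (simp add: partialI)
  also have "\<dots> = ?s * (1 / 2 * ?t)"
  proof -
    have "inverse r / 2 * (d * t) = r * (1 / 2 * t)" if "r * r = d" "r > 0" for r d t :: real
      using that by (auto simp: field_simps)
    from this[of ?s "- det (A x)"] neg show ?thesis by simp
  qed
  finally have 1: "partial \<alpha> (\<lambda>y. sqrt (- det (A y))) x = ?s * (1 / 2 * ?t)" .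
  have 2: "(\<lambda>y. sqrt (- det (A y))) differentiable (at x)"
    using s by (auto simp: differentiable_def)
  have 3: "partial \<alpha> (\<lambda>y. matrix_inv (A y) $ b $ c) x =
      (- (matrix_inv (A x) ** partial_matrix \<alpha> A x ** matrix_inv (A x))) $ b $ c"
    unfolding partial_matrix_inv[OF assms, symmetric] by (simp add: partial_matrix_def)
  show ?thesis
    by (simp only: gothic_def vector_scaleR_component real_scaleR_def
       partial_mult[OF 2 differentiable_matrix_inv[OF assms]] 1 3) (simp add: algebra_simps)
qed

lemma transpose_matrix_inv:
  fixes A :: "real^4^4"
  assumes "det A < 0" "transpose A = A"
  shows "transpose (matrix_inv A) = matrix_inv A"
proof -
  have "A ** transpose (matrix_inv A) = mat 1"
    using matrix_transpose_mul[of "matrix_inv A" A] by (simp add: assms matrix_inv_props transpose_mat)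
  from matrix_inv_eqI[OF assms(1) this] show ?thesis by simp
qed

text \<open>\<open>gothic\<close> is an involution at negative determinant and preserves the
  determinant. Hence g = gothic A has inverse A / s with the same s, and the formula can be written
  in the inverse density A.\<close>

lemma einstein_density_gothic:
  fixes A :: "real^4 \<Rightarrow> real^4^4"
  assumes A: "\<And>i j. (\<lambda>y. A y $ i $ j) differentiable (at x)" and neg: "det (A x) < 0"
    and sym: "\<And>y. transpose (A y) = A y"
    and g: "\<forall>\<^sub>F y in nhds x. g y = gothic (A y)"
  defines "G \<equiv> matrix_inv (A x)"
  shows "einstein_density g x = 1 / 4 *
    ((\<Sum>\<^sub>U a b. A x $ a $ b * trace (G ** partial_matrix a A x ** G ** partial_matrix b A x))
      - 1 / 2 * (\<Sum>\<^sub>U a b. A x $ a $ b *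
          (trace (G ** partial_matrix a A x) * trace (G ** partial_matrix b A x)))
      - 2 * (\<Sum>\<^sub>U a b. (partial_matrix a A x ** G ** partial_matrix b A x) $ b $ a))"
proof -
  let ?s = "sqrt (- det (A x))"
  have s: "?s > 0" using neg by simp
  have gx: "g x = gothic (A x)" using g by (rule eventually_nhds_x_imp_x)
  then have det: "det (g x) = det (A x)" by (simp add: det_gothic neg)
  have "gothic (g x) = A x" by (simp add: gx gothic_gothic neg)
  then have inv: "matrix_inv (g x) = (1 / ?s) *\<^sub>R A x"
    using s unfolding gothic_def det by (metis divideR_right scaleR_scaleR less_irrefl inverse_eq_divide)
  have "transpose (partial_matrix a A x) = partial_matrix a A x" for a
  proof -
    have "A y $ i $ j = A y $ j $ i" for y i j using sym by (rule transpose_eq_self)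
    then show ?thesis by (simp add: partial_matrix_def transpose_def vec_eq_iff)
  qed
  moreover have "partial a (\<lambda>y. g y $ b $ c) x = ?s * ((- (G ** partial_matrix a A x ** G)) $ b $ c
     + 1 / 2 * trace (G ** partial_matrix a A x) * G $ b $ c)" for a b c
  proof -
    have "partial a (\<lambda>y. g y $ b $ c) x = partial a (\<lambda>y. gothic (A y) $ b $ c) x"
      using g by (intro partial_cong_nhds) (auto elim: eventually_mono)
    then show ?thesis by (simp only: partial_matrix_gothic[OF A neg] G_def)
  qed
  ultimately show ?thesis
    unfolding einstein_density_def det inv
    by (intro einstein_contraction[where l = "\<lambda>a. 1 / 2 * trace (G ** partial_matrix a A x)"
         and D = "\<lambda>a. - (G ** partial_matrix a A x ** G)" and p = "\<lambda>a b c. partial a (\<lambda>y. g y $ b $ c) x"])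
       (auto simp: G_def matrix_inv_props neg sym transpose_matrix_inv christoffel_def inv)
qed

subsection \<open>Expansion in powers of the coupling\<close>

text \<open>The existence of a power series is part of the predicate, because
  \<open>has_kappa_expansion\<close> requires convergence. Tracking three coefficients is enough for
  the quartic term.\<close>

definition taylor2 :: "(real \<Rightarrow> real) \<Rightarrow> real \<Rightarrow> real \<Rightarrow> real \<Rightarrow> bool" where
  "taylor2 f a b c \<longleftrightarrow> (\<exists>F. f has_fps_expansion F \<and> fps_nth F 0 = a \<and> fps_nth F 1 = b \<and> fps_nth F 2 = c)"

lemma taylor2_const: "taylor2 (\<lambda>_. c) c 0 0"
  unfolding taylor2_def by (rule exI[of _ "fps_const c"]) auto

lemma taylor2_id: "taylor2 (\<lambda>x. x) 0 1 0"
  unfolding taylor2_def by (rule exI[of _ fps_X]) (auto intro: has_fps_expansion_fps_X)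

lemma taylor2_add:
  assumes "taylor2 f a b c" "taylor2 g a' b' c'"
  shows "taylor2 (\<lambda>x. f x + g x) (a + a') (b + b') (c + c')"
proof -
  from assms obtain F G where
    "f has_fps_expansion F" "g has_fps_expansion G" and *: "fps_nth F 0 = a" "fps_nth F 1 = b" "fps_nth F 2 = c" "fps_nth G 0 = a'" "fps_nth G 1 = b'" "fps_nth G 2 = c'"
    unfolding taylor2_def by blast
  then have "(\<lambda>x. f x + g x) has_fps_expansion F + G" by (intro has_fps_expansion_add)
  with * show ?thesis unfolding taylor2_def by (intro exI[of _ "F + G"]) auto
qed

lemma taylor2_mult:
  assumes "taylor2 f a b c" "taylor2 g a' b' c'"
  shows "taylor2 (\<lambda>x. f x * g x) (a * a') (a * b' + b * a') (a * c' + b * b' + c * a')"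
proof -
  from assms obtain F G where
    "f has_fps_expansion F" "g has_fps_expansion G" and *: "fps_nth F 0 = a" "fps_nth F 1 = b" "fps_nth F 2 = c" "fps_nth G 0 = a'" "fps_nth G 1 = b'" "fps_nth G 2 = c'"
    unfolding taylor2_def by blast
  then have "(\<lambda>x. f x * g x) has_fps_expansion F * G" by (intro has_fps_expansion_mult)
  with * show ?thesis unfolding taylor2_def
    by (intro exI[of _ "F * G"]) (auto simp: fps_mult_nth numeral_2_eq_2)
qed

lemma taylor2_cmult:
  assumes "taylor2 f a b c"
  shows "taylor2 (\<lambda>x. k * f x) (k * a) (k * b) (k * c)"
  using taylor2_mult[OF taylor2_const[of k] assms] by simp

lemma taylor2_diff:
  assumes "taylor2 f a b c" "taylor2 g a' b' c'"
  shows "taylor2 (\<lambda>x. f x - g x) (a - a') (b - b') (c - c')"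
  using taylor2_add[OF assms(1) taylor2_cmult[OF assms(2), of "-1"]] by simp

lemma taylor2_sum:
  assumes "\<And>i. i \<in> I \<Longrightarrow> taylor2 (f i) (a i) (b i) (c i)"
  shows "taylor2 (\<lambda>x. \<Sum>i\<in>I. f i x) (\<Sum>i\<in>I. a i) (\<Sum>i\<in>I. b i) (\<Sum>i\<in>I. c i)"
  using assms
proof (induction I rule: infinite_finite_induct)
  case (insert i I)
  then show ?case by (simp add: taylor2_add)
qed (auto intro: taylor2_const)

definition mtaylor2 :: "(real \<Rightarrow> real^'n^'m) \<Rightarrow> real^'n^'m \<Rightarrow> real^'n^'m \<Rightarrow> real^'n^'m \<Rightarrow> bool" where
  "mtaylor2 f A B C \<longleftrightarrow> (\<forall>i j. taylor2 (\<lambda>x. f x $ i $ j) (A $ i $ j) (B $ i $ j) (C $ i $ j))"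

lemma mtaylor2_const: "mtaylor2 (\<lambda>_. A) A 0 0"
  by (simp add: mtaylor2_def taylor2_const)

lemma mtaylor2_mult:
  assumes "mtaylor2 f A B C" "mtaylor2 g A' B' C'"
  shows "mtaylor2 (\<lambda>x. f x ** g x) (A ** A') (A ** B' + B ** A') (A ** C' + B ** B' + C ** A')"
  unfolding mtaylor2_def
proof (intro allI)
  fix i j
  have "taylor2 (\<lambda>x. \<Sum>\<^sub>U k. f x $ i $ k * g x $ k $ j)
     (\<Sum>\<^sub>U k. A $ i $ k * A' $ k $ j)
     (\<Sum>\<^sub>U k. A $ i $ k * B' $ k $ j + B $ i $ k * A' $ k $ j)
     (\<Sum>\<^sub>U k. A $ i $ k * C' $ k $ j + B $ i $ k * B' $ k $ j + C $ i $ k * A' $ k $ j)"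
    using assms by (intro taylor2_sum taylor2_mult) (auto simp: mtaylor2_def)
  then show "taylor2 (\<lambda>x. (f x ** g x) $ i $ j) ((A ** A') $ i $ j)
      ((A ** B' + B ** A') $ i $ j) ((A ** C' + B ** B' + C ** A') $ i $ j)"
    by (simp add: matrix_matrix_mult_def sum.distrib)
qed

lemma taylor2_trace:
  assumes "mtaylor2 f A B C"
  shows "taylor2 (\<lambda>x. trace (f x)) (trace A) (trace B) (trace C)"
  unfolding trace_def using assms by (intro taylor2_sum) (auto simp: mtaylor2_def)

text \<open>Agreement on a punctured neighbourhood allows \<open>f\<close> to be the analytic
  continuation of a \<open>g\<close> that divides by \<kappa>^2.\<close>

lemma taylor2_has_kappa_expansion:
  assumes "taylor2 f a b c" "\<forall>\<^sub>F \<kappa> in at 0. f \<kappa> = g \<kappa>"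
  shows "\<exists>d. has_kappa_expansion g d \<and> d 2 = c"
proof -
  from assms(1) obtain F where F: "f has_fps_expansion F" "fps_nth F 2 = c"
    unfolding taylor2_def by blast
  have "\<forall>\<^sub>F \<kappa> in nhds 0. \<kappa> \<in> eball 0 (fps_conv_radius F)"
    using F(1) by (intro eventually_nhds_in_open) (auto simp: has_fps_expansion_def zero_ereal_def)
  moreover have "\<forall>\<^sub>F \<kappa> in nhds 0. eval_fps F \<kappa> = f \<kappa>"
    using F(1) by (simp add: has_fps_expansion_def)
  ultimately have "\<forall>\<^sub>F \<kappa> in nhds 0. (\<lambda>n. fps_nth F n * \<kappa> ^ n) sums f \<kappa>"
    by eventually_elim (metis sums_eval_fps in_eball_iff dist_0_norm)
  then have "\<forall>\<^sub>F \<kappa> in at 0. (\<lambda>n. fps_nth F n * \<kappa> ^ n) sums g \<kappa>"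
    using assms(2) unfolding eventually_at_filter by eventually_elim auto
  with F(2) show ?thesis unfolding has_kappa_expansion_def by (intro exI[of _ "fps_nth F"]) auto
qed

section \<open>Expansion of the inverse gothic metric and of the Lagrangian\<close>

lemma eta_eta: "eta ** eta = (mat 1 :: 'a::comm_ring_1^4^4)"
proof -
  have "(\<Sum>\<^sub>U k. eta $ i $ k * eta $ k $ j) = (\<Sum>\<^sub>U k. if k = i then (eta $ i $ i * eta $ i $ j :: 'a) else 0)" for i j
    by (rule sum.cong) (auto simp: eta_def)
  then show ?thesis
    by (simp add: vec_eq_iff matrix_matrix_mult_def mat_def) (simp add: eta_def)
qed

lemma transpose_eta: "transpose eta = eta"
  by (simp add: vec_eq_iff transpose_def eta_def)

lemma det_eta: "det (eta :: real^4^4) = - 1"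
proof -
  have "det (eta :: real^4^4) = (\<Prod>i\<in>UNIV. eta $ i $ i)"
    by (rule det_diagonal) (simp add: eta_def)
  also have "\<dots> = - 1" unfolding UNIV_4 by (simp add: eta_def)
  finally show ?thesis .
qed

lemma matrix_add_right_distrib: "(A + B) ** C = A ** C + (B ** C :: 'a::semiring_1^'k^'n)"
  by (simp add: matrix_matrix_mult_def vec_eq_iff distrib_right sum.distrib)

lemma matrix_mul_diff_left: "A ** (B - C) = A ** B - A ** (C :: 'a::comm_ring_1^'k^'n)"
  by (simp add: matrix_matrix_mult_def vec_eq_iff right_diff_distrib sum_subtractf)

lemma trace_scaleR: "trace (k *\<^sub>R A) = k * trace (A :: real^'n^'n)"
  by (simp add: trace_def sum_distrib_left)

text \<open>Analyticity and coefficients are obtained separately. Cramer's rule makes every entry a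
  quotient of power series. Iterating G = eta - \<kappa> (eta A) G three times leaves a remainder
  \<kappa>^3 \<open>?T\<close> with analytic \<open>?T\<close>, so the coefficients of order 0, 1
  and 2 can be read off.\<close>

lemma taylor2_matrix_inv:
  fixes A :: "real^4^4"
  shows "mtaylor2 (\<lambda>\<kappa>. matrix_inv (eta + \<kappa> *\<^sub>R A)) eta (- (eta ** A ** eta)) (eta ** A ** eta ** A ** eta)"
    and "\<forall>\<^sub>F \<kappa> in nhds 0. det (eta + \<kappa> *\<^sub>R A) < 0"
proof -
  let ?M = "\<lambda>\<kappa>. eta + \<kappa> *\<^sub>R A" and ?X = "eta ** A"
  show neg: "\<forall>\<^sub>F \<kappa> in nhds 0. det (?M \<kappa>) < 0"
    by (intro eventually_det_neg) (auto simp: det_eta)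
  let ?T = "\<lambda>\<kappa>. ?X ** ?X ** ?X ** matrix_inv (?M \<kappa>)"
  have expand: "matrix_inv (?M \<kappa>) = eta - \<kappa> *\<^sub>R (?X ** eta) + (\<kappa> * \<kappa>) *\<^sub>R (?X ** ?X ** eta) - (\<kappa> * \<kappa> * \<kappa>) *\<^sub>R ?T \<kappa>"
    if "det (?M \<kappa>) < 0" for \<kappa>
  proof -
    let ?G = "matrix_inv (?M \<kappa>)"
    have "eta ** (?M \<kappa> ** ?G) = eta"
      by (simp add: matrix_inv_props[OF that])
    then have "?G + \<kappa> *\<^sub>R (?X ** ?G) = eta"
      by (simp add: matrix_mul_assoc matrix_add_ldistrib matrix_add_right_distrib eta_eta matrix_scalar_ac
           flip: scalar_matrix_assoc)
    then have *: "?G = eta - \<kappa> *\<^sub>R (?X ** ?G)" by (simp add: algebra_simps)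
    have 1: "?X ** ?G = ?X ** eta - \<kappa> *\<^sub>R (?X ** ?X ** ?G)"
      by (subst *) (simp add: matrix_mul_assoc matrix_mul_diff_left matrix_scalar_ac flip: scalar_matrix_assoc)
    have 2: "?X ** ?X ** ?G = ?X ** ?X ** eta - \<kappa> *\<^sub>R ?T \<kappa>"
      by (subst *) (simp add: matrix_mul_assoc matrix_mul_diff_left matrix_scalar_ac flip: scalar_matrix_assoc)
    show ?thesis
      by (subst *, subst 1, subst 2) (simp add: scaleR_diff_right algebra_simps)
  qed
  obtain F where F: "\<And>i j. (\<lambda>\<kappa>. matrix_inv (?M \<kappa>) $ i $ j) has_fps_expansion F i j"
  proof -
    have M: "(\<lambda>\<kappa>. ?M \<kappa> $ i $ j) has_fps_expansion fps_const (eta $ i $ j) + fps_X * fps_const (A $ i $ j)" for i j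
      by (auto intro!: has_fps_expansion_add has_fps_expansion_mult has_fps_expansion_fps_X)
    have "\<exists>F. (\<lambda>\<kappa>. matrix_inv (?M \<kappa>) $ i $ j) has_fps_expansion F" for i j
    proof -
      have det: "\<exists>F. (\<lambda>\<kappa>. det (B \<kappa>)) has_fps_expansion F"
        if "\<And>i j. \<exists>F. (\<lambda>\<kappa>. B \<kappa> $ i $ j) has_fps_expansion F" for B :: "real \<Rightarrow> real^4^4"
      proof -
        from that obtain F where "\<And>i j. (\<lambda>\<kappa>. B \<kappa> $ i $ j) has_fps_expansion F i j" by metis
        then show ?thesis unfolding det_def
          by (intro exI[of _ "\<Sum>p | p permutes UNIV. fps_const (of_int (sign p)) * (\<Prod>i\<in>UNIV. F i (p i))"]
                has_fps_expansion_sum has_fps_expansion_cmult_left has_fps_expansion_prod)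
      qed
      obtain D where D: "(\<lambda>\<kappa>. det (?M \<kappa>)) has_fps_expansion D"
        using det[of ?M] M by blast
      have "\<exists>F. (\<lambda>\<kappa>. (\<chi> k l. if l = i then axis j 1 $ k else ?M \<kappa> $ k $ l) $ a $ b) has_fps_expansion F" for a b
        using M[of a b] by (cases "b = i") auto
      then obtain E where E: "(\<lambda>\<kappa>. det (\<chi> k l. if l = i then axis j 1 $ k else ?M \<kappa> $ k $ l)) has_fps_expansion E"
        using det[of "\<lambda>\<kappa>. \<chi> k l. if l = i then axis j 1 $ k else ?M \<kappa> $ k $ l"] by blast
      \<comment> \<open>The constant term of the denominator is det eta = - 1.\<close>
      have "fps_nth D 0 \<noteq> 0"
        using D det_eta by (auto simp: has_fps_expansion_def eval_fps_at_0 dest!: eventually_nhds_x_imp_x)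
      from has_fps_expansion_divide'[OF E D this]
      have "(\<lambda>\<kappa>. det (\<chi> k l. if l = i then axis j 1 $ k else ?M \<kappa> $ k $ l) / det (?M \<kappa>)) has_fps_expansion E / D" .
      moreover have "\<forall>\<^sub>F \<kappa> in nhds 0. det (\<chi> k l. if l = i then axis j 1 $ k else ?M \<kappa> $ k $ l) / det (?M \<kappa>) = matrix_inv (?M \<kappa>) $ i $ j"
        using neg by eventually_elim (simp only: matrix_inv_cramer)
      ultimately show ?thesis
        unfolding has_fps_expansion_def
        by (intro exI[of _ "E / D"] conjI) (auto elim: eventually_elim2)
    qed
    with that show ?thesis by metis
  qed
  show "mtaylor2 (\<lambda>\<kappa>. matrix_inv (?M \<kappa>)) eta (- (eta ** A ** eta)) (eta ** A ** eta ** A ** eta)"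
    unfolding mtaylor2_def
  proof (intro allI)
    fix i j
    obtain a b c where T: "taylor2 (\<lambda>\<kappa>. ?T \<kappa> $ i $ j) a b c"
    proof -
      have "(\<lambda>\<kappa>. \<Sum>\<^sub>U k. (?X ** ?X ** ?X) $ i $ k * matrix_inv (?M \<kappa>) $ k $ j) has_fps_expansion
         (\<Sum>\<^sub>U k. fps_const ((?X ** ?X ** ?X) $ i $ k) * F k j)"
        by (intro has_fps_expansion_sum has_fps_expansion_cmult_left F)
      then show ?thesis by (intro that) (auto simp: taylor2_def sum_contract)
    qed
    have "taylor2 (\<lambda>\<kappa>. eta $ i $ j - \<kappa> * (?X ** eta) $ i $ j + \<kappa> * \<kappa> * (?X ** ?X ** eta) $ i $ j - \<kappa> * \<kappa> * \<kappa> * ?T \<kappa> $ i $ j)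
       (eta $ i $ j) ((- (?X ** eta)) $ i $ j) ((?X ** ?X ** eta) $ i $ j)"
      (is "taylor2 ?f _ _ _")
      using taylor2_diff[OF taylor2_add[OF taylor2_diff[OF taylor2_const[of "eta $ i $ j"]
           taylor2_mult[OF taylor2_id taylor2_const[of "(?X ** eta) $ i $ j"]]]
           taylor2_mult[OF taylor2_mult[OF taylor2_id taylor2_id] taylor2_const[of "(?X ** ?X ** eta) $ i $ j"]]]
           taylor2_mult[OF taylor2_mult[OF taylor2_mult[OF taylor2_id taylor2_id] taylor2_id] T]]
      by simp
    moreover have "\<forall>\<^sub>F \<kappa> in nhds 0. ?f \<kappa> = matrix_inv (?M \<kappa>) $ i $ j"
      using neg by eventually_elim (subst expand, auto)
    ultimately show "taylor2 (\<lambda>\<kappa>. matrix_inv (?M \<kappa>) $ i $ j) (eta $ i $ j) ((- (eta ** A ** eta)) $ i $ j)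
       ((eta ** A ** eta ** A ** eta) $ i $ j)"
      unfolding taylor2_def has_fps_expansion_def matrix_mul_assoc
      by (force elim: eventually_elim2)
  qed
qed

text \<open>The density is quadratic in the derivatives of eta + \<kappa> h, each of which is
  \<kappa> \<open>H a\<close>. The resulting \<kappa>^2 cancels the prefactor, and the coefficient
  wanted is the second-order one of the remaining function \<open>f\<close>.\<close>

lemma einstein_lagrangian_expansion:
  fixes h :: "real^4 \<Rightarrow> real^4^4"
  assumes h: "h differentiable (at x)" and sym: "\<And>y. transpose (h y) = h y"
  defines "A \<equiv> h x" and "H \<equiv> \<lambda>a. partial_matrix a h x"
  defines "G1 \<equiv> - (eta ** A ** eta)" and "G2 \<equiv> eta ** A ** eta ** A ** eta"
  shows "\<exists>c. has_kappa_expansion (\<lambda>\<kappa>. einstein_lagrangian \<kappa> h x) c \<and> c 2 = 1 / 2 *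
    ((\<Sum>\<^sub>U a b. eta $ a $ b * (trace (G2 ** H a ** eta ** H b) + trace (G1 ** H a ** G1 ** H b) + trace (eta ** H a ** G2 ** H b))
        + A $ a $ b * (trace (G1 ** H a ** eta ** H b) + trace (eta ** H a ** G1 ** H b)))
      - 1 / 2 * (\<Sum>\<^sub>U a b. eta $ a $ b * (trace (eta ** H a) * trace (G2 ** H b)
            + trace (G1 ** H a) * trace (G1 ** H b) + trace (G2 ** H a) * trace (eta ** H b))
          + A $ a $ b * (trace (eta ** H a) * trace (G1 ** H b) + trace (G1 ** H a) * trace (eta ** H b)))
      - 2 * (\<Sum>\<^sub>U a b. (H a ** G2 ** H b) $ b $ a))"
proof -
  let ?M = "\<lambda>\<kappa>. eta + \<kappa> *\<^sub>R A" and ?G = "\<lambda>\<kappa>. matrix_inv (eta + \<kappa> *\<^sub>R A)"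
  note inv = taylor2_matrix_inv(1)[of A, folded G1_def G2_def]
  have dh: "(\<lambda>y. h y $ i $ j) differentiable (at x)" for i j
  proof -
    from h obtain h' where h': "(h has_derivative h') (at x)" by (auto simp: differentiable_def)
    note bounded_linear.has_derivative[OF bounded_linear_vec_nth this, of i]
    from bounded_linear.has_derivative[OF bounded_linear_vec_nth this, of j]
    show ?thesis by (rule differentiableI)
  qed
  have M: "taylor2 (\<lambda>\<kappa>. ?M \<kappa> $ a $ b) (eta $ a $ b) (A $ a $ b) 0" for a b
    using taylor2_add[OF taylor2_const[of "eta $ a $ b"] taylor2_mult[OF taylor2_id taylor2_const[of "A $ a $ b"]]] by simp
  have GH: "mtaylor2 (\<lambda>\<kappa>. ?G \<kappa> ** H a) (eta ** H a) (G1 ** H a) (G2 ** H a)" for a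
    using mtaylor2_mult[OF inv mtaylor2_const[of "H a"]] by simp
  have HGH: "mtaylor2 (\<lambda>\<kappa>. H a ** ?G \<kappa> ** H b) (H a ** eta ** H b) (H a ** G1 ** H b) (H a ** G2 ** H b)" for a b
    using mtaylor2_mult[OF mtaylor2_mult[OF mtaylor2_const[of "H a"] inv] mtaylor2_const[of "H b"]] by simp
  have GHGH: "mtaylor2 (\<lambda>\<kappa>. ?G \<kappa> ** H a ** ?G \<kappa> ** H b) (eta ** H a ** eta ** H b)
     (G1 ** H a ** eta ** H b + eta ** H a ** G1 ** H b)
     (G2 ** H a ** eta ** H b + G1 ** H a ** G1 ** H b + eta ** H a ** G2 ** H b)" for a b
    using mtaylor2_mult[OF GH[of a] GH[of b]] by (simp add: matrix_mul_assoc add_ac)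
  define f where "f = (\<lambda>\<kappa>. 1 / 2 * ((\<Sum>\<^sub>U a b. ?M \<kappa> $ a $ b * trace (?G \<kappa> ** H a ** ?G \<kappa> ** H b))
      - 1 / 2 * (\<Sum>\<^sub>U a b. ?M \<kappa> $ a $ b * (trace (?G \<kappa> ** H a) * trace (?G \<kappa> ** H b)))
      - 2 * (\<Sum>\<^sub>U a b. (H a ** ?G \<kappa> ** H b) $ b $ a)))"
  \<comment> \<open>The summands with factor 0 come from the missing second-order term of eta +
    \<kappa> A; they are kept here so that the composed rules match, and removed below.\<close>
  have "\<exists>a b. taylor2 f a b (1 / 2 *
    ((\<Sum>\<^sub>U a b. eta $ a $ b * trace (G2 ** H a ** eta ** H b + G1 ** H a ** G1 ** H b + eta ** H a ** G2 ** H b)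
        + A $ a $ b * trace (G1 ** H a ** eta ** H b + eta ** H a ** G1 ** H b) + 0 * trace (eta ** H a ** eta ** H b))
      - 1 / 2 * (\<Sum>\<^sub>U a b. eta $ a $ b * (trace (eta ** H a) * trace (G2 ** H b)
            + trace (G1 ** H a) * trace (G1 ** H b) + trace (G2 ** H a) * trace (eta ** H b))
          + A $ a $ b * (trace (eta ** H a) * trace (G1 ** H b) + trace (G1 ** H a) * trace (eta ** H b))
          + 0 * (trace (eta ** H a) * trace (eta ** H b)))
      - 2 * (\<Sum>\<^sub>U a b. (H a ** G2 ** H b) $ b $ a)))"
    unfolding f_def
    by (intro exI) (rule taylor2_cmult[OF taylor2_diff[OF taylor2_diff
          [OF taylor2_sum[OF taylor2_sum[OF taylor2_mult[OF M taylor2_trace[OF GHGH]]]]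
          taylor2_cmult[OF taylor2_sum[OF taylor2_sum[OF taylor2_mult[OF M taylor2_mult[OF taylor2_trace[OF GH] taylor2_trace[OF GH]]]]]]]
          taylor2_cmult[OF taylor2_sum[OF taylor2_sum[OF HGH[unfolded mtaylor2_def, rule_format]]]]]])
  then obtain f0 f1 where f: "taylor2 f f0 f1 (1 / 2 *
    ((\<Sum>\<^sub>U a b. eta $ a $ b * (trace (G2 ** H a ** eta ** H b) + trace (G1 ** H a ** G1 ** H b) + trace (eta ** H a ** G2 ** H b))
        + A $ a $ b * (trace (G1 ** H a ** eta ** H b) + trace (eta ** H a ** G1 ** H b)))
      - 1 / 2 * (\<Sum>\<^sub>U a b. eta $ a $ b * (trace (eta ** H a) * trace (G2 ** H b)
            + trace (G1 ** H a) * trace (G1 ** H b) + trace (G2 ** H a) * trace (eta ** H b))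
          + A $ a $ b * (trace (eta ** H a) * trace (G1 ** H b) + trace (G1 ** H a) * trace (eta ** H b)))
      - 2 * (\<Sum>\<^sub>U a b. (H a ** G2 ** H b) $ b $ a)))"
    by (simp only: trace_add mult_zero_left add_0_right) blast
  have "\<forall>\<^sub>F \<kappa> in at 0. f \<kappa> = einstein_lagrangian \<kappa> h x"
    unfolding eventually_at_filter using taylor2_matrix_inv(2)[of A]
  proof eventually_elim
    case (elim \<kappa>)
    show ?case
    proof (intro impI)
      assume \<kappa>: "\<kappa> \<noteq> 0"
      let ?B = "\<lambda>y. eta + \<kappa> *\<^sub>R h y"
      have B: "(\<lambda>y. ?B y $ i $ j) differentiable (at x)" for i j
        using dh by (auto intro!: differentiable_add differentiable_mult)
      have neg: "det (?B x) < 0" using elim by (simp add: A_def)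
      have PB: "partial_matrix a ?B x = \<kappa> *\<^sub>R H a" for a
      proof -
        have "partial a (\<lambda>y. eta $ i $ j + \<kappa> * h y $ i $ j) x = \<kappa> * partial a (\<lambda>y. h y $ i $ j) x" for i j
        proof -
          obtain d where d: "((\<lambda>y. h y $ i $ j) has_derivative d) (at x)" using dh by (auto simp: differentiable_def)
          have "((\<lambda>y. eta $ i $ j + \<kappa> * h y $ i $ j) has_derivative (\<lambda>v. \<kappa> * d v)) (at x)"
            by (auto intro!: derivative_eq_intros d)
          with d show ?thesis by (simp add: partialI)
        qed
        then show ?thesis by (simp add: partial_matrix_def H_def vec_eq_iff)
      qed
      have "transpose (?B y) = ?B y" for y
        using sym[of y] transpose_eta[where 'a = real] by (simp add: transpose_def vec_eq_iff)
      moreover have "\<forall>\<^sub>F y in nhds x. metric_of_deviation \<kappa> h y = gothic (?B y)"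
        using eventually_det_neg[OF B neg]
        by eventually_elim (simp add: metric_of_deviation_def metric_of_gothic_eq gothic_def)
      ultimately have "einstein_density (metric_of_deviation \<kappa> h) x = \<kappa>\<^sup>2 / 2 * f \<kappa>"
        using neg
        apply (subst einstein_density_gothic[where A = ?B])
        apply (rule B)
        apply assumption+
        apply (simp add: PB f_def A_def[symmetric] matrix_scalar_ac trace_scaleR power2_eq_square sum_distrib_left
            field_simps flip: scalar_matrix_assoc)
        done
      with \<kappa> show "f \<kappa> = einstein_lagrangian \<kappa> h x"
        by (simp add: einstein_lagrangian_def field_simps)
    qed
  qed
  from taylor2_has_kappa_expansion[OF f this] show ?thesis .
qed

subsection \<open>Integration over the mass shell\<close>

text \<open>A function that is not integrable has Bochner integral 0, so domination alone gives the
  bound.\<close>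

lemma norm_integral_le:
  fixes f :: "'a \<Rightarrow> 'b::{banach,second_countable_topology}"
  assumes g: "integrable M g" and le: "\<And>x. x \<in> space M \<Longrightarrow> norm (f x) \<le> g x"
  shows "norm (\<integral>x. f x \<partial>M) \<le> (\<integral>x. g x \<partial>M)"
proof (cases "integrable M f")
  case True
  have "norm (\<integral>x. f x \<partial>M) \<le> (\<integral>x. norm (f x) \<partial>M)" by (rule integral_norm_bound)
  also have "\<dots> \<le> (\<integral>x. g x \<partial>M)" using True g le by (intro integral_mono) auto
  finally show ?thesis .
next
  case False
  have "0 \<le> g x" if "x \<in> space M" for x using le[OF that] norm_ge_zero order_trans by blast
  then show ?thesis using False by (simp add: not_integrable_integral_eq integral_nonneg_AE)
qed

definition shell :: "real \<Rightarrow> real \<Rightarrow> mode set" where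
  "shell r R = {k. r \<le> norm (fst k) \<and> norm (fst k) \<le> R}"

lemma sets_shell_measure [measurable_cong]: "sets shell_measure = sets (borel \<Otimes>\<^sub>M count_space UNIV)"
  unfolding shell_measure_def sets_density by (intro sets_pair_measure_cong) auto

lemma space_shell_measure [simp]: "space shell_measure = UNIV"
  unfolding shell_measure_def by (simp add: space_pair_measure)

lemma fst_measurable_shell [measurable]: "fst \<in> borel_measurable shell_measure"
  by measurable

lemma shell_in_sets [measurable]: "shell r R \<in> sets shell_measure"
proof -
  have "{k \<in> space shell_measure. r \<le> norm (fst k) \<and> norm (fst k) \<le> R} \<in> sets shell_measure"
    by measurable
  then show ?thesis by (simp add: shell_def)
qed

lemma sigma_finite_shell_measure: "sigma_finite_measure shell_measure"
proof -
  interpret c: sigma_finite_measure "count_space (UNIV :: bool set)"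
    by (rule sigma_finite_measure_count_space_finite) simp
  interpret p: pair_sigma_finite "lborel :: (real^3) measure" "count_space (UNIV :: bool set)" ..
  show ?thesis
    unfolding shell_measure_def
    by (subst p.sigma_finite_iff_density_finite) auto
qed

interpretation shell: sigma_finite_measure shell_measure
  by (rule sigma_finite_shell_measure)

interpretation shell_pair: pair_sigma_finite shell_measure shell_measure ..

interpretation shell_prod: product_sigma_finite "\<lambda>_::nat. shell_measure" ..

text \<open>On the shell the invariant density is at most its value at |p| = r, and two balls of
  radius R, one per helicity, contain the shell.\<close>

lemma emeasure_shell_finite:
  assumes "0 < r"
  shows "emeasure shell_measure (shell r R) < \<infinity>"
proof -
  interpret c: sigma_finite_measure "count_space (UNIV :: bool set)"
    by (rule sigma_finite_measure_count_space_finite) simp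
  interpret p: pair_sigma_finite "lborel :: (real^3) measure" "count_space (UNIV :: bool set)" ..
  let ?P = "(lborel :: (real^3) measure) \<Otimes>\<^sub>M count_space (UNIV :: bool set)"
  let ?w = "1 / ((2 * pi) ^ 3 * (2 * r))"
  have S: "shell r R \<in> sets ?P"
    using shell_in_sets[of r R] by (simp add: shell_measure_def)
  have "emeasure shell_measure (shell r R) =
      (\<integral>\<^sup>+ k. ennreal (1 / ((2 * pi) ^ 3 * (2 * norm (fst k)))) * indicator (shell r R) k \<partial>?P)"
    unfolding shell_measure_def using S by (intro emeasure_density) auto
  also have "\<dots> \<le> (\<integral>\<^sup>+ k. ennreal ?w * indicator (cball 0 R \<times> UNIV) k \<partial>?P)"
    using assms
    by (intro nn_integral_mono)
       (auto simp: shell_def indicator_def intro!: ennreal_leI divide_left_mono mult_mono mult_pos_pos)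
  also have "\<dots> = ennreal ?w * emeasure ?P (cball 0 R \<times> UNIV)"
    by (intro nn_integral_cmult_indicator) auto
  also have "\<dots> = ennreal ?w * (emeasure lborel (cball (0::real^3) R) * 2)"
    by (subst c.emeasure_pair_measure_Times) (auto simp: emeasure_count_space)
  also have "\<dots> < \<infinity>"
    using emeasure_bounded_finite[OF bounded_cball, of "0::real^3" R] by (auto simp: ennreal_mult_less_top)
  finally show ?thesis .
qed

lemma space_config: "space (config n) = extensional {..<n}"
  by (simp add: config_def space_PiM PiE_UNIV_domain PiE_def)

lemma case_nat_in_space: "K \<in> space (config n) \<Longrightarrow> case_nat k K \<in> space (config (Suc n))"
  by (auto simp: space_config extensional_def split: nat.split)

lemma measurable_case_nat_config:
  "(\<lambda>(K, k). case_nat k K) \<in> measurable (config n \<Otimes>\<^sub>M shell_measure) (config (Suc n))"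
  unfolding config_def
proof (rule measurable_PiM_single')
  fix i assume i: "i \<in> {..<Suc n}"
  show "(\<lambda>x. (case x of (K, k) \<Rightarrow> case_nat k K) i) \<in> measurable (PiM {..<n} (\<lambda>_. shell_measure) \<Otimes>\<^sub>M shell_measure) shell_measure"
  proof (cases i)
    case (Suc j)
    with i have "j \<in> {..<n}" by simp
    then have "(\<lambda>x. fst x j) \<in> measurable (PiM {..<n} (\<lambda>_. shell_measure) \<Otimes>\<^sub>M shell_measure) shell_measure"
      by (intro measurable_compose[OF measurable_fst] measurable_component_singleton)
    then show ?thesis by (simp add: Suc case_prod_beta)
  qed (simp add: case_prod_beta)
next
  show "(\<lambda>x. (case x of (K, k) \<Rightarrow> case_nat k K)) \<in> space (PiM {..<n} (\<lambda>_. shell_measure) \<Otimes>\<^sub>M shell_measure) \<rightarrow> (\<Pi>\<^sub>E i\<in>{..<Suc n}. space shell_measure)"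
    using case_nat_in_space[of _ n] by (auto simp: space_pair_measure config_def space_PiM)
qed

lemma measurable_case_nat_fixed:
  assumes "K \<in> space (config n)"
  shows "(\<lambda>k. case_nat k K) \<in> measurable shell_measure (config (Suc n))"
  using measurable_Pair2[OF measurable_case_nat_config assms] by simp

definition box :: "real \<Rightarrow> real \<Rightarrow> nat \<Rightarrow> (nat \<Rightarrow> mode) set" where
  "box r R n = PiE {..<n} (\<lambda>_. shell r R)"

lemma box_in_sets [measurable]: "box r R n \<in> sets (config n)"
  unfolding box_def config_def by (intro sets_PiM_I_finite) auto

lemma emeasure_box_finite:
  assumes "0 < r"
  shows "emeasure (config n) (box r R n) < \<infinity>"
  unfolding box_def config_def
  using emeasure_shell_finite[OF assms, of R]
  by (subst shell_prod.emeasure_PiM) (auto simp: power_less_top_ennreal)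

subsection \<open>Fock vectors with bounded wave functions\<close>

text \<open>The conditions of \<open>fock_domain\<close> with their constants exposed, as needed for
  estimates that are uniform in the vectors.\<close>

definition fock_bounded :: "real \<Rightarrow> real \<Rightarrow> nat \<Rightarrow> real \<Rightarrow> fock \<Rightarrow> bool" where
  "fock_bounded r R N B \<psi> \<longleftrightarrow>
     (\<forall>n. \<psi> n \<in> borel_measurable (config n)) \<and>
     (\<forall>n \<pi>. \<pi> permutes {..<n} \<longrightarrow> (\<forall>K\<in>space (config n). \<psi> n (K \<circ> \<pi>) = \<psi> n K)) \<and>
     (\<forall>n. \<forall>K\<in>space (config n). norm (\<psi> n K) \<le> B) \<and>
     (\<forall>n. \<forall>K\<in>space (config n). \<psi> n K \<noteq> 0 \<longrightarrow> n < N \<and> (\<forall>i<n. K i \<in> shell r R))"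

lemma fock_boundedD:
  assumes "fock_bounded r R N B \<psi>"
  shows "\<psi> n \<in> borel_measurable (config n)"
    and "\<pi> permutes {..<n} \<Longrightarrow> K \<in> space (config n) \<Longrightarrow> \<psi> n (K \<circ> \<pi>) = \<psi> n K"
    and "K \<in> space (config n) \<Longrightarrow> norm (\<psi> n K) \<le> B"
    and "K \<in> space (config n) \<Longrightarrow> \<psi> n K \<noteq> 0 \<Longrightarrow> n < N"
    and "K \<in> space (config n) \<Longrightarrow> \<psi> n K \<noteq> 0 \<Longrightarrow> i < n \<Longrightarrow> K i \<in> shell r R"
    and "0 \<le> B"
proof -
  note * = assms[unfolded fock_bounded_def]
  show "\<psi> n \<in> borel_measurable (config n)"
    using *[THEN conjunct1] by simp
  show "\<pi> permutes {..<n} \<Longrightarrow> K \<in> space (config n) \<Longrightarrow> \<psi> n (K \<circ> \<pi>) = \<psi> n K"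
    using *[THEN conjunct2, THEN conjunct1] by simp
  show "K \<in> space (config n) \<Longrightarrow> norm (\<psi> n K) \<le> B"
    using *[THEN conjunct2, THEN conjunct2, THEN conjunct1] by simp
  show "K \<in> space (config n) \<Longrightarrow> \<psi> n K \<noteq> 0 \<Longrightarrow> n < N"
    and "K \<in> space (config n) \<Longrightarrow> \<psi> n K \<noteq> 0 \<Longrightarrow> i < n \<Longrightarrow> K i \<in> shell r R"
    using *[THEN conjunct2, THEN conjunct2, THEN conjunct2] by simp_all
  show "0 \<le> B"
  proof -
    \<comment> \<open>The empty configuration exists, so B bounds at least one norm.\<close>
    have "(\<lambda>_. undefined) \<in> space (config 0)" by (simp add: space_config extensional_def)
    then have "norm (\<psi> 0 (\<lambda>_. undefined)) \<le> B" using *[THEN conjunct2, THEN conjunct2, THEN conjunct1] by blast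
    then show ?thesis using norm_ge_zero order_trans by blast
  qed
qed

lemma fock_domain_iff: "\<psi> \<in> fock_domain \<longleftrightarrow> (\<exists>r R N B. 0 < r \<and> fock_bounded r R N B \<psi>)"
proof
  assume "\<psi> \<in> fock_domain"
  then obtain N B r R where *:
    "\<forall>n\<ge>N. \<forall>K\<in>space (config n). \<psi> n K = 0" "\<forall>n. \<forall>K\<in>space (config n). norm (\<psi> n K) \<le> B"
    "0 < r" "\<forall>n. \<forall>K\<in>space (config n). \<psi> n K \<noteq> 0 \<longrightarrow> (\<forall>i<n. r \<le> norm (fst (K i)) \<and> norm (fst (K i)) \<le> R)"
    "\<forall>n. \<psi> n \<in> borel_measurable (config n)"
    "\<forall>n \<pi>. \<pi> permutes {..<n} \<longrightarrow> (\<forall>K\<in>space (config n). \<psi> n (K \<circ> \<pi>) = \<psi> n K)"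
    unfolding fock_domain_def by (elim CollectE conjE exE)
  have "\<forall>n. \<forall>K\<in>space (config n). \<psi> n K \<noteq> 0 \<longrightarrow> n < N \<and> (\<forall>i<n. K i \<in> shell r R)"
  proof (intro allI ballI impI)
    fix n K assume "K \<in> space (config n)" "\<psi> n K \<noteq> 0"
    then show "n < N \<and> (\<forall>i<n. K i \<in> shell r R)"
      using *(1)[rule_format, of n K] *(4)[rule_format, of K n] by (auto simp: shell_def not_le[symmetric])
  qed
  with * have "fock_bounded r R N B \<psi>"
    unfolding fock_bounded_def by (intro conjI)
  with \<open>0 < r\<close> show "\<exists>r R N B. 0 < r \<and> fock_bounded r R N B \<psi>" by blast
next
  assume "\<exists>r R N B. 0 < r \<and> fock_bounded r R N B \<psi>"
  then obtain r R N B where "0 < r" and b: "fock_bounded r R N B \<psi>" by blast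
  have "\<forall>n\<ge>N. \<forall>K\<in>space (config n). \<psi> n K = 0" using fock_boundedD(4)[OF b] by (meson not_le)
  moreover have "\<forall>n. \<forall>K\<in>space (config n). \<psi> n K \<noteq> 0 \<longrightarrow> (\<forall>i<n. r \<le> norm (fst (K i)) \<and> norm (fst (K i)) \<le> R)"
    using fock_boundedD(5)[OF b] by (auto simp: shell_def)
  moreover have "\<forall>n. \<psi> n \<in> borel_measurable (config n)"
    "\<forall>n. \<forall>K\<in>space (config n). norm (\<psi> n K) \<le> B"
    "\<forall>n \<pi>. \<pi> permutes {..<n} \<longrightarrow> (\<forall>K\<in>space (config n). \<psi> n (K \<circ> \<pi>) = \<psi> n K)"
    using b[unfolded fock_bounded_def, THEN conjunct1]
      b[unfolded fock_bounded_def, THEN conjunct2, THEN conjunct2, THEN conjunct1]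
      b[unfolded fock_bounded_def, THEN conjunct2, THEN conjunct1] by this+
  ultimately show "\<psi> \<in> fock_domain"
    unfolding fock_domain_def using \<open>0 < r\<close> by (intro CollectI conjI exI)
qed

lemma fock_bounded_mono:
  assumes "fock_bounded r R N B \<psi>" "r' \<le> r" "R \<le> R'" "N \<le> N'" "B \<le> B'"
  shows "fock_bounded r' R' N' B' \<psi>"
proof -
  have *: "shell r R \<subseteq> shell r' R'" using assms by (auto simp: shell_def)
  show ?thesis
    unfolding fock_bounded_def
  proof (intro conjI allI impI ballI)
    fix n K assume K: "K \<in> space (config n)"
    show "norm (\<psi> n K) \<le> B'" using fock_boundedD(3)[OF assms(1) K] assms(5) by simp
    assume nz: "\<psi> n K \<noteq> 0"
    show "n < N'" using fock_boundedD(4)[OF assms(1) K nz] assms(4) by simp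
    show "K i \<in> shell r' R'" if "i < n" for i
      using fock_boundedD(5)[OF assms(1) K nz that] * by blast
  qed (rule fock_boundedD[OF assms(1)]; assumption)+
qed

lemma fock_domain_common:
  assumes "\<phi> \<in> fock_domain" "\<psi> \<in> fock_domain"
  obtains r R N B where "0 < r" "fock_bounded r R N B \<phi>" "fock_bounded r R N B \<psi>"
proof -
  from assms obtain r R N B r' R' N' B' where
    *: "0 < r" "fock_bounded r R N B \<phi>" "0 < r'" "fock_bounded r' R' N' B' \<psi>"
    by (auto simp: fock_domain_iff)
  show ?thesis
    by (rule that[of "min r r'" "max R R'" "max N N'" "max B B'"])
       (use * in \<open>auto intro: fock_bounded_mono\<close>)
qed

text \<open>Wave functions are total functions in HOL, and only their values on genuine
  configurations have a meaning.\<close>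

definition fock_eq :: "fock \<Rightarrow> fock \<Rightarrow> bool" where
  "fock_eq \<phi> \<psi> \<longleftrightarrow> (\<forall>n. \<forall>K\<in>space (config n). \<phi> n K = \<psi> n K)"

lemma fock_eq_refl [simp]: "fock_eq \<phi> \<phi>"
  by (simp add: fock_eq_def)

lemma annihilate_cong: "fock_eq \<phi> \<psi> \<Longrightarrow> fock_eq (annihilate u \<phi>) (annihilate u \<psi>)"
  by (simp add: fock_eq_def annihilate_def case_nat_in_space)

lemma fock_inner_cong: "fock_eq \<phi> \<phi>' \<Longrightarrow> fock_eq \<psi> \<psi>' \<Longrightarrow> fock_inner \<phi> \<psi> = fock_inner \<phi>' \<psi>'"
  unfolding fock_inner_def fock_eq_def by (intro arg_cong[where f = suminf] ext Bochner_Integration.integral_cong) auto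

lemma wick_form_cong: "fock_eq \<phi> \<phi>' \<Longrightarrow> fock_eq \<psi> \<psi>' \<Longrightarrow> wick_form us \<phi> \<psi> = wick_form us \<phi>' \<psi>'"
proof (induction us arbitrary: \<phi> \<psi> \<phi>' \<psi>')
  case (Cons u us)
  show ?case
    using Cons.IH[OF annihilate_cong[OF Cons.prems(1)] Cons.prems(2)]
      Cons.IH[OF Cons.prems(1) annihilate_cong[OF Cons.prems(2)]] by simp
qed (simp add: fock_inner_cong)

text \<open>Bounds are asked on shells only: amplitudes may be singular at zero momentum because of
  the string integration, and derivatives of the field make them grow with the momentum. Vectors of
  \<open>fock_domain\<close> see neither end.\<close>

definition mode_bounded :: "(mode \<Rightarrow> complex) \<Rightarrow> bool" where
  "mode_bounded u \<longleftrightarrow> u \<in> borel_measurable shell_measure \<and>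
     (\<forall>r R. 0 < r \<longrightarrow> (\<exists>B. \<forall>k\<in>shell r R. norm (u k) \<le> B))"

lemma mode_bounded_measurable: "mode_bounded u \<Longrightarrow> u \<in> borel_measurable shell_measure"
  by (simp add: mode_bounded_def)

lemma mode_boundedE:
  assumes "mode_bounded u" "0 < r"
  obtains b where "0 \<le> b" "\<And>k. k \<in> shell r R \<Longrightarrow> norm (u k) \<le> b"
proof -
  from assms obtain b where "\<forall>k\<in>shell r R. norm (u k) \<le> b" unfolding mode_bounded_def by blast
  then show ?thesis by (intro that[of "max 0 b"]) auto
qed

lemma mode_bounded_mult:
  assumes u: "mode_bounded u" and v: "mode_bounded v"
  shows "mode_bounded (\<lambda>k. u k * v k)"
  unfolding mode_bounded_def
proof (intro conjI allI impI)
  show "(\<lambda>k. u k * v k) \<in> borel_measurable shell_measure"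
    using u v by (auto simp: mode_bounded_def intro: borel_measurable_times borel_measurable_add)
  fix r R :: real assume "0 < r"
  obtain b where b: "0 \<le> b" "\<And>k. k \<in> shell r R \<Longrightarrow> norm (u k) \<le> b" using mode_boundedE[OF u \<open>0 < r\<close>] by metis
  obtain c where c: "0 \<le> c" "\<And>k. k \<in> shell r R \<Longrightarrow> norm (v k) \<le> c" using mode_boundedE[OF v \<open>0 < r\<close>] by metis
  show "\<exists>B. \<forall>k\<in>shell r R. norm (u k * v k) \<le> B"
    using b c by (intro exI[of _ "b * c"]) (auto simp: norm_mult intro!: mult_mono)
qed

lemma mode_bounded_add:
  assumes u: "mode_bounded u" and v: "mode_bounded v"
  shows "mode_bounded (\<lambda>k. u k + v k)"
  unfolding mode_bounded_def
proof (intro conjI allI impI)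
  show "(\<lambda>k. u k + v k) \<in> borel_measurable shell_measure"
    using u v by (auto simp: mode_bounded_def intro: borel_measurable_times borel_measurable_add)
  fix r R :: real assume "0 < r"
  obtain b where b: "0 \<le> b" "\<And>k. k \<in> shell r R \<Longrightarrow> norm (u k) \<le> b" using mode_boundedE[OF u \<open>0 < r\<close>] by metis
  obtain c where c: "0 \<le> c" "\<And>k. k \<in> shell r R \<Longrightarrow> norm (v k) \<le> c" using mode_boundedE[OF v \<open>0 < r\<close>] by metis
  show "\<exists>B. \<forall>k\<in>shell r R. norm (u k + v k) \<le> B"
    using b c by (intro exI[of _ "b + c"]) (auto intro!: norm_triangle_le add_mono)
qed

lemma mode_bounded_const: "mode_bounded (\<lambda>k. c)"
  by (auto simp: mode_bounded_def)

lemma mode_bounded_sum: "(\<And>i. i \<in> I \<Longrightarrow> mode_bounded (u i)) \<Longrightarrow> mode_bounded (\<lambda>k. \<Sum>i\<in>I. u i k)"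
  by (induction I rule: infinite_finite_induct) (auto intro: mode_bounded_add mode_bounded_const)

lemma annihilate_integrable_bounded:
  assumes u: "u \<in> borel_measurable shell_measure" and b: "0 \<le> b" "\<And>k. k \<in> shell r R \<Longrightarrow> norm (u k) \<le> b"
    and \<psi>: "fock_bounded r R N B \<psi>" and r: "0 < r" and K: "K \<in> space (config n)"
  shows "integrable shell_measure (\<lambda>k. u k * \<psi> (Suc n) (case_nat k K))"
proof (rule integrableI_bounded_set[where A = "shell r R" and B = "b * B"])
    show "(\<lambda>k. u k * \<psi> (Suc n) (case_nat k K)) \<in> borel_measurable shell_measure"
      using measurable_compose[OF measurable_case_nat_fixed[OF K] fock_boundedD(1)[OF \<psi>]] u
      by simp
    show "AE k in shell_measure. k \<in> shell r R \<longrightarrow> norm (u k * \<psi> (Suc n) (case_nat k K)) \<le> b * B"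
      using b fock_boundedD(3)[OF \<psi> case_nat_in_space[OF K]] by (auto simp: norm_mult intro!: mult_mono AE_I2)
    show "AE k in shell_measure. k \<notin> shell r R \<longrightarrow> u k * \<psi> (Suc n) (case_nat k K) = 0"
      using fock_boundedD(5)[OF \<psi> case_nat_in_space[OF K], of _ 0] by (auto intro!: AE_I2)
qed (auto simp: emeasure_shell_finite[OF r, simplified])

lemma annihilate_integrable:
  assumes "mode_bounded u" "\<psi> \<in> fock_domain" "K \<in> space (config n)"
  shows "integrable shell_measure (\<lambda>k. u k * \<psi> (Suc n) (case_nat k K))"
proof -
  from assms obtain r R N B where *: "0 < r" "fock_bounded r R N B \<psi>" by (auto simp: fock_domain_iff)
  obtain b where "0 \<le> b" "\<And>k. k \<in> shell r R \<Longrightarrow> norm (u k) \<le> b"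
    using mode_boundedE[OF assms(1) *(1)] by metis
  then show ?thesis
    by (intro annihilate_integrable_bounded[OF mode_bounded_measurable[OF assms(1)] _ _ *(2,1) assms(3)])
qed

text \<open>The factor sqrt N bounds sqrt (n + 1), as the wave function vanishes unless n + 1 < N;
  the measure of the shell comes from integrating out the absorbed particle.\<close>

lemma annihilate_bounded:
  assumes u: "u \<in> borel_measurable shell_measure" and b: "0 \<le> b" "\<And>k. k \<in> shell r R \<Longrightarrow> norm (u k) \<le> b"
    and \<psi>: "fock_bounded r R N B \<psi>" and r: "0 < r"
  shows "fock_bounded r R N (sqrt (real N) * (b * measure shell_measure (shell r R)) * B) (annihilate u \<psi>)"
  unfolding fock_bounded_def
proof (intro conjI allI impI ballI)
  fix n
  have "(\<lambda>(K, k). \<psi> (Suc n) (case_nat k K)) \<in> borel_measurable (config n \<Otimes>\<^sub>M shell_measure)"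
    using measurable_compose[OF measurable_case_nat_config fock_boundedD(1)[OF \<psi>], of n] by (simp add: case_prod_beta)
  then have "(\<lambda>(K, k). u k * \<psi> (Suc n) (case_nat k K)) \<in> borel_measurable (config n \<Otimes>\<^sub>M shell_measure)"
    using u by (simp add: case_prod_beta)
  then show "annihilate u \<psi> n \<in> borel_measurable (config n)"
    unfolding annihilate_def by (intro borel_measurable_times borel_measurable_const shell.borel_measurable_lebesgue_integral)
next
  fix n \<pi> K assume \<pi>: "\<pi> permutes {..<n}" and K: "K \<in> space (config n)"
  \<comment> \<open>The absorbed particle sits in position 0, which the extended permutation
    fixes.\<close>
  define \<pi>' where "\<pi>' = case_nat 0 (\<lambda>i. Suc (\<pi> i))"
  have "\<pi>' permutes {..<Suc n}"
  proof -
    have "bij_betw \<pi> {..<n} {..<n}" using \<pi> by (rule permutes_imp_bij)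
    then have "bij_betw \<pi>' {..<Suc n} {..<Suc n}"
      unfolding lessThan_Suc_eq_insert_0 \<pi>'_def bij_betw_def
      by (auto simp: inj_on_def image_image)
    moreover have "\<pi>' i = i" if "i \<notin> {..<Suc n}" for i
      using that permutes_not_in[OF \<pi>] by (auto simp: \<pi>'_def split: nat.split)
    ultimately show ?thesis by (rule bij_imp_permutes)
  qed
  moreover have "case_nat k (K \<circ> \<pi>) = case_nat k K \<circ> \<pi>'" for k
    by (auto simp: \<pi>'_def fun_eq_iff split: nat.split)
  ultimately have "\<psi> (Suc n) (case_nat k (K \<circ> \<pi>)) = \<psi> (Suc n) (case_nat k K)" for k
    using fock_boundedD(2)[OF \<psi> _ case_nat_in_space[OF K]] by simp
  then show "annihilate u \<psi> n (K \<circ> \<pi>) = annihilate u \<psi> n K"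
    by (simp add: annihilate_def)
next
  fix n K assume K: "K \<in> space (config n)"
  let ?f = "\<lambda>k. u k * \<psi> (Suc n) (case_nat k K)"
  let ?M = "measure shell_measure (shell r R)"
  have B: "0 \<le> B" using fock_boundedD(6)[OF \<psi>] .
  show "norm (annihilate u \<psi> n K) \<le> sqrt (real N) * (b * ?M) * B"
  proof (cases "Suc n < N")
    case True
    have bd: "norm (?f k) \<le> b * B * indicator (shell r R) k" for k
      using b(1) b(2)[of k] fock_boundedD(3)[OF \<psi> case_nat_in_space[OF K], of k] fock_boundedD(5)[OF \<psi> case_nat_in_space[OF K], of k 0]
      by (cases "\<psi> (Suc n) (case_nat k K) = 0") (auto simp: norm_mult indicator_def intro!: mult_mono)
    have "norm (LINT k|shell_measure. ?f k) \<le> (LINT k|shell_measure. b * B * indicator (shell r R) k)"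
    proof (rule norm_integral_le)
      show "norm (?f k) \<le> b * B * indicator (shell r R) k" for k by (rule bd)
      show "integrable shell_measure (\<lambda>k. b * B * indicator (shell r R) k)"
        using emeasure_shell_finite[OF r, of R] by auto
    qed
    also have "\<dots> = b * B * ?M" by simp
    finally have "norm (annihilate u \<psi> n K) \<le> sqrt (real (Suc n)) * (b * B * ?M)"
      unfolding annihilate_def norm_mult by (intro mult_mono) auto
    also have "\<dots> \<le> sqrt (real N) * (b * B * ?M)"
      using True b B by (intro mult_right_mono) auto
    finally show ?thesis by (simp add: mult_ac)
  next
    case False
    then have "\<psi> (Suc n) (case_nat k K) = 0" for k
      using fock_boundedD(4)[OF \<psi> case_nat_in_space[OF K]] by blast
    then show ?thesis using b B by (simp add: annihilate_def)
  qed
  { assume nz: "annihilate u \<psi> n K \<noteq> 0"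
    have "\<exists>k. \<psi> (Suc n) (case_nat k K) \<noteq> 0"
    proof (rule ccontr)
      assume "\<not> ?thesis"
      then have "\<psi> (Suc n) (case_nat k K) = 0" for k by blast
      then have "annihilate u \<psi> n K = 0" by (simp add: annihilate_def)
      with nz show False by contradiction
    qed
    then obtain k where k: "\<psi> (Suc n) (case_nat k K) \<noteq> 0" ..
    show "n < N"
      using fock_boundedD(4)[OF \<psi> case_nat_in_space[OF K] k] by simp
    show "K i \<in> shell r R" if "i < n" for i
      using fock_boundedD(5)[OF \<psi> case_nat_in_space[OF K] k, of "Suc i"] that by simp }
qed

lemma annihilate_in_fock_domain:
  assumes u: "mode_bounded u" and "\<psi> \<in> fock_domain"
  shows "annihilate u \<psi> \<in> fock_domain"
proof -
  from assms obtain r R N B where *: "0 < r" "fock_bounded r R N B \<psi>" by (auto simp: fock_domain_iff)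
  obtain b where "0 \<le> b" "\<And>k. k \<in> shell r R \<Longrightarrow> norm (u k) \<le> b" using mode_boundedE[OF u *(1)] by metis
  then have "fock_bounded r R N (sqrt (real N) * (b * measure shell_measure (shell r R)) * B) (annihilate u \<psi>)"
    by (intro annihilate_bounded[OF mode_bounded_measurable[OF u] _ _ *(2,1)])
  with *(1) show ?thesis
    by (auto simp: fock_domain_iff)
qed

subsection \<open>Wick products as sesquilinear forms\<close>

definition fock_add :: "fock \<Rightarrow> fock \<Rightarrow> fock" where
  "fock_add \<phi> \<psi> = (\<lambda>n K. \<phi> n K + \<psi> n K)"

definition fock_scale :: "complex \<Rightarrow> fock \<Rightarrow> fock" where
  "fock_scale c \<psi> = (\<lambda>n K. c * \<psi> n K)"

lemma fock_bounded_add: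
  assumes "fock_bounded r R N B \<phi>" "fock_bounded r R N B' \<psi>"
  shows "fock_bounded r R N (B + B') (fock_add \<phi> \<psi>)"
  unfolding fock_bounded_def fock_add_def
proof (intro conjI allI impI ballI)
  fix n show "(\<lambda>K. \<phi> n K + \<psi> n K) \<in> borel_measurable (config n)"
    by (intro borel_measurable_add fock_boundedD(1)[OF assms(1)] fock_boundedD(1)[OF assms(2)])
next
  fix n \<pi> K assume "\<pi> permutes {..<n}" "K \<in> space (config n)"
  then show "\<phi> n (K \<circ> \<pi>) + \<psi> n (K \<circ> \<pi>) = \<phi> n K + \<psi> n K"
    using fock_boundedD(2)[OF assms(1)] fock_boundedD(2)[OF assms(2)] by metis
next
  fix n K assume K: "K \<in> space (config n)"
  show "norm (\<phi> n K + \<psi> n K) \<le> B + B'"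
    using fock_boundedD(3)[OF assms(1) K] fock_boundedD(3)[OF assms(2) K] by (intro norm_triangle_le) simp
  assume "\<phi> n K + \<psi> n K \<noteq> 0"
  then have nz: "\<phi> n K \<noteq> 0 \<or> \<psi> n K \<noteq> 0" by auto
  then show "n < N" using fock_boundedD(4)[OF assms(1) K] fock_boundedD(4)[OF assms(2) K] by blast
  show "K i \<in> shell r R" if "i < n" for i
    using nz fock_boundedD(5)[OF assms(1) K _ that] fock_boundedD(5)[OF assms(2) K _ that] by blast
qed

lemma fock_add_in_fock_domain: "\<phi> \<in> fock_domain \<Longrightarrow> \<psi> \<in> fock_domain \<Longrightarrow> fock_add \<phi> \<psi> \<in> fock_domain"
  by (metis fock_domain_common fock_bounded_add fock_domain_iff)

text \<open>Multiplication by a symmetric function of the momenta covers scalars, translations and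
  the energy-momentum operators.\<close>

lemma fock_bounded_multiplier:
  assumes \<psi>: "fock_bounded r R N B \<psi>" and b: "0 \<le> b"
    and meas: "\<And>n. (\<lambda>K. g n K) \<in> borel_measurable (config n)"
    and sym: "\<And>n \<pi> K. \<pi> permutes {..<n} \<Longrightarrow> g n (K \<circ> \<pi>) = g n K"
    and bound: "\<And>n K. n < N \<Longrightarrow> (\<And>i. i < n \<Longrightarrow> K i \<in> shell r R) \<Longrightarrow> norm (g n K) \<le> b"
  shows "fock_bounded r R N (b * B) (\<lambda>n K. g n K * \<psi> n K)"
  unfolding fock_bounded_def
proof (intro conjI allI impI ballI)
  fix n show "(\<lambda>K. g n K * \<psi> n K) \<in> borel_measurable (config n)"
    by (intro borel_measurable_times meas fock_boundedD(1)[OF \<psi>])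
next
  fix n \<pi> K assume "\<pi> permutes {..<n}" "K \<in> space (config n)"
  then show "g n (K \<circ> \<pi>) * \<psi> n (K \<circ> \<pi>) = g n K * \<psi> n K"
    using fock_boundedD(2)[OF \<psi>] sym by metis
next
  fix n K assume K: "K \<in> space (config n)"
  show "norm (g n K * \<psi> n K) \<le> b * B"
  proof (cases "\<psi> n K = 0")
    case True
    then show ?thesis using b fock_boundedD(6)[OF \<psi>] by simp
  next
    case False
    then have "norm (g n K) \<le> b" using fock_boundedD(4,5)[OF \<psi> K] by (intro bound)
    then show ?thesis using fock_boundedD(3)[OF \<psi> K] b by (auto simp: norm_mult intro!: mult_mono)
  qed
  assume "g n K * \<psi> n K \<noteq> 0"
  then have nz: "\<psi> n K \<noteq> 0" by auto
  then show "n < N" using fock_boundedD(4)[OF \<psi> K] by blast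
  show "K i \<in> shell r R" if "i < n" for i
    using fock_boundedD(5)[OF \<psi> K nz that] .
qed

lemma fock_bounded_scale:
  assumes "fock_bounded r R N B \<psi>"
  shows "fock_bounded r R N (norm c * B) (fock_scale c \<psi>)"
  unfolding fock_scale_def by (rule fock_bounded_multiplier[OF assms]) auto

lemma annihilate_add:
  assumes "mode_bounded u" "\<phi> \<in> fock_domain" "\<psi> \<in> fock_domain"
  shows "fock_eq (annihilate u (fock_add \<phi> \<psi>)) (fock_add (annihilate u \<phi>) (annihilate u \<psi>))"
  unfolding fock_eq_def annihilate_def fock_add_def
  using annihilate_integrable[OF assms(1,2)] annihilate_integrable[OF assms(1,3)] by (simp add: algebra_simps)

lemma annihilate_scale: "annihilate u (fock_scale c \<psi>) = fock_scale c (annihilate u \<psi>)"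
proof -
  have "(LINT k|shell_measure. u k * (c * \<psi> (Suc n) (case_nat k K))) = c * (LINT k|shell_measure. u k * \<psi> (Suc n) (case_nat k K))" for n K
    by (simp add: mult.left_commute)
  then show ?thesis by (simp add: annihilate_def fock_scale_def fun_eq_iff mult_ac)
qed

lemma fock_inner_integrable_bounded:
  assumes \<phi>: "fock_bounded r R N B \<phi>" and \<psi>: "fock_bounded r R N B' \<psi>" and r: "0 < r"
  shows "integrable (config n) (\<lambda>K. cnj (\<phi> n K) * \<psi> n K)"
    and "norm (LINT K|config n. cnj (\<phi> n K) * \<psi> n K) \<le> B * B' * measure (config n) (box r R n)"
    and "N \<le> n \<Longrightarrow> (LINT K|config n. cnj (\<phi> n K) * \<psi> n K) = 0"
proof -
  have zero: "cnj (\<phi> n K) * \<psi> n K = 0" if "K \<in> space (config n)" "K \<notin> box r R n" for K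
  proof (rule ccontr)
    assume "cnj (\<phi> n K) * \<psi> n K \<noteq> 0"
    then have "\<forall>i<n. K i \<in> shell r R" using fock_boundedD(5)[OF \<psi> that(1)] by auto
    with that show False by (auto simp: box_def space_config PiE_iff)
  qed
  have bd: "norm (cnj (\<phi> n K) * \<psi> n K) \<le> B * B'" if "K \<in> space (config n)" for K
    using fock_boundedD(3)[OF \<phi> that] fock_boundedD(3)[OF \<psi> that] by (auto simp: norm_mult intro!: mult_mono fock_boundedD(6)[OF \<phi>])
  show int: "integrable (config n) (\<lambda>K. cnj (\<phi> n K) * \<psi> n K)"
  proof (rule integrableI_bounded_set[where A = "box r R n" and B = "B * B'"])
    show "(\<lambda>K. cnj (\<phi> n K) * \<psi> n K) \<in> borel_measurable (config n)"
      by (intro borel_measurable_times fock_boundedD(1)[OF \<psi>]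
            measurable_compose[OF fock_boundedD(1)[OF \<phi>] borel_measurable_continuous_onI]) (intro continuous_intros)
    show "AE K in config n. K \<in> box r R n \<longrightarrow> norm (cnj (\<phi> n K) * \<psi> n K) \<le> B * B'"
      using bd by (auto intro!: AE_I2)
    show "AE K in config n. K \<notin> box r R n \<longrightarrow> cnj (\<phi> n K) * \<psi> n K = 0"
      using zero by (auto intro!: AE_I2)
  qed (use emeasure_box_finite[OF r, of n R] in auto)
  have "norm (LINT K|config n. cnj (\<phi> n K) * \<psi> n K) \<le> (LINT K|config n. B * B' * indicator (box r R n) K)"
  proof (rule norm_integral_le)
    show "integrable (config n) (\<lambda>K. B * B' * indicator (box r R n) K)"
      using emeasure_box_finite[OF r, of n R] by auto
    show "norm (cnj (\<phi> n K) * \<psi> n K) \<le> B * B' * indicator (box r R n) K" if "K \<in> space (config n)" for K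
      using bd[OF that] zero[OF that] by (auto simp: indicator_def)
  qed
  also have "\<dots> = B * B' * measure (config n) (box r R n)"
    by simp
  finally show "norm (LINT K|config n. cnj (\<phi> n K) * \<psi> n K) \<le> B * B' * measure (config n) (box r R n)" .
  assume n: "N \<le> n"
  have "(LINT K|config n. cnj (\<phi> n K) * \<psi> n K) = (LINT K|config n. 0)"
    using fock_boundedD(4)[OF \<psi>] n by (intro Bochner_Integration.integral_cong refl) (metis mult_eq_0_iff not_le)
  then show "(LINT K|config n. cnj (\<phi> n K) * \<psi> n K) = 0" by simp
qed

lemma fock_inner_finite:
  assumes "fock_bounded r R N B \<phi>" "fock_bounded r R N B' \<psi>" "0 < r"
  shows "fock_inner \<phi> \<psi> = (\<Sum>n<N. LINT K|config n. cnj (\<phi> n K) * \<psi> n K)"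
  unfolding fock_inner_def
  by (rule suminf_finite) (use fock_inner_integrable_bounded(3)[OF assms] in \<open>auto simp: not_less\<close>)

lemma fock_domain_common3:
  assumes "\<phi> \<in> fock_domain" "\<psi> \<in> fock_domain" "\<xi> \<in> fock_domain"
  obtains r R N B where "0 < r" "fock_bounded r R N B \<phi>" "fock_bounded r R N B \<psi>" "fock_bounded r R N B \<xi>"
proof -
  obtain r R N B where 1: "0 < r" "fock_bounded r R N B \<phi>" "fock_bounded r R N B \<psi>"
    using fock_domain_common[OF assms(1,2)] .
  obtain r' R' N' B' where 2: "0 < r'" "fock_bounded r' R' N' B' \<xi>"
    using assms(3) by (auto simp: fock_domain_iff)
  show ?thesis
    by (rule that[of "min r r'" "max R R'" "max N N'" "max B B'"])
       (use 1 2 in \<open>auto intro: fock_bounded_mono\<close>)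
qed

lemma fock_inner_add:
  assumes "\<phi> \<in> fock_domain" "\<phi>' \<in> fock_domain" "\<psi> \<in> fock_domain"
  shows "fock_inner (fock_add \<phi> \<phi>') \<psi> = fock_inner \<phi> \<psi> + fock_inner \<phi>' \<psi>"
    and "fock_inner \<psi> (fock_add \<phi> \<phi>') = fock_inner \<psi> \<phi> + fock_inner \<psi> \<phi>'"
proof -
  obtain r R N B where *: "0 < r" "fock_bounded r R N B \<phi>" "fock_bounded r R N B \<phi>'" "fock_bounded r R N B \<psi>"
    using fock_domain_common3[OF assms] .
  note int = fock_inner_integrable_bounded(1)[OF _ _ *(1)]
  show "fock_inner (fock_add \<phi> \<phi>') \<psi> = fock_inner \<phi> \<psi> + fock_inner \<phi>' \<psi>"
    unfolding fock_inner_finite[OF fock_bounded_add[OF *(2,3)] *(4,1)] fock_inner_finite[OF *(2,4,1)] fock_inner_finite[OF *(3,4,1)]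
    using int[OF *(2,4)] int[OF *(3,4)] by (simp add: fock_add_def algebra_simps sum.distrib)
  show "fock_inner \<psi> (fock_add \<phi> \<phi>') = fock_inner \<psi> \<phi> + fock_inner \<psi> \<phi>'"
    unfolding fock_inner_finite[OF *(4) fock_bounded_add[OF *(2,3)] *(1)] fock_inner_finite[OF *(4,2,1)] fock_inner_finite[OF *(4,3,1)]
    using int[OF *(4,2)] int[OF *(4,3)] by (simp add: fock_add_def algebra_simps sum.distrib)
qed

lemma wick_form_add:
  assumes "\<forall>u\<in>set us. mode_bounded u" "\<phi> \<in> fock_domain" "\<phi>' \<in> fock_domain" "\<psi> \<in> fock_domain"
  shows "wick_form us (fock_add \<phi> \<phi>') \<psi> = wick_form us \<phi> \<psi> + wick_form us \<phi>' \<psi>"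
    and "wick_form us \<psi> (fock_add \<phi> \<phi>') = wick_form us \<psi> \<phi> + wick_form us \<psi> \<phi>'"
  using assms
proof (induction us arbitrary: \<phi> \<phi>' \<psi>)
  case Nil
  { case 1 with fock_inner_add show ?case by simp next case 2 with fock_inner_add show ?case by simp }
next
  case (Cons u us)
  { case 1
    note a = annihilate_in_fock_domain[of u]
    have "wick_form us (annihilate u (fock_add \<phi> \<phi>')) \<psi> = wick_form us (fock_add (annihilate u \<phi>) (annihilate u \<phi>')) \<psi>"
      using 1 by (intro wick_form_cong annihilate_add) auto
    with 1 Cons.IH(1)[of "annihilate u \<phi>" "annihilate u \<phi>'" \<psi>] Cons.IH(1)[of \<phi> \<phi>' "annihilate u \<psi>"] a
    show ?case by simp
  next
    case 2
    note a = annihilate_in_fock_domain[of u]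
    have "wick_form us \<psi> (annihilate u (fock_add \<phi> \<phi>')) = wick_form us \<psi> (fock_add (annihilate u \<phi>) (annihilate u \<phi>'))"
      using 2 by (intro wick_form_cong annihilate_add) auto
    with 2 Cons.IH(2)[of "annihilate u \<phi>" "annihilate u \<phi>'" \<psi>] Cons.IH(2)[of \<phi> \<phi>' "annihilate u \<psi>"] a
    show ?case by simp }
qed

lemma fock_inner_scale:
  assumes "\<phi> \<in> fock_domain" "\<psi> \<in> fock_domain"
  shows "fock_inner (fock_scale c \<phi>) \<psi> = cnj c * fock_inner \<phi> \<psi>"
    and "fock_inner \<phi> (fock_scale c \<psi>) = c * fock_inner \<phi> \<psi>"
proof -
  obtain r R N B where *: "0 < r" "fock_bounded r R N B \<phi>" "fock_bounded r R N B \<psi>"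
    using fock_domain_common[OF assms] .
  show "fock_inner (fock_scale c \<phi>) \<psi> = cnj c * fock_inner \<phi> \<psi>"
    unfolding fock_inner_finite[OF fock_bounded_scale[OF *(2)] *(3,1)] fock_inner_finite[OF *(2,3,1)]
    by (simp add: fock_scale_def mult.assoc sum_distrib_left)
  show "fock_inner \<phi> (fock_scale c \<psi>) = c * fock_inner \<phi> \<psi>"
    unfolding fock_inner_finite[OF *(2) fock_bounded_scale[OF *(3)] *(1)] fock_inner_finite[OF *(2,3,1)]
    by (simp add: fock_scale_def mult.left_commute sum_distrib_left)
qed

lemma wick_form_scale:
  assumes "\<forall>u\<in>set us. mode_bounded u" "\<phi> \<in> fock_domain" "\<psi> \<in> fock_domain"
  shows "wick_form us (fock_scale c \<phi>) \<psi> = cnj c * wick_form us \<phi> \<psi>"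
    and "wick_form us \<phi> (fock_scale c \<psi>) = c * wick_form us \<phi> \<psi>"
  using assms
proof (induction us arbitrary: \<phi> \<psi>)
  case Nil
  { case 1 with fock_inner_scale show ?case by simp next case 2 with fock_inner_scale show ?case by simp }
next
  case (Cons u us)
  { case 1 then show ?case
      using Cons.IH(1) annihilate_in_fock_domain[of u] by (simp add: annihilate_scale distrib_left)
  next
    case 2 then show ?case
      using Cons.IH(2) annihilate_in_fock_domain[of u] by (simp add: annihilate_scale distrib_left) }
qed

text \<open>Fubini exchanges the two integrals and Bose symmetry exchanges the two absorbed
  particles.\<close>

lemma annihilate_commute:
  assumes u: "mode_bounded u" and v: "mode_bounded v" and "\<psi> \<in> fock_domain"
  shows "fock_eq (annihilate u (annihilate v \<psi>)) (annihilate v (annihilate u \<psi>))"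
  unfolding fock_eq_def
proof (intro allI ballI)
  fix n K assume K: "K \<in> space (config n)"
  from assms obtain r R N B where r: "0 < r" and \<psi>: "fock_bounded r R N B \<psi>" by (auto simp: fock_domain_iff)
  obtain b where b: "0 \<le> b" "\<And>k. k \<in> shell r R \<Longrightarrow> norm (u k) \<le> b" using mode_boundedE[OF u r] by metis
  obtain c where c: "0 \<le> c" "\<And>k. k \<in> shell r R \<Longrightarrow> norm (v k) \<le> c" using mode_boundedE[OF v r] by metis
  let ?\<psi> = "\<lambda>k l. \<psi> (Suc (Suc n)) (case_nat k (case_nat l K))"
  have sym: "?\<psi> k l = ?\<psi> l k" for k l
  proof -
    have "case_nat k (case_nat l K) = case_nat l (case_nat k K) \<circ> Transposition.transpose 0 (Suc 0)"
      by (auto simp: fun_eq_iff Transposition.transpose_def split: nat.split)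
    moreover have "Transposition.transpose 0 (Suc 0) permutes {..<Suc (Suc n)}"
      by (intro permutes_swap_id) auto
    ultimately show ?thesis
      using fock_boundedD(2)[OF \<psi> _ case_nat_in_space[OF case_nat_in_space[OF K]]] by simp
  qed
  let ?f = "\<lambda>(k, l). u k * (v l * ?\<psi> l k)"
  have "integrable (shell_measure \<Otimes>\<^sub>M shell_measure) ?f"
  proof (rule integrableI_bounded_set[where A = "shell r R \<times> shell r R" and B = "b * (c * B)"])
    have 1: "(\<lambda>(k, l). case_nat l (case_nat k K)) \<in> measurable (shell_measure \<Otimes>\<^sub>M shell_measure) (config (Suc (Suc n)))"
    proof -
      have "(\<lambda>x. (case_nat (fst x) K, snd x)) \<in> measurable (shell_measure \<Otimes>\<^sub>M shell_measure) (config (Suc n) \<Otimes>\<^sub>M shell_measure)"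
        by (intro measurable_Pair measurable_compose[OF measurable_fst measurable_case_nat_fixed[OF K]] measurable_snd)
      from measurable_compose[OF this measurable_case_nat_config] show ?thesis by (simp add: case_prod_beta)
    qed
    have [measurable]: "u \<in> borel_measurable shell_measure" "v \<in> borel_measurable shell_measure"
      using u v mode_bounded_measurable by auto
    show "?f \<in> borel_measurable (shell_measure \<Otimes>\<^sub>M shell_measure)"
      using measurable_compose[OF 1 fock_boundedD(1)[OF \<psi>]] by (simp add: case_prod_beta)
    have mem: "case_nat l (case_nat k K) \<in> space (config (Suc (Suc n)))" for k l
      using case_nat_in_space[OF case_nat_in_space[OF K]] .
    show "AE x in shell_measure \<Otimes>\<^sub>M shell_measure. x \<in> shell r R \<times> shell r R \<longrightarrow> norm (?f x) \<le> b * (c * B)"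
      using b c fock_boundedD(3)[OF \<psi> mem] by (auto simp: norm_mult intro!: AE_I2 mult_mono)
    show "AE x in shell_measure \<Otimes>\<^sub>M shell_measure. x \<notin> shell r R \<times> shell r R \<longrightarrow> ?f x = 0"
    proof (intro AE_I2 impI)
      fix x :: "mode \<times> mode" assume "x \<notin> shell r R \<times> shell r R"
      moreover obtain k l where x: "x = (k, l)" by (cases x)
      ultimately have "?\<psi> l k = 0"
        using fock_boundedD(5)[OF \<psi> mem, of l k 0] fock_boundedD(5)[OF \<psi> mem, of l k "Suc 0"] by auto
      then show "?f x = 0" by (simp add: x)
    qed
    show "emeasure (shell_measure \<Otimes>\<^sub>M shell_measure) (shell r R \<times> shell r R) < \<infinity>"
      using emeasure_shell_finite[OF r, of R] by (simp add: shell.emeasure_pair_measure_Times ennreal_mult_less_top)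
  qed auto
  from shell_pair.Fubini_integral[OF this]
  have "(LINT l|shell_measure. LINT k|shell_measure. u k * (v l * ?\<psi> l k)) =
        (LINT k|shell_measure. LINT l|shell_measure. u k * (v l * ?\<psi> l k))"
    by simp
  moreover have "(LINT k|shell_measure. u k * (v l * ?\<psi> l k)) = v l * (LINT k|shell_measure. u k * ?\<psi> k l)" for l
  proof -
    have "u k * (v l * ?\<psi> l k) = v l * (u k * ?\<psi> k l)" for k
      by (subst sym) (rule mult.left_commute)
    then show ?thesis by (simp only: integral_mult_right_zero)
  qed
  moreover have "(LINT l|shell_measure. u k * (v l * ?\<psi> l k)) = u k * (LINT l|shell_measure. v l * ?\<psi> l k)" for k
    by (rule integral_mult_right_zero)
  ultimately have "(LINT l|shell_measure. v l * (LINT k|shell_measure. u k * ?\<psi> k l)) =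
     (LINT k|shell_measure. u k * (LINT l|shell_measure. v l * ?\<psi> l k))"
    by (simp only:)
  moreover have "annihilate u' (annihilate v' \<psi>) n K = of_real (sqrt (real (Suc n))) * (of_real (sqrt (real (Suc (Suc n)))) *
      (LINT k|shell_measure. u' k * (LINT l|shell_measure. v' l * ?\<psi> l k)))" for u' v'
  proof -
    have "(LINT k|shell_measure. u' k * (c * (LINT l|shell_measure. v' l * ?\<psi> l k))) =
       c * (LINT k|shell_measure. u' k * (LINT l|shell_measure. v' l * ?\<psi> l k))" for c
      by (subst mult.left_commute) (rule integral_mult_right_zero)
    then show ?thesis by (simp only: annihilate_def)
  qed
  ultimately show "annihilate u (annihilate v \<psi>) n K = annihilate v (annihilate u \<psi>) n K"
    by (simp only:)
qed

lemma wick_form_swap: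
  assumes "mode_bounded u" "mode_bounded v" "\<phi> \<in> fock_domain" "\<psi> \<in> fock_domain"
  shows "wick_form (u # v # us) \<phi> \<psi> = wick_form (v # u # us) \<phi> \<psi>"
  using wick_form_cong[OF annihilate_commute[OF assms(1,2,3)] fock_eq_refl, of us \<psi>]
    wick_form_cong[OF fock_eq_refl annihilate_commute[OF assms(1,2,4)], of us \<phi>]
  by simp

lemma wick_form_move:
  assumes "mode_bounded u" "\<forall>v\<in>set us. mode_bounded v" "\<phi> \<in> fock_domain" "\<psi> \<in> fock_domain"
  shows "wick_form (us @ u # vs) \<phi> \<psi> = wick_form (u # us @ vs) \<phi> \<psi>"
  using assms(2-4)
proof (induction us arbitrary: \<phi> \<psi>)
  case (Cons v us)
  have "wick_form ((v # us) @ u # vs) \<phi> \<psi> = wick_form (v # u # us @ vs) \<phi> \<psi>"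
    using Cons.IH[of "annihilate v \<phi>" \<psi>] Cons.IH[of \<phi> "annihilate v \<psi>"] Cons.prems annihilate_in_fock_domain[of v]
    by simp
  also have "\<dots> = wick_form (u # v # us @ vs) \<phi> \<psi>"
    using Cons.prems assms(1) by (intro wick_form_swap) auto
  finally show ?case by simp
qed simp

text \<open>This makes the arbitrary listing of a monomial in \<open>wick_value\<close>
  harmless.\<close>

lemma wick_form_mset:
  assumes "mset us = mset vs" "\<forall>u\<in>set us. mode_bounded u" "\<phi> \<in> fock_domain" "\<psi> \<in> fock_domain"
  shows "wick_form us \<phi> \<psi> = wick_form vs \<phi> \<psi>"
  using assms
proof (induction us arbitrary: vs \<phi> \<psi>)
  case (Cons u us)
  have "u \<in> set vs" by (metis Cons.prems(1) list.set_intros(1) mset_eq_setD)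
  then obtain v1 v2 where vs: "vs = v1 @ u # v2" by (metis split_list)
  have m: "mset us = mset (v1 @ v2)" using Cons.prems(1) by (simp add: vs)
  have "\<forall>v\<in>set v1. mode_bounded v"
    using Cons.prems(1,2) mset_eq_setD[OF Cons.prems(1)] by (auto simp: vs)
  then have "wick_form vs \<phi> \<psi> = wick_form (u # v1 @ v2) \<phi> \<psi>"
    unfolding vs using Cons.prems by (intro wick_form_move) auto
  then show ?case
    using Cons.IH[OF m, of "annihilate u \<phi>" \<psi>] Cons.IH[OF m, of \<phi> "annihilate u \<psi>"] Cons.prems annihilate_in_fock_domain[of u]
    by simp
qed simp

lemma annihilate_add_mode:
  assumes "mode_bounded u" "mode_bounded v" "\<psi> \<in> fock_domain"
  shows "fock_eq (annihilate (\<lambda>k. u k + v k) \<psi>) (fock_add (annihilate u \<psi>) (annihilate v \<psi>))"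
  unfolding fock_eq_def annihilate_def fock_add_def
  using annihilate_integrable[OF assms(1,3)] annihilate_integrable[OF assms(2,3)] by (simp add: algebra_simps)

lemma annihilate_scale_mode: "annihilate (\<lambda>k. c * u k) \<psi> = fock_scale c (annihilate u \<psi>)"
proof -
  have "(LINT k|shell_measure. c * u k * \<psi> (Suc n) (case_nat k K)) = c * (LINT k|shell_measure. u k * \<psi> (Suc n) (case_nat k K))" for n K
    by (simp add: mult.assoc)
  then show ?thesis by (simp add: annihilate_def fock_scale_def fun_eq_iff mult_ac)
qed

lemma wick_form_Cons_add:
  assumes "\<forall>u\<in>set us. mode_bounded u" "mode_bounded u" "mode_bounded v" "\<phi> \<in> fock_domain" "\<psi> \<in> fock_domain"
  shows "wick_form ((\<lambda>k. u k + v k) # us) \<phi> \<psi> = wick_form (u # us) \<phi> \<psi> + wick_form (v # us) \<phi> \<psi>"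
  using wick_form_cong[OF annihilate_add_mode[OF assms(2,3,4)] fock_eq_refl, of us \<psi>]
    wick_form_cong[OF fock_eq_refl annihilate_add_mode[OF assms(2,3,5)], of us \<phi>]
    wick_form_add(1)[OF assms(1) annihilate_in_fock_domain[OF assms(2,4)] annihilate_in_fock_domain[OF assms(3,4)] assms(5)]
    wick_form_add(2)[OF assms(1) annihilate_in_fock_domain[OF assms(2,5)] annihilate_in_fock_domain[OF assms(3,5)] assms(4)]
  by simp

text \<open>The creation part acts through the left vector, from which a scalar comes out
  conjugated. For a real factor both parts scale alike.\<close>

lemma wick_form_Cons_scale:
  assumes "\<forall>u\<in>set us. mode_bounded u" "mode_bounded u" "\<phi> \<in> fock_domain" "\<psi> \<in> fock_domain"
  shows "wick_form ((\<lambda>k. of_real c * u k) # us) \<phi> \<psi> = of_real c * wick_form (u # us) \<phi> \<psi>"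
  using wick_form_scale[OF assms(1) annihilate_in_fock_domain[OF assms(2,3)] assms(4)]
    wick_form_scale[OF assms(1) assms(3) annihilate_in_fock_domain[OF assms(2,4)]]
  by (simp add: annihilate_scale_mode distrib_left)

lemma wick_form_Cons_sum:
  assumes "\<forall>u\<in>set us. mode_bounded u" "\<And>i. i \<in> I \<Longrightarrow> mode_bounded (u i)" "\<phi> \<in> fock_domain" "\<psi> \<in> fock_domain"
    and "finite I"
  shows "wick_form ((\<lambda>k. \<Sum>i\<in>I. of_real (c i) * u i k) # us) \<phi> \<psi> = (\<Sum>i\<in>I. of_real (c i) * wick_form (u i # us) \<phi> \<psi>)"
  using assms(5,2)
proof (induction I rule: finite_induct)
  case empty
  show ?case using wick_form_Cons_scale[OF assms(1) mode_bounded_const[of 0] assms(3,4), of 0] by simp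
next
  case (insert i I)
  have 1: "mode_bounded (\<lambda>k. of_real (c j) * u j k)" if "j \<in> insert i I" for j
    using insert.prems that by (intro mode_bounded_mult mode_bounded_const)
  have 2: "mode_bounded (\<lambda>k. \<Sum>i\<in>I. of_real (c i) * u i k)"
    using insert.prems by (intro mode_bounded_sum mode_bounded_mult mode_bounded_const) auto
  have "wick_form ((\<lambda>k. of_real (c i) * u i k + (\<Sum>i\<in>I. of_real (c i) * u i k)) # us) \<phi> \<psi> =
     of_real (c i) * wick_form (u i # us) \<phi> \<psi> + (\<Sum>i\<in>I. of_real (c i) * wick_form (u i # us) \<phi> \<psi>)"
    by (simp only: wick_form_Cons_add[OF assms(1) 1[OF insertI1] 2 assms(3,4)] wick_form_Cons_scale[OF assms(1) insert.prems[OF insertI1] assms(3,4)]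
        insert.IH[OF insert.prems[OF insertI2]])
  then show ?case using insert.hyps by simp
qed

subsection \<open>Translations\<close>

abbreviation phase :: "mode \<Rightarrow> real^4 \<Rightarrow> real" where
  "phase k y \<equiv> mdot (on_shell (fst k)) y"

lemma mdot_add: "mdot p (x + y) = mdot p x + mdot p y"
  by (simp add: mdot_def algebra_simps sum.distrib)

lemma mdot_scaleR: "mdot p (c *\<^sub>R x) = c * mdot p x"
  by (simp add: mdot_def sum_distrib_left mult_ac)

lemma abs_mdot_le: "\<bar>mdot p x\<bar> \<le> 16 * norm p * norm x"
proof -
  have "\<bar>mdot p x\<bar> \<le> (\<Sum>\<mu>\<in>(UNIV::4 set). \<Sum>\<nu>\<in>(UNIV::4 set). \<bar>eta $ \<mu> $ \<nu> * p $ \<mu> * x $ \<nu>\<bar>)"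
    unfolding mdot_def by (rule order_trans[OF sum_abs sum_mono]) (rule sum_abs)
  also have "\<dots> \<le> (\<Sum>\<mu>\<in>(UNIV::4 set). \<Sum>\<nu>\<in>(UNIV::4 set). norm p * norm x)"
  proof (intro sum_mono)
    fix \<mu> \<nu> :: 4
    have "\<bar>eta $ \<mu> $ \<nu> :: real\<bar> \<le> 1" by (simp add: eta_def)
    then have "\<bar>eta $ \<mu> $ \<nu> * (p $ \<mu> * x $ \<nu>)\<bar> \<le> 1 * (norm p * norm x)"
      unfolding abs_mult by (intro mult_mono component_le_norm_cart) auto
    then show "\<bar>eta $ \<mu> $ \<nu> * p $ \<mu> * x $ \<nu>\<bar> \<le> norm p * norm x" by (simp add: mult.assoc)
  qed
  finally show ?thesis by simp
qed

lemma continuous_on_shell: "continuous_on UNIV on_shell"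
proof -
  have "continuous_on UNIV (\<lambda>v. spatial v $ \<mu>)" for \<mu>
    unfolding spatial_def by (cases "\<mu> = 0 \<or> \<mu> = 1 \<or> \<mu> = 2") (auto intro!: continuous_intros)
  then have "continuous_on UNIV spatial"
    by (subst continuous_on_componentwise) (auto simp: Basis_vec_def inner_axis)
  then show ?thesis
    unfolding on_shell_def by (intro continuous_intros)
qed

lemma norm_on_shell_le: "norm (on_shell p) \<le> 4 * norm p"
proof -
  have "norm (spatial p) \<le> (\<Sum>\<^sub>U \<mu>. \<bar>spatial p $ \<mu>\<bar>)" by (rule norm_le_l1_cart)
  also have "\<dots> \<le> 3 * norm p"
    unfolding sum_4 spatial_def using component_le_norm_cart[of p 1] component_le_norm_cart[of p 2] component_le_norm_cart[of p 3]
    by simp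
  finally have "norm (spatial p) \<le> 3 * norm p" .
  then show ?thesis
    unfolding on_shell_def by (intro order_trans[OF norm_triangle_ineq]) (simp add: norm_axis_1)
qed

lemma abs_phase_le:
  assumes "k \<in> shell r R"
  shows "\<bar>phase k v\<bar> \<le> 64 * R * norm v"
proof -
  have "\<bar>phase k v\<bar> \<le> 16 * (4 * norm (fst k)) * norm v"
    by (intro order_trans[OF abs_mdot_le] mult_right_mono mult_left_mono norm_on_shell_le) auto
  also have "\<dots> \<le> 64 * R * norm v"
    using assms by (auto simp: shell_def intro!: mult_right_mono)
  finally show ?thesis .
qed

lemma measurable_phase [measurable]: "(\<lambda>k. phase k v) \<in> borel_measurable shell_measure"
proof -
  have "(\<lambda>p. mdot (on_shell p) v) \<in> borel_measurable borel"
    unfolding mdot_def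
    by (intro borel_measurable_continuous_onI continuous_intros continuous_on_shell)
  from measurable_compose[OF fst_measurable_shell this] show ?thesis .
qed

lemma mode_bounded_phase: "mode_bounded (\<lambda>k. of_real (phase k v))"
  unfolding mode_bounded_def
proof (intro conjI allI impI)
  show "(\<lambda>k. complex_of_real (phase k v)) \<in> borel_measurable shell_measure"
    by (rule measurable_compose[OF measurable_phase borel_measurable_continuous_onI]) (intro continuous_intros)
  show "\<exists>B. \<forall>k\<in>shell r R. norm (of_real (phase k v) :: complex) \<le> B" for r R
    using abs_phase_le by (intro exI[of _ "64 * R * norm v"]) auto
qed

lemma mode_bounded_cis_phase: "mode_bounded (\<lambda>k. cis (- phase k y))"
  unfolding mode_bounded_def
proof (intro conjI allI impI)
  have "cis \<in> borel_measurable borel" by (intro borel_measurable_continuous_onI continuous_intros)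
  then show "(\<lambda>k. cis (- phase k y)) \<in> borel_measurable shell_measure" by measurable
qed (auto intro!: exI[of _ 1])

definition total_phase :: "nat \<Rightarrow> (nat \<Rightarrow> mode) \<Rightarrow> real^4 \<Rightarrow> real" where
  "total_phase n K y = (\<Sum>i<n. phase (K i) y)"

definition translate :: "real^4 \<Rightarrow> fock \<Rightarrow> fock" where
  "translate y \<psi> = (\<lambda>n K. cis (- total_phase n K y) * \<psi> n K)"

text \<open>The derivative of \<open>translate\<close> at the origin in direction v: - \<i> times
  the energy-momentum operator contracted with v.\<close>

definition generator :: "real^4 \<Rightarrow> fock \<Rightarrow> fock" where
  "generator v \<psi> = (\<lambda>n K. - \<i> * of_real (total_phase n K v) * \<psi> n K)"

lemma total_phase_case_nat: "total_phase (Suc n) (case_nat k K) y = phase k y + total_phase n K y"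
  unfolding total_phase_def by (subst sum.lessThan_Suc_shift) simp

lemma total_phase_permutes: "\<pi> permutes {..<n} \<Longrightarrow> total_phase n (K \<circ> \<pi>) y = total_phase n K y"
  unfolding total_phase_def comp_def by (rule sum.permute[symmetric, unfolded comp_def])

lemma total_phase_measurable: "(\<lambda>K. total_phase n K y) \<in> borel_measurable (config n)"
  unfolding total_phase_def config_def
proof (rule borel_measurable_sum)
  fix i assume "i \<in> {..<n}"
  then have "(\<lambda>K. K i) \<in> measurable (PiM {..<n} (\<lambda>_. shell_measure)) shell_measure"
    by (rule measurable_component_singleton)
  from measurable_compose[OF this measurable_phase]
  show "(\<lambda>K. phase (K i) y) \<in> borel_measurable (PiM {..<n} (\<lambda>_. shell_measure))" .
qed

lemma total_phase_add: "total_phase n K (x + y) = total_phase n K x + total_phase n K y"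
  by (simp add: total_phase_def mdot_add sum.distrib)

lemma total_phase_scaleR: "total_phase n K (c *\<^sub>R x) = c * total_phase n K x"
  by (simp add: total_phase_def mdot_scaleR sum_distrib_left)

lemma abs_total_phase_le:
  assumes "n < N" "\<And>i. i < n \<Longrightarrow> K i \<in> shell r R"
  shows "\<bar>total_phase n K v\<bar> \<le> real N * (64 * \<bar>R\<bar>) * norm v"
proof -
  have "\<bar>total_phase n K v\<bar> \<le> (\<Sum>i<n. \<bar>phase (K i) v\<bar>)" unfolding total_phase_def by (rule sum_abs)
  also have "\<dots> \<le> (\<Sum>i<n. 64 * \<bar>R\<bar> * norm v)"
  proof (rule sum_mono)
    fix i assume "i \<in> {..<n}"
    then have "\<bar>phase (K i) v\<bar> \<le> 64 * R * norm v" using assms(2) by (intro abs_phase_le) auto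
    also have "\<dots> \<le> 64 * \<bar>R\<bar> * norm v" by (intro mult_right_mono) auto
    finally show "\<bar>phase (K i) v\<bar> \<le> 64 * \<bar>R\<bar> * norm v" .
  qed
  also have "\<dots> = real n * (64 * \<bar>R\<bar> * norm v)" by simp
  also have "\<dots> \<le> real N * (64 * \<bar>R\<bar> * norm v)" using assms(1) by (intro mult_right_mono) auto
  finally show ?thesis by (simp add: mult_ac)
qed

lemma measurable_cis [measurable]: "cis \<in> borel_measurable borel"
  by (intro borel_measurable_continuous_onI continuous_intros)

lemma fock_bounded_translate:
  assumes "fock_bounded r R N B \<psi>"
  shows "fock_bounded r R N B (translate y \<psi>)"
proof -
  have [measurable]: "(\<lambda>K. total_phase n K y) \<in> borel_measurable (config n)" for n by (rule total_phase_measurable)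
  have "fock_bounded r R N (1 * B) (\<lambda>n K. cis (- total_phase n K y) * \<psi> n K)"
    by (rule fock_bounded_multiplier[OF assms]) (auto simp: total_phase_permutes)
  then show ?thesis by (simp add: translate_def)
qed

lemma fock_bounded_generator:
  assumes "fock_bounded r R N B \<psi>"
  shows "fock_bounded r R N (real N * (64 * \<bar>R\<bar>) * norm v * B) (generator v \<psi>)"
proof -
  have [measurable]: "(\<lambda>K. total_phase n K v) \<in> borel_measurable (config n)" for n by (rule total_phase_measurable)
  show ?thesis unfolding generator_def
    by (rule fock_bounded_multiplier[OF assms])
       (auto simp: total_phase_permutes norm_mult intro!: abs_total_phase_le)
qed

lemma translate_in_fock_domain: "\<psi> \<in> fock_domain \<Longrightarrow> translate y \<psi> \<in> fock_domain"
  by (meson fock_bounded_translate fock_domain_iff)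

lemma generator_in_fock_domain: "\<psi> \<in> fock_domain \<Longrightarrow> generator v \<psi> \<in> fock_domain"
  by (meson fock_bounded_generator fock_domain_iff)

text \<open>The total phase is additive over the particles, so the absorbed particle takes its own
  phase into the mode function.\<close>

lemma annihilate_translate:
  "annihilate u (translate y \<psi>) = translate y (annihilate (\<lambda>k. u k * cis (- phase k y)) \<psi>)"
proof (intro ext)
  fix n K
  have cis: "cis (- (a + b)) = cis (- b) * cis (- a)" for a b
    unfolding cis_mult minus_add_distrib by (rule arg_cong[where f = cis], rule add.commute)
  have "(LINT k|shell_measure. u k * (cis (- total_phase (Suc n) (case_nat k K) y) * \<psi> (Suc n) (case_nat k K))) =
    (LINT k|shell_measure. cis (- total_phase n K y) * (u k * cis (- phase k y) * \<psi> (Suc n) (case_nat k K)))"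
    by (intro Bochner_Integration.integral_cong refl)
       (simp only: total_phase_case_nat cis mult_ac)
  also have "\<dots> = cis (- total_phase n K y) * (LINT k|shell_measure. u k * cis (- phase k y) * \<psi> (Suc n) (case_nat k K))"
    by (rule integral_mult_right_zero)
  finally show "annihilate u (translate y \<psi>) n K = translate y (annihilate (\<lambda>k. u k * cis (- phase k y)) \<psi>) n K"
    by (simp add: annihilate_def translate_def)
qed

lemma fock_inner_translate: "fock_inner (translate y \<phi>) (translate y \<psi>) = fock_inner \<phi> \<psi>"
proof -
  have "cnj (cis (- t) * a) * (cis (- t) * b) = cnj a * b" for t a b
    by (simp add: cis_cnj cis_mult mult_ac)
  then show ?thesis by (simp only: fock_inner_def translate_def)
qed

text \<open>Each step of the recursion passes one phase from mode to vector; at the end the phases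
  of both vectors cancel in the inner product.\<close>

lemma wick_form_translate:
  "wick_form (map (\<lambda>u k. u k * cis (- phase k y)) us) \<phi> \<psi> = wick_form us (translate y \<phi>) (translate y \<psi>)"
  by (induction us arbitrary: \<phi> \<psi>) (simp_all add: fock_inner_translate annihilate_translate)

text \<open>Infinitesimal form of \<open>annihilate_translate\<close>: the commutator with the
  generator differentiates the plane wave of the mode.\<close>

lemma annihilate_generator:
  assumes u: "mode_bounded u" and \<psi>: "\<psi> \<in> fock_domain"
  shows "fock_eq (annihilate u (generator v \<psi>))
    (fock_add (generator v (annihilate u \<psi>)) (annihilate (\<lambda>k. - \<i> * of_real (phase k v) * u k) \<psi>))"
  unfolding fock_eq_def
proof (intro allI ballI)
  fix n K assume K: "K \<in> space (config n)"
  have u': "mode_bounded (\<lambda>k. - \<i> * of_real (phase k v) * u k)"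
    by (intro mode_bounded_mult mode_bounded_const mode_bounded_phase u)
  let ?c = "- \<i> * of_real (total_phase n K v)"
  have "(LINT k|shell_measure. u k * (- \<i> * of_real (total_phase (Suc n) (case_nat k K) v) * \<psi> (Suc n) (case_nat k K))) =
    (LINT k|shell_measure. ?c * (u k * \<psi> (Suc n) (case_nat k K)) + - \<i> * of_real (phase k v) * u k * \<psi> (Suc n) (case_nat k K))"
    by (intro Bochner_Integration.integral_cong refl) (simp add: total_phase_case_nat algebra_simps)
  also have "\<dots> = ?c * (LINT k|shell_measure. u k * \<psi> (Suc n) (case_nat k K))
      + (LINT k|shell_measure. - \<i> * of_real (phase k v) * u k * \<psi> (Suc n) (case_nat k K))"
    using annihilate_integrable[OF u \<psi> K] annihilate_integrable[OF u' \<psi> K]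
    by (subst Bochner_Integration.integral_add) auto
  finally have F: "(LINT k|shell_measure. u k * (- \<i> * of_real (total_phase (Suc n) (case_nat k K) v) * \<psi> (Suc n) (case_nat k K))) =
    ?c * (LINT k|shell_measure. u k * \<psi> (Suc n) (case_nat k K))
      + (LINT k|shell_measure. - \<i> * of_real (phase k v) * u k * \<psi> (Suc n) (case_nat k K))" .
  show "annihilate u (generator v \<psi>) n K =
    fock_add (generator v (annihilate u \<psi>)) (annihilate (\<lambda>k. - \<i> * of_real (phase k v) * u k) \<psi>) n K"
    unfolding annihilate_def generator_def fock_add_def F by (simp only: distrib_left mult.left_commute)
qed

text \<open>The generator is antihermitian, being - \<i> times a real multiplier.\<close>

lemma fock_inner_generator:
  assumes "\<phi> \<in> fock_domain" "\<psi> \<in> fock_domain"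
  shows "fock_inner (generator v \<phi>) \<psi> + fock_inner \<phi> (generator v \<psi>) = 0"
proof -
  obtain r R N B where *: "0 < r" "fock_bounded r R N B \<phi>" "fock_bounded r R N B \<psi>"
    using fock_domain_common[OF assms] .
  have "(LINT K|config n. cnj (generator v \<phi> n K) * \<psi> n K) = - (LINT K|config n. cnj (\<phi> n K) * generator v \<psi> n K)" for n
    unfolding Bochner_Integration.integral_minus[symmetric]
    by (intro Bochner_Integration.integral_cong refl) (simp add: generator_def)
  then show ?thesis
    unfolding fock_inner_finite[OF fock_bounded_generator[OF *(2)] *(3,1)] fock_inner_finite[OF *(2) fock_bounded_generator[OF *(3)] *(1)]
    by (simp add: sum_negf)
qed

text \<open>Leibniz rule for Wick products. Every annihilation passes the generator at the cost of
  one differentiated mode, and what remains after the last one vanishes by antihermiticity.\<close>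

lemma wick_form_generator:
  assumes "\<forall>u\<in>set us. mode_bounded u" "\<phi> \<in> fock_domain" "\<psi> \<in> fock_domain"
  shows "wick_form us (generator v \<phi>) \<psi> + wick_form us \<phi> (generator v \<psi>) =
    (\<Sum>i<length us. wick_form (us[i := (\<lambda>k. - \<i> * of_real (phase k v) * (us ! i) k)]) \<phi> \<psi>)"
  using assms
proof (induction us arbitrary: \<phi> \<psi>)
  case Nil then show ?case by (simp add: fock_inner_generator)
next
  case (Cons u us)
  let ?u' = "\<lambda>k. - \<i> * of_real (phase k v) * u k"
  from Cons.prems have u: "mode_bounded u" and us: "\<forall>u\<in>set us. mode_bounded u" and \<phi>: "\<phi> \<in> fock_domain" and \<psi>: "\<psi> \<in> fock_domain"
    by auto
  have u': "mode_bounded ?u'" by (intro mode_bounded_mult mode_bounded_const mode_bounded_phase u)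
  note ann = annihilate_in_fock_domain
  note gen = generator_in_fock_domain
  have 1: "wick_form us (annihilate u (generator v \<phi>)) \<psi> = wick_form us (generator v (annihilate u \<phi>)) \<psi> + wick_form us (annihilate ?u' \<phi>) \<psi>"
    unfolding wick_form_cong[OF annihilate_generator[OF u \<phi>] fock_eq_refl]
    by (intro wick_form_add us gen ann u u' \<phi> \<psi>)
  have 2: "wick_form us \<phi> (annihilate u (generator v \<psi>)) = wick_form us \<phi> (generator v (annihilate u \<psi>)) + wick_form us \<phi> (annihilate ?u' \<psi>)"
    unfolding wick_form_cong[OF fock_eq_refl annihilate_generator[OF u \<psi>]]
    by (intro wick_form_add us gen ann u u' \<phi> \<psi>)
  have "wick_form (u # us) (generator v \<phi>) \<psi> + wick_form (u # us) \<phi> (generator v \<psi>) =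
     wick_form (?u' # us) \<phi> \<psi>
     + (wick_form us (generator v (annihilate u \<phi>)) \<psi> + wick_form us (annihilate u \<phi>) (generator v \<psi>))
     + (wick_form us (generator v \<phi>) (annihilate u \<psi>) + wick_form us \<phi> (generator v (annihilate u \<psi>)))"
    unfolding wick_form.simps 1 2 by (simp only: add_ac)
  also have "\<dots> = wick_form (?u' # us) \<phi> \<psi> +
     (\<Sum>i<length us. wick_form (u # us[i := (\<lambda>k. - \<i> * of_real (phase k v) * (us ! i) k)]) \<phi> \<psi>)"
    unfolding Cons.IH[OF us ann[OF u \<phi>] \<psi>] Cons.IH[OF us \<phi> ann[OF u \<psi>]]
    by (simp only: wick_form.simps sum.distrib add.assoc)
  also have "\<dots> = (\<Sum>i<length (u # us). wick_form ((u # us)[i := (\<lambda>k. - \<i> * of_real (phase k v) * ((u # us) ! i) k)]) \<phi> \<psi>)"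
    by (simp only: length_Cons sum.lessThan_Suc_shift) simp
  finally show ?case .
qed

lemma fock_inner_bound:
  assumes "0 < r"
  shows "\<exists>C\<ge>0. \<forall>\<phi> \<psi> B B'. fock_bounded r R N B \<phi> \<longrightarrow> fock_bounded r R N B' \<psi> \<longrightarrow> norm (fock_inner \<phi> \<psi>) \<le> C * B * B'"
proof (intro exI conjI allI impI)
  let ?C = "\<Sum>n<N. measure (config n) (box r R n)"
  show "0 \<le> ?C" by (intro sum_nonneg) auto
  fix \<phi> \<psi> B B' assume *: "fock_bounded r R N B \<phi>" "fock_bounded r R N B' \<psi>"
  have "norm (fock_inner \<phi> \<psi>) \<le> (\<Sum>n<N. B * B' * measure (config n) (box r R n))"
    unfolding fock_inner_finite[OF * assms]
    by (intro order_trans[OF norm_sum] sum_mono fock_inner_integrable_bounded(2)[OF * assms])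
  then show "norm (fock_inner \<phi> \<psi>) \<le> ?C * B * B'"
    by (simp add: sum_distrib_left mult_ac)
qed

text \<open>The constant is independent of the vectors and of their sup bounds. A remainder vector
  that is small of second order therefore contributes an error of second order.\<close>

lemma wick_form_bound:
  assumes "0 < r" "\<forall>u\<in>set us. mode_bounded u"
  shows "\<exists>C\<ge>0. \<forall>\<phi> \<psi> B B'. fock_bounded r R N B \<phi> \<longrightarrow> fock_bounded r R N B' \<psi> \<longrightarrow> norm (wick_form us \<phi> \<psi>) \<le> C * B * B'"
  using assms(2)
proof (induction us)
  case Nil
  show ?case using fock_inner_bound[OF assms(1)] by simp
next
  case (Cons u us)
  then obtain C where C: "0 \<le> C" "\<And>\<phi> \<psi> B B'. fock_bounded r R N B \<phi> \<Longrightarrow> fock_bounded r R N B' \<psi> \<Longrightarrow> norm (wick_form us \<phi> \<psi>) \<le> C * B * B'"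
    by (metis list.set_intros(2))
  have u: "mode_bounded u" using Cons.prems by simp
  obtain b where b: "0 \<le> b" "\<And>k. k \<in> shell r R \<Longrightarrow> norm (u k) \<le> b" using mode_boundedE[OF u assms(1)] by metis
  define D where "D = sqrt (real N) * (b * measure shell_measure (shell r R))"
  have D: "fock_bounded r R N (D * B) (annihilate u \<psi>)" if "fock_bounded r R N B \<psi>" for B \<psi>
    unfolding D_def by (rule annihilate_bounded[OF mode_bounded_measurable[OF u] b that assms(1)])
  show ?case
  proof (intro exI[of _ "2 * C * D"] conjI allI impI)
    show "0 \<le> 2 * C * D" using C(1) b(1) by (simp add: D_def)
    fix \<phi> \<psi> B B' assume *: "fock_bounded r R N B \<phi>" "fock_bounded r R N B' \<psi>"
    have "norm (wick_form (u # us) \<phi> \<psi>) \<le> C * (D * B) * B' + C * B * (D * B')"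
      unfolding wick_form.simps by (intro norm_triangle_le add_mono C(2) D *)
    then show "norm (wick_form (u # us) \<phi> \<psi>) \<le> 2 * C * D * B * B'" by (simp add: mult_ac)
  qed
qed

lemma norm_cis_remainder: "norm (cis (- t) - 1 + \<i> * of_real t) \<le> t\<^sup>2"
  using Taylor_exp[of "\<i> * of_real (- t)" 1]
  by (simp add: cis_conv_exp norm_mult power2_eq_square algebra_simps)

lemma norm_cis_diff: "norm (cis (- t) - 1) \<le> \<bar>t\<bar>"
  using Taylor_exp[of "\<i> * of_real (- t)" 0] by (simp add: cis_conv_exp norm_mult)

text \<open>With the translation moved to the two vectors this is a product rule for a bounded
  sesquilinear form. The derivative appears as two generator terms, which
  \<open>wick_form_generator\<close> turns into one differentiated mode per summand.\<close>

lemma wick_form_has_derivative: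
  assumes us: "\<forall>u\<in>set us. mode_bounded u" and \<phi>: "\<phi> \<in> fock_domain" and \<psi>: "\<psi> \<in> fock_domain"
  shows "((\<lambda>y. wick_form (map (\<lambda>u k. u k * cis (- phase k y)) us) \<phi> \<psi>) has_derivative
    (\<lambda>v. \<Sum>i<length us. wick_form ((map (\<lambda>u k. u k * cis (- phase k x)) us)
        [i := (\<lambda>k. - \<i> * of_real (phase k v) * ((us ! i) k * cis (- phase k x)))]) \<phi> \<psi>)) (at x)"
proof -
  obtain r R N B where r: "0 < r" and \<phi>b: "fock_bounded r R N B \<phi>" and \<psi>b: "fock_bounded r R N B \<psi>"
    using fock_domain_common[OF \<phi> \<psi>] .
  have B: "0 \<le> B" using fock_boundedD(6)[OF \<phi>b] .
  obtain C where C: "0 \<le> C" "\<And>\<phi> \<psi> B B'. fock_bounded r R N B \<phi> \<Longrightarrow> fock_bounded r R N B' \<psi> \<Longrightarrow> norm (wick_form us \<phi> \<psi>) \<le> C * B * B'"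
    using wick_form_bound[OF r us, of R N] by metis
  define \<Phi> \<Psi> where "\<Phi> = translate x \<phi>" and "\<Psi> = translate x \<psi>"
  have \<Phi>b: "fock_bounded r R N B \<Phi>" and \<Psi>b: "fock_bounded r R N B \<Psi>"
    unfolding \<Phi>_def \<Psi>_def by (intro fock_bounded_translate \<phi>b \<psi>b)+
  have \<Phi>: "\<Phi> \<in> fock_domain" and \<Psi>: "\<Psi> \<in> fock_domain"
    unfolding \<Phi>_def \<Psi>_def by (intro translate_in_fock_domain \<phi> \<psi>)+
  define f' where "f' = (\<lambda>v. wick_form us (generator v \<Phi>) \<Psi> + wick_form us \<Phi> (generator v \<Psi>))"
  define D where "D = real N * (64 * \<bar>R\<bar>)"
  have D: "0 \<le> D" by (simp add: D_def)

  have f'_sum: "f' v = (\<Sum>i<length us. wick_form ((map (\<lambda>u k. u k * cis (- phase k x)) us)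
        [i := (\<lambda>k. - \<i> * of_real (phase k v) * ((us ! i) k * cis (- phase k x)))]) \<phi> \<psi>)" for v
  proof -
    have "wick_form (us[i := (\<lambda>k. - \<i> * of_real (phase k v) * (us ! i) k)]) \<Phi> \<Psi> =
      wick_form ((map (\<lambda>u k. u k * cis (- phase k x)) us)
        [i := (\<lambda>k. - \<i> * of_real (phase k v) * ((us ! i) k * cis (- phase k x)))]) \<phi> \<psi>" for i
      unfolding \<Phi>_def \<Psi>_def wick_form_translate[symmetric] map_update by (simp only: mult.assoc)
    then show ?thesis unfolding f'_def wick_form_generator[OF us \<Phi> \<Psi>] by simp
  qed

  have "linear f'"
  proof (rule linearI)
    fix v w
    have "generator (v + w) \<xi> = fock_add (generator v \<xi>) (generator w \<xi>)" for \<xi>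
      by (simp add: generator_def fock_add_def total_phase_add algebra_simps)
    then show "f' (v + w) = f' v + f' w"
      by (simp add: f'_def wick_form_add us \<Phi> \<Psi> generator_in_fock_domain)
  next
    fix c v
    have "generator (c *\<^sub>R v) \<xi> = fock_scale (of_real c) (generator v \<xi>)" for \<xi>
      by (simp add: generator_def fock_scale_def total_phase_scaleR mult_ac)
    then show "f' (c *\<^sub>R v) = c *\<^sub>R f' v"
      by (simp add: f'_def wick_form_scale us \<Phi> \<Psi> generator_in_fock_domain scaleR_conv_of_real distrib_left)
  qed
  then have lin: "bounded_linear f'" by (simp add: linear_conv_bounded_linear)

  \<comment> \<open>Taylor remainders of the phase factor: \<open>rem\<close> is of second order in
    v, \<open>dif\<close> of first order. Both are symmetric multipliers with explicit bounds on the
    shells.\<close>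
  define rem where "rem = (\<lambda>v \<xi> n K. (cis (- total_phase n K v) - 1 + \<i> * of_real (total_phase n K v)) * \<xi> n K)"
  define dif where "dif = (\<lambda>v \<xi> n K. (cis (- total_phase n K v) - 1) * \<xi> n K)"
  have [measurable]: "(\<lambda>K. total_phase n K v) \<in> borel_measurable (config n)" for n v by (rule total_phase_measurable)
  have rem: "fock_bounded r R N ((D * norm v)\<^sup>2 * B) (rem v \<xi>)" if "fock_bounded r R N B \<xi>" for v \<xi>
    unfolding rem_def
  proof (rule fock_bounded_multiplier[OF that])
    fix n K assume "n < N" "\<And>i. i < n \<Longrightarrow> K i \<in> shell r R"
    then have "\<bar>total_phase n K v\<bar> \<le> \<bar>D * norm v\<bar>"
      using abs_total_phase_le[of n N K r R v] D by (simp add: D_def abs_mult)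
    then have "(total_phase n K v)\<^sup>2 \<le> (D * norm v)\<^sup>2" by (simp add: abs_le_square_iff)
    then show "norm (cis (- total_phase n K v) - 1 + \<i> * of_real (total_phase n K v)) \<le> (D * norm v)\<^sup>2"
      using norm_cis_remainder order_trans by blast
  qed (auto simp: total_phase_permutes)
  have dif: "fock_bounded r R N (D * norm v * B) (dif v \<xi>)" if "fock_bounded r R N B \<xi>" for v \<xi>
    unfolding dif_def
  proof (rule fock_bounded_multiplier[OF that])
    fix n K assume "n < N" "\<And>i. i < n \<Longrightarrow> K i \<in> shell r R"
    then show "norm (cis (- total_phase n K v) - 1) \<le> D * norm v"
      using abs_total_phase_le[of n N K r R v] order_trans[OF norm_cis_diff] by (auto simp: D_def)
  qed (use D in \<open>auto simp: total_phase_permutes\<close>)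
  have gen: "fock_bounded r R N (D * norm v * B) (generator v \<xi>)" if "fock_bounded r R N B \<xi>" for v \<xi>
    using fock_bounded_generator[OF that] by (simp add: D_def)
  have dom: "\<xi> \<in> fock_domain" if "fock_bounded r R N b \<xi>" for b \<xi>
    using that r by (auto simp: fock_domain_iff)
  have tr: "translate (x + v) \<xi> = fock_add (translate x \<xi>) (fock_add (generator v (translate x \<xi>)) (rem v (translate x \<xi>)))"
    and tr': "translate (x + v) \<xi> = fock_add (translate x \<xi>) (dif v (translate x \<xi>))" for v \<xi>
    by (simp_all add: translate_def fock_add_def generator_def rem_def dif_def total_phase_add fun_eq_iff algebra_simps)
       (simp_all add: cis_mult)
  \<comment> \<open>Each error term is quadratic in v: two contain \<open>rem\<close>, and the third
    pairs the first-order vectors \<open>generator\<close> and \<open>dif\<close>.\<close>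
  have decomp: "wick_form us (translate (x + v) \<phi>) (translate (x + v) \<psi>) - wick_form us \<Phi> \<Psi> - f' v =
     wick_form us (rem v \<Phi>) (translate (x + v) \<psi>) + wick_form us (generator v \<Phi>) (dif v \<Psi>) + wick_form us \<Phi> (rem v \<Psi>)" for v
  proof -
    note doms = dom[OF rem[OF \<Phi>b]] dom[OF rem[OF \<Psi>b]] dom[OF dif[OF \<Psi>b]] dom[OF gen[OF \<Phi>b]] dom[OF gen[OF \<Psi>b]] \<Phi> \<Psi>
      translate_in_fock_domain[OF \<psi>] fock_add_in_fock_domain
    have "wick_form us (translate (x + v) \<phi>) (translate (x + v) \<psi>) = wick_form us \<Phi> (translate (x + v) \<psi>)
       + (wick_form us (generator v \<Phi>) (translate (x + v) \<psi>) + wick_form us (rem v \<Phi>) (translate (x + v) \<psi>))"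
      unfolding tr[of v \<phi>] \<Phi>_def[symmetric] by (simp add: wick_form_add us doms)
    moreover have "wick_form us (generator v \<Phi>) (translate (x + v) \<psi>) = wick_form us (generator v \<Phi>) \<Psi> + wick_form us (generator v \<Phi>) (dif v \<Psi>)"
      unfolding tr'[of v \<psi>] \<Psi>_def[symmetric] by (simp add: wick_form_add us doms)
    moreover have "wick_form us \<Phi> (translate (x + v) \<psi>) = wick_form us \<Phi> \<Psi> + (wick_form us \<Phi> (generator v \<Psi>) + wick_form us \<Phi> (rem v \<Psi>))"
      unfolding tr[of v \<psi>] \<Psi>_def[symmetric] by (simp add: wick_form_add us doms)
    ultimately show ?thesis by (simp add: f'_def)
  qed
  define E where "E = 3 * (C * D\<^sup>2 * B\<^sup>2)"
  have bound: "norm (wick_form us (translate (x + v) \<phi>) (translate (x + v) \<psi>) - wick_form us \<Phi> \<Psi> - f' v) \<le> E * norm v * norm v" for v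
  proof -
    have "norm (wick_form us (rem v \<Phi>) (translate (x + v) \<psi>) + wick_form us (generator v \<Phi>) (dif v \<Psi>) + wick_form us \<Phi> (rem v \<Psi>))
      \<le> C * ((D * norm v)\<^sup>2 * B) * B + C * (D * norm v * B) * (D * norm v * B) + C * B * ((D * norm v)\<^sup>2 * B)"
      by (intro norm_triangle_le add_mono C(2) rem gen dif \<Phi>b \<Psi>b fock_bounded_translate[OF \<psi>b])
    then show ?thesis unfolding decomp by (simp add: E_def power2_eq_square algebra_simps)
  qed
  have "((\<lambda>y. wick_form us (translate y \<phi>) (translate y \<psi>)) has_derivative f') (at x)"
  proof (rule has_derivativeI_sandwich[where e = 1 and H = "\<lambda>y. E * norm (y - x)"])
    show "((\<lambda>y. E * norm (y - x)) \<longlongrightarrow> 0) (at x)"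
      by (auto intro!: tendsto_eq_intros)
    fix y assume "y \<noteq> x"
    then show "norm (wick_form us (translate y \<phi>) (translate y \<psi>) - wick_form us (translate x \<phi>) (translate x \<psi>) - f' (y - x)) / norm (y - x) \<le> E * norm (y - x)"
      using bound[of "y - x"] by (simp add: \<Phi>_def \<Psi>_def divide_le_eq)
  qed (use lin in auto)
  then show ?thesis
    unfolding wick_form_translate f'_sum[abs_def] .
qed

subsection \<open>The string-localized modes\<close>

text \<open>Two mean value theorems, one for f(x + t) - f(x) and one for f'.\<close>

lemma norm_second_difference_le:
  fixes f :: "real \<Rightarrow> real"
  assumes f': "\<And>x. (f has_real_derivative f' x) (at x)" and f'': "\<And>x. (f' has_real_derivative f'' x) (at x)"
    and M: "\<And>x. \<bar>f'' x\<bar> \<le> M" and t: "0 < t"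
  shows "\<bar>f (2 * t) - 2 * f t + f 0\<bar> \<le> M * t\<^sup>2"
proof -
  define g where "g = (\<lambda>x. f (x + t) - f x)"
  have g: "(g has_real_derivative (f' (x + t) - f' x)) (at x)" for x
    unfolding g_def by (intro DERIV_diff DERIV_shift[THEN iffD1] f')
  obtain u where u: "g t - g 0 = (t - 0) * (f' (u + t) - f' u)"
    using MVT2[OF t, of g "\<lambda>x. f' (x + t) - f' x"] g by blast
  obtain w where w: "f' (u + t) - f' u = (u + t - u) * f'' w"
  proof -
    have "u < u + t" using t by simp
    from MVT2[OF this f''] that show ?thesis by blast
  qed
  have "f (2 * t) - 2 * f t + f 0 = g t - g 0" unfolding g_def mult_2 by simp
  also have "\<dots> = t\<^sup>2 * f'' w" unfolding u w by (simp add: power2_eq_square)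
  finally have "\<bar>f (2 * t) - 2 * f t + f 0\<bar> = t\<^sup>2 * \<bar>f'' w\<bar>" by (simp add: abs_mult)
  also have "\<dots> \<le> t\<^sup>2 * M" by (intro mult_left_mono M) auto
  finally show ?thesis by (simp add: mult.commute)
qed

lemma integrable_inverse_one_plus_square: "integrable lborel (\<lambda>s. indicator {0..} s * inverse (1 + s\<^sup>2) :: real)"
proof (rule integrableI_nonneg)
  have "(\<integral>\<^sup>+ s. ennreal (inverse (1 + s\<^sup>2)) * indicator {0..} s \<partial>lborel) = ennreal (pi / 2 - arctan 0)"
  proof (rule nn_integral_FTC_atLeast)
    show "(arctan \<longlongrightarrow> pi / 2) at_top" by (rule tendsto_arctan_at_top)
  qed (auto intro!: derivative_eq_intros)
  moreover have "(\<integral>\<^sup>+ s. ennreal (indicator {0..} s * inverse (1 + s\<^sup>2)) \<partial>lborel) = (\<integral>\<^sup>+ s. ennreal (inverse (1 + s\<^sup>2)) * indicator {0..} s \<partial>lborel)"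
    by (intro nn_integral_cong) (auto simp: indicator_def)
  ultimately show "(\<integral>\<^sup>+ s. ennreal (indicator {0..} s * inverse (1 + s\<^sup>2)) \<partial>lborel) < \<infinity>" by simp
qed auto

lemma integrable_indicator_cball: "integrable lborel (indicator (cball (a :: 'a::euclidean_space) r) :: 'a \<Rightarrow> real)"
  using emeasure_bounded_finite[OF bounded_cball, of a r] by (simp add: integrable_indicator_iff)

lemma lborel_integral_translate:
  fixes g :: "'a::euclidean_space \<Rightarrow> 'b::{banach,second_countable_topology}"
  assumes "g \<in> borel_measurable borel"
  shows "(LINT e|lborel. g (c + e)) = (LINT e|lborel. g e)"
proof -
  have "(LINT e|lborel. g e) = (LINT e|distr lborel borel ((+) c). g e)"
    by (simp add: lborel_distr_plus)
  also have "\<dots> = (LINT e|lborel. g (c + e))"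
    using assms by (subst integral_distr) auto
  finally show ?thesis by simp
qed

text \<open>Shifting the integration variable by half a period in the time direction changes the sign of
  the exponential; doing this twice turns \<open>f\<close> into a second difference.\<close>

lemma norm_fourier_le:
  fixes f :: "real^4 \<Rightarrow> real"
  assumes meas: "f \<in> borel_measurable borel"
    and M0: "\<And>e. \<bar>f e\<bar> \<le> M0" and supp: "\<And>e. \<rho> < norm e \<Longrightarrow> f e = 0"
    and M2: "\<And>e t. 0 < t \<Longrightarrow> \<bar>f (e + (2 * t) *\<^sub>R axis 0 1) - 2 * f (e + t *\<^sub>R axis 0 1) + f e\<bar> \<le> M2 * t\<^sup>2"
    and t: "0 < t" "t \<le> T" and P: "mdot P (t *\<^sub>R axis 0 1) = pi"
  shows "norm (LINT e|lborel. of_real (f e) * cis (- mdot P e)) \<le> M2 * t\<^sup>2 * measure lborel (cball (0 :: real^4) (\<rho> + 2 * T))"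
proof -
  let ?a = "axis 0 1 :: real^4"
  let ?D = "\<lambda>e. f (e + (2 * t) *\<^sub>R ?a) - 2 * f (e + t *\<^sub>R ?a) + f e"
  have [measurable]: "(\<lambda>e. mdot P e) \<in> borel_measurable borel"
    unfolding mdot_def by (intro borel_measurable_continuous_onI continuous_intros)
  note [measurable] = meas
  have int: "integrable lborel (\<lambda>e. of_real (f (e + u *\<^sub>R ?a)) * cis (- mdot P e))" for u
  proof (rule integrableI_bounded_set[where A = "cball 0 (\<rho> + \<bar>u\<bar>)" and B = M0])
    show "AE e in lborel. e \<in> cball 0 (\<rho> + \<bar>u\<bar>) \<longrightarrow> norm (of_real (f (e + u *\<^sub>R ?a)) * cis (- mdot P e)) \<le> M0"
      using M0 by (auto simp: norm_mult)
    show "AE e in lborel. e \<notin> cball 0 (\<rho> + \<bar>u\<bar>) \<longrightarrow> of_real (f (e + u *\<^sub>R ?a)) * cis (- mdot P e) = 0"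
    proof (intro AE_I2 impI)
      fix e :: "real^4" assume "e \<notin> cball 0 (\<rho> + \<bar>u\<bar>)"
      then have "\<rho> < norm (e + u *\<^sub>R ?a)"
        using norm_diff_ineq[of e "u *\<^sub>R ?a"] by (simp add: norm_axis_1)
      then show "of_real (f (e + u *\<^sub>R ?a)) * cis (- mdot P e) = 0" by (simp add: supp)
    qed
    show "emeasure lborel (cball (0 :: real^4) (\<rho> + \<bar>u\<bar>)) < \<infinity>" by (rule emeasure_bounded_finite) auto
  qed auto
  define I where "I = (\<lambda>u. LINT e|lborel. of_real (f (e + u *\<^sub>R ?a)) * cis (- mdot P e))"
  have shift: "I u = - I (u + t)" for u
  proof -
    have "I u = (LINT e|lborel. of_real (f (t *\<^sub>R ?a + e + u *\<^sub>R ?a)) * cis (- mdot P (t *\<^sub>R ?a + e)))"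
      unfolding I_def by (rule lborel_integral_translate[symmetric]) measurable
    also have "\<dots> = (LINT e|lborel. - (of_real (f (e + (u + t) *\<^sub>R ?a)) * cis (- mdot P e)))"
    proof (intro Bochner_Integration.integral_cong refl)
      fix e
      have "cis (- mdot P (t *\<^sub>R ?a + e)) = - cis (- mdot P e)"
        unfolding mdot_add P by (simp add: complex_eq_iff cos_add sin_add cos_diff sin_diff)
      then show "of_real (f (t *\<^sub>R ?a + e + u *\<^sub>R ?a)) * cis (- mdot P (t *\<^sub>R ?a + e)) = - (of_real (f (e + (u + t) *\<^sub>R ?a)) * cis (- mdot P e))"
        by (simp add: algebra_simps)
    qed
    finally show ?thesis by (simp add: I_def)
  qed
  have "(LINT e|lborel. of_real (?D e) * cis (- mdot P e)) =
    (LINT e|lborel. of_real (f (e + (2 * t) *\<^sub>R ?a)) * cis (- mdot P e)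
      - 2 * (of_real (f (e + t *\<^sub>R ?a)) * cis (- mdot P e)) + of_real (f (e + 0 *\<^sub>R ?a)) * cis (- mdot P e))"
    by (intro Bochner_Integration.integral_cong refl) (simp add: left_diff_distrib distrib_right)
  also have "\<dots> = I (2 * t) - 2 * I t + I 0"
    unfolding I_def
    by (simp only: Bochner_Integration.integral_add[OF Bochner_Integration.integrable_diff[OF int integrable_mult_right[OF int]] int]
        Bochner_Integration.integral_diff[OF int integrable_mult_right[OF int]] integral_mult_right_zero)
  finally have "I (2 * t) - 2 * I t + I 0 = (LINT e|lborel. of_real (?D e) * cis (- mdot P e))" ..
  moreover have "I t = - I (2 * t)" "I 0 = - I t"
    using shift[of t, folded mult_2] shift[of 0] by simp_all
  \<comment> \<open>With alternating signs I 0 = - I t = I (2 * t), so the three terms of the second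
    difference add up to 4 I 0.\<close>
  ultimately have 4: "4 * I 0 = (LINT e|lborel. of_real (?D e) * cis (- mdot P e))" by simp
  have le: "norm (of_real (?D e) * cis (- mdot P e)) \<le> M2 * t\<^sup>2 * indicator (cball 0 (\<rho> + 2 * T)) e" for e
  proof (cases "norm e \<le> \<rho> + 2 * T")
    case True
    then show ?thesis using M2[OF t(1), of e] by (simp add: norm_mult del: of_real_add of_real_diff of_real_mult)
  next
    case False
    have far: "\<rho> < norm (e + u *\<^sub>R ?a)" if "0 \<le> u" "u \<le> 2 * T" for u
      using norm_diff_ineq[of e "u *\<^sub>R ?a"] False that by (simp add: norm_axis_1)
    have "?D e = 0" using supp[OF far[of "2 * t"]] supp[OF far[of t]] supp[OF far[of 0]] t by simp
    with False show ?thesis by simp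
  qed
  have "norm (4 * I 0) \<le> (LINT e|lborel. M2 * t\<^sup>2 * indicator (cball (0 :: real^4) (\<rho> + 2 * T)) e)"
    unfolding 4 by (rule norm_integral_le[OF _ le]) (intro integrable_mult_right integrable_indicator_cball)
  also have "\<dots> = M2 * t\<^sup>2 * measure lborel (cball (0 :: real^4) (\<rho> + 2 * T))" by simp
  finally have "4 * norm (I 0) \<le> M2 * t\<^sup>2 * measure lborel (cball (0 :: real^4) (\<rho> + 2 * T))" by (simp add: norm_mult)
  then have "norm (I 0) \<le> M2 * t\<^sup>2 * measure lborel (cball (0 :: real^4) (\<rho> + 2 * T))"
    using norm_ge_zero[of "I 0"] by linarith
  then show ?thesis by (simp add: I_def)
qed

lemma smooth_partials_differentiable: "smooth f \<Longrightarrow> partials \<alpha>s f differentiable (at x)"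
  by (simp add: smooth_def)

lemma partials_zero_outside:
  fixes c :: "real^4 \<Rightarrow> real"
  assumes "closed S" "\<And>e. e \<notin> S \<Longrightarrow> c e = 0" "e \<notin> S"
  shows "partials \<alpha>s c e = 0"
  using assms(3)
proof (induction \<alpha>s arbitrary: e)
  case (Cons \<alpha> \<alpha>s)
  have "(partials \<alpha>s c has_derivative (\<lambda>_. 0)) (at e)"
    by (rule has_derivative_transform_within_open[OF has_derivative_const[of 0] open_Compl[OF assms(1)]])
       (use Cons in auto)
  then show ?case
    by (simp add: partials_def partial_def frechet_derivative_at[symmetric])
qed (use assms in \<open>simp add: partials_def\<close>)

lemma has_real_derivative_along_axis:
  fixes f :: "real^4 \<Rightarrow> real"
  assumes "f differentiable (at (e + \<tau> *\<^sub>R axis \<alpha> 1))"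
  shows "((\<lambda>\<tau>. f (e + \<tau> *\<^sub>R axis \<alpha> 1)) has_real_derivative partial \<alpha> f (e + \<tau> *\<^sub>R axis \<alpha> 1)) (at \<tau>)"
proof -
  let ?x = "e + \<tau> *\<^sub>R axis \<alpha> 1 :: real^4" and ?f' = "frechet_derivative f (at (e + \<tau> *\<^sub>R axis \<alpha> 1))"
  have f': "(f has_derivative ?f') (at ?x)" using assms by (simp add: frechet_derivative_works)
  have "((\<lambda>\<tau>. e + \<tau> *\<^sub>R axis \<alpha> 1) has_derivative (\<lambda>h. h *\<^sub>R axis \<alpha> 1)) (at \<tau>)"
    by (auto intro!: derivative_eq_intros)
  from has_derivative_compose[OF this f']
  have "((\<lambda>\<tau>. f (e + \<tau> *\<^sub>R axis \<alpha> 1)) has_derivative (\<lambda>h. ?f' (h *\<^sub>R axis \<alpha> 1))) (at \<tau>)" .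
  moreover have "?f' (h *\<^sub>R axis \<alpha> 1) = partial \<alpha> f ?x * h" for h
    using linear_cmul[OF has_derivative_linear[OF f']] by (simp add: partial_def)
  ultimately show ?thesis by (simp add: has_field_derivative_def mult.commute[of _ "partial \<alpha> f ?x"])
qed

text \<open>The input of \<open>norm_fourier_le\<close> for the function c(e) e^\<kappa>.
  \<open>M2\<close> bounds its second time derivative, a continuous function with compact support;
  \<open>\<delta>\<close> is the time derivative of the component e^\<kappa>.\<close>

lemma string_smearing_moment:
  assumes "string_smearing c"
  obtains \<rho> M0 M2 where "(\<lambda>e. c e * e $ \<kappa>) \<in> borel_measurable borel" "0 \<le> M0" "0 \<le> M2"
    "\<And>e. \<bar>c e * e $ \<kappa>\<bar> \<le> M0" "\<And>e. \<rho> < norm e \<Longrightarrow> c e * e $ \<kappa> = 0"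
    "\<And>e t. 0 < t \<Longrightarrow> \<bar>c (e + (2 * t) *\<^sub>R axis 0 1) * (e + (2 * t) *\<^sub>R axis 0 1) $ \<kappa>
        - 2 * (c (e + t *\<^sub>R axis 0 1) * (e + t *\<^sub>R axis 0 1) $ \<kappa>) + c e * e $ \<kappa>\<bar> \<le> M2 * t\<^sup>2"
proof -
  from assms obtain S where sm: "smooth c" and S: "compact S" "\<And>e. e \<notin> S \<Longrightarrow> c e = 0"
    unfolding string_smearing_def by blast
  define \<delta> :: real where "\<delta> = (if \<kappa> = 0 then 1 else 0)"
  let ?a = "axis 0 1 :: real^4"
  let ?c1 = "partials [0] c" and ?c2 = "partials [0,0] c"
  have cont: "continuous_on UNIV (partials \<alpha>s c)" for \<alpha>s
    using smooth_partials_differentiable[OF sm]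
    by (auto simp: continuous_on_eq_continuous_at intro: differentiable_imp_continuous_within)
  have cc: "continuous_on UNIV c" using cont[of "[]"] by (simp add: partials_def)
  have bdd: "\<exists>M\<ge>0. \<forall>e. \<bar>f e\<bar> \<le> M" if "continuous_on UNIV f" "\<And>e. e \<notin> S \<Longrightarrow> f e = 0" for f :: "real^4 \<Rightarrow> real"
  proof -
    have "bounded (f ` S)"
      by (rule compact_imp_bounded, rule compact_continuous_image[OF continuous_on_subset[OF that(1)] S(1)]) simp
    then obtain M where "\<forall>e\<in>S. norm (f e) \<le> M" by (auto simp: bounded_iff)
    then have "\<bar>f e\<bar> \<le> max 0 M" for e using that(2)[of e] by (cases "e \<in> S") auto
    then show ?thesis by (intro exI[of _ "max 0 M"]) auto
  qed
  have z: "partials \<alpha>s c e = 0" if "e \<notin> S" for \<alpha>s e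
    by (rule partials_zero_outside[OF compact_imp_closed[OF S(1)] S(2) that])
  have ck: "continuous_on UNIV (\<lambda>e. c e * e $ \<kappa>)" by (intro continuous_intros cc)
  obtain M0 where M0: "0 \<le> M0" "\<forall>e. \<bar>c e * e $ \<kappa>\<bar> \<le> M0"
    using bdd[OF ck] S(2) by auto
  have cM: "continuous_on UNIV (\<lambda>e. ?c2 e * e $ \<kappa> + 2 * ?c1 e * \<delta>)" by (intro continuous_intros cont)
  obtain M2 where M2: "0 \<le> M2" "\<forall>e. \<bar>?c2 e * e $ \<kappa> + 2 * ?c1 e * \<delta>\<bar> \<le> M2"
    using bdd[OF cM] z by auto
  obtain \<rho> where \<rho>: "\<forall>e\<in>S. norm e \<le> \<rho>" using compact_imp_bounded[OF S(1)] by (auto simp: bounded_iff)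
  show ?thesis
  proof (rule that[of M0 M2 \<rho>])
    show "(\<lambda>e. c e * e $ \<kappa>) \<in> borel_measurable borel"
      by (intro borel_measurable_continuous_onI continuous_intros cc)
    show "c e * e $ \<kappa> = 0" if "\<rho> < norm e" for e
      using that \<rho> S(2)[of e] by force
    fix e t assume t: "0 < (t::real)"
    let ?x = "\<lambda>\<tau>. e + \<tau> *\<^sub>R ?a"
    have d0: "((\<lambda>\<tau>. c (?x \<tau>)) has_real_derivative ?c1 (?x \<tau>)) (at \<tau>)" for \<tau>
      using has_real_derivative_along_axis[of c e \<tau> 0] smooth_partials_differentiable[OF sm, of "[]"] by (simp add: partials_def)
    have d1: "((\<lambda>\<tau>. ?c1 (?x \<tau>)) has_real_derivative ?c2 (?x \<tau>)) (at \<tau>)" for \<tau>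
      using has_real_derivative_along_axis[of ?c1 e \<tau> 0] smooth_partials_differentiable[OF sm, of "[0]"] by (simp add: partials_def)
    have de: "((\<lambda>\<tau>. ?x \<tau> $ \<kappa>) has_real_derivative \<delta>) (at \<tau>)" for \<tau>
      by (auto simp: \<delta>_def axis_def intro!: derivative_eq_intros)
    have "\<bar>c (?x (2 * t)) * ?x (2 * t) $ \<kappa> - 2 * (c (?x t) * ?x t $ \<kappa>) + c (?x 0) * ?x 0 $ \<kappa>\<bar> \<le> M2 * t\<^sup>2"
    proof (rule norm_second_difference_le[OF _ _ _ t])
      show "((\<lambda>\<tau>. c (?x \<tau>) * ?x \<tau> $ \<kappa>) has_real_derivative (?c1 (?x \<tau>) * ?x \<tau> $ \<kappa> + c (?x \<tau>) * \<delta>)) (at \<tau>)" for \<tau>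
        using DERIV_mult[OF d0 de, of \<tau>] by (simp add: add.commute mult.commute)
      show "((\<lambda>\<tau>. ?c1 (?x \<tau>) * ?x \<tau> $ \<kappa> + c (?x \<tau>) * \<delta>) has_real_derivative (?c2 (?x \<tau>) * ?x \<tau> $ \<kappa> + 2 * ?c1 (?x \<tau>) * \<delta>)) (at \<tau>)" for \<tau>
        using DERIV_add[OF DERIV_mult[OF d1[of \<tau>] de[of \<tau>]] DERIV_cmult_right[OF d0[of \<tau>], of \<delta>]] by (simp add: algebra_simps)
      show "\<bar>?c2 (?x \<tau>) * ?x \<tau> $ \<kappa> + 2 * ?c1 (?x \<tau>) * \<delta>\<bar> \<le> M2" for \<tau>
        using M2(2) by blast
    qed
    then show "\<bar>c (e + (2 * t) *\<^sub>R ?a) * (e + (2 * t) *\<^sub>R ?a) $ \<kappa> - 2 * (c (e + t *\<^sub>R ?a) * (e + t *\<^sub>R ?a) $ \<kappa>) + c e * e $ \<kappa>\<bar> \<le> M2 * t\<^sup>2"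
      by simp
  qed (use M0 M2 in auto)
qed

text \<open>The factor by which \<open>string_int\<close> multiplies the plane wave of momentum P;
  formally the average of e^\<kappa> / (i P e) with weight c.\<close>

definition string_vector :: "(real^4 \<Rightarrow> real) \<Rightarrow> 4 \<Rightarrow> real^4 \<Rightarrow> complex" where
  "string_vector c \<kappa> P = (LINT s:{0..}|lborel. (LINT e|lborel. of_real (c e * e $ \<kappa>) * cis (- mdot P (s *\<^sub>R e))))"

text \<open>\<open>sum_4\<close> enumerates the index type as 1, 2, 3, 4, so the time index 0 shows
  up as 4.\<close>

lemma four_eq_zero: "(4 :: 4) = 0"
  by simp

lemma eta_contract:
  fixes f g :: "4 \<Rightarrow> 'a::comm_ring_1"
  shows "(\<Sum>\<^sub>U \<mu> \<nu>. eta $ \<mu> $ \<nu> * f \<mu> * g \<nu>) = f 0 * g 0 - f 1 * g 1 - f 2 * g 2 - f 3 * g 3"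
proof -
  have "(\<Sum>\<^sub>U \<nu>. eta $ \<mu> $ \<nu> * f \<mu> * g \<nu>) = (\<Sum>\<^sub>U \<nu>. if \<nu> = \<mu> then (if \<mu> = 0 then 1 else - 1) * f \<mu> * g \<mu> else 0)" for \<mu>
    by (rule sum.cong) (auto simp: eta_def)
  then have *: "(\<Sum>\<^sub>U \<nu>. eta $ \<mu> $ \<nu> * f \<mu> * g \<nu>) = (if \<mu> = 0 then 1 else - 1) * f \<mu> * g \<mu>" for \<mu>
    by simp
  show ?thesis unfolding * sum_4 four_eq_zero by simp
qed

lemma mdot_axis_0: "mdot (on_shell p) (axis 0 1) = norm p"
  unfolding mdot_def eta_contract by (simp add: axis_def on_shell_def spatial_def)

text \<open>The inner integral is bounded for s < 1 and of order 1 / s^2 for s \<ge> 1, hence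
  dominated by a multiple of 1 / (1 + s^2). The constants depend on the momentum only through
  r.\<close>

lemma norm_string_vector_le:
  assumes "string_smearing c" and r: "0 < r"
  shows "\<exists>B. \<forall>p. r \<le> norm p \<longrightarrow> norm (string_vector c \<kappa> (on_shell p)) \<le> B"
proof -
  obtain \<rho> M0 M2 where meas: "(\<lambda>e. c e * e $ \<kappa>) \<in> borel_measurable borel" and nn: "0 \<le> M0" "0 \<le> M2"
    and M0: "\<And>e. \<bar>c e * e $ \<kappa>\<bar> \<le> M0" and supp: "\<And>e. \<rho> < norm e \<Longrightarrow> c e * e $ \<kappa> = 0"
    and M2: "\<And>e t. 0 < t \<Longrightarrow> \<bar>c (e + (2 * t) *\<^sub>R axis 0 1) * (e + (2 * t) *\<^sub>R axis 0 1) $ \<kappa>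
        - 2 * (c (e + t *\<^sub>R axis 0 1) * (e + t *\<^sub>R axis 0 1) $ \<kappa>) + c e * e $ \<kappa>\<bar> \<le> M2 * t\<^sup>2"
    by (rule string_smearing_moment[OF assms(1), of \<kappa>]) (rule that; assumption)
  define A where "A = measure lborel (cball (0 :: real^4) \<rho>)"
  define A' where "A' = measure lborel (cball (0 :: real^4) (\<rho> + 2 * (pi / r)))"
  \<comment> \<open>The factor 2 serves both ranges of s: 1 \<le> 2 / (1 + s^2) for s < 1, and 1 /
    s^2 \<le> 2 / (1 + s^2) for s \<ge> 1.\<close>
  define K where "K = 2 * (M0 * A + M2 * (pi / r)\<^sup>2 * A')"
  have K: "0 \<le> M0 * A" "0 \<le> M2 * (pi / r)\<^sup>2 * A'" using nn by (auto simp: A_def A'_def)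
  show ?thesis
  proof (intro exI allI impI)
    fix p :: "real^3" assume p: "r \<le> norm p"
    let ?I = "\<lambda>s. LINT e|lborel. of_real (c e * e $ \<kappa>) * cis (- mdot (on_shell p) (s *\<^sub>R e))"
    have I: "norm (?I s) \<le> K * inverse (1 + s\<^sup>2)" if s: "0 \<le> s" for s
    proof (cases "s < 1")
      case True
      have "norm (?I s) \<le> (LINT e|lborel. M0 * indicator (cball (0 :: real^4) \<rho>) e)"
      proof (rule norm_integral_le)
        show "norm (of_real (c e * e $ \<kappa>) * cis (- mdot (on_shell p) (s *\<^sub>R e))) \<le> M0 * indicator (cball 0 \<rho>) e" for e
          using M0[of e] supp[of e] by (auto simp: norm_mult indicator_def abs_mult)
      qed (intro integrable_mult_right integrable_indicator_cball)
      also have "\<dots> = M0 * A" by (simp add: A_def)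
      also have "\<dots> \<le> K / 2" using K by (simp add: K_def)
      also have "\<dots> \<le> K * inverse (1 + s\<^sup>2)"
      proof -
        have "s\<^sup>2 \<le> 1" using True s by (simp add: power_le_one)
        then have "1 / 2 \<le> inverse (1 + s\<^sup>2)" by (simp add: field_simps add_pos_nonneg)
        then have "K * (1 / 2) \<le> K * inverse (1 + s\<^sup>2)" using K by (intro mult_left_mono) (auto simp: K_def)
        then show ?thesis by simp
      qed
      finally show ?thesis .
    next
      case False
      \<comment> \<open>Half a period: an on-shell momentum has time component |p|, so the time
        shift t changes the phase of momentum s p by pi.\<close>
      define t where "t = pi / (s * norm p)"
      have p0: "0 < norm p" using p r by linarith
      have t: "0 < t" using False p0 by (auto simp: t_def)
      have tT: "t \<le> (pi / r) / s"
        using False p r p0 by (auto simp: t_def field_simps)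
      also have "\<dots> \<le> pi / r" using False r by (simp add: divide_le_eq mult_le_cancel_left1)
      finally have tT': "t \<le> pi / r" .
      have "mdot (s *\<^sub>R on_shell p) e = mdot (on_shell p) (s *\<^sub>R e)" for e
        by (simp add: mdot_def sum_distrib_left mult_ac)
      moreover have "norm (LINT e|lborel. of_real (c e * e $ \<kappa>) * cis (- mdot (s *\<^sub>R on_shell p) e)) \<le> M2 * t\<^sup>2 * A'"
        unfolding A'_def
      proof (rule norm_fourier_le[OF meas M0 supp M2 t tT'])
        show "mdot (s *\<^sub>R on_shell p) (t *\<^sub>R axis 0 1) = pi"
          unfolding \<open>mdot (s *\<^sub>R on_shell p) _ = _\<close>
          using False p0 by (simp add: mdot_scaleR mdot_axis_0 t_def)
      qed
      ultimately have "norm (?I s) \<le> M2 * t\<^sup>2 * A'" by simp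
      also have "\<dots> \<le> M2 * ((pi / r) / s)\<^sup>2 * A'"
        using t tT nn by (intro mult_right_mono mult_left_mono power_mono) (auto simp: A'_def)
      also have "\<dots> = (M2 * (pi / r)\<^sup>2 * A') * inverse (s\<^sup>2)"
        by (simp add: power_divide field_simps)
      also have "\<dots> \<le> (K / 2) * (2 * inverse (1 + s\<^sup>2))"
      proof (rule mult_mono)
        have "1 \<le> s\<^sup>2" using False by (simp add: one_le_power)
        moreover have "inverse x \<le> 2 * inverse (1 + x)" if "1 \<le> x" for x :: real
          using that by (simp add: field_simps)
        ultimately show "inverse (s\<^sup>2) \<le> 2 * inverse (1 + s\<^sup>2)" by blast
      qed (use K in \<open>auto simp: K_def\<close>)
      finally show ?thesis by simp
    qed
    have "norm (string_vector c \<kappa> (on_shell p)) \<le> (LINT s|lborel. K * (indicator {0..} s * inverse (1 + s\<^sup>2)))"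
      unfolding string_vector_def set_lebesgue_integral_def
    proof (rule norm_integral_le)
      show "integrable lborel (\<lambda>s. K * (indicator {0..} s * inverse (1 + s\<^sup>2)))"
        by (intro integrable_mult_right integrable_inverse_one_plus_square)
      show "norm (indicator {0..} s *\<^sub>R ?I s) \<le> K * (indicator {0..} s * inverse (1 + s\<^sup>2))" for s
        using I[of s] by (auto simp: indicator_def)
    qed
    then show "norm (string_vector c \<kappa> (on_shell p)) \<le> (LINT s|lborel. K * (indicator {0..} s * inverse (1 + s\<^sup>2)))" .
  qed
qed

text \<open>Plane waves are eigenfunctions, so the second string integration in
  \<open>h_mode_lower\<close> only contributes another factor.\<close>

lemma string_int_plane_wave:
  "string_int c \<kappa> (\<lambda>x. A * cis (- mdot P x)) x = A * string_vector c \<kappa> P * cis (- mdot P x)"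
proof -
  have cis: "cis (- (a + b)) = cis (- a) * cis (- b)" for a b
    by (simp add: cis_mult)
  have "(LINT e|lborel. of_real (c e * e $ \<kappa>) * (A * cis (- mdot P (x + s *\<^sub>R e)))) =
    (LINT e|lborel. (A * cis (- mdot P x)) * (of_real (c e * e $ \<kappa>) * cis (- mdot P (s *\<^sub>R e))))" for s
    by (intro Bochner_Integration.integral_cong refl) (simp only: mdot_add cis mult_ac)
  then have "(LINT e|lborel. of_real (c e * e $ \<kappa>) * (A * cis (- mdot P (x + s *\<^sub>R e)))) =
    (A * cis (- mdot P x)) * (LINT e|lborel. of_real (c e * e $ \<kappa>) * cis (- mdot P (s *\<^sub>R e)))" for s
    by (simp only: integral_mult_right_zero)
  then have "string_int c \<kappa> (\<lambda>x. A * cis (- mdot P x)) x =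
    (LINT s|lborel. (A * cis (- mdot P x)) * (indicator {0..} s *\<^sub>R (LINT e|lborel. of_real (c e * e $ \<kappa>) * cis (- mdot P (s *\<^sub>R e)))))"
    by (simp only: string_int_def set_lebesgue_integral_def mult_scaleR_right)
  also have "\<dots> = (A * cis (- mdot P x)) * string_vector c \<kappa> P"
    by (simp only: integral_mult_right_zero string_vector_def set_lebesgue_integral_def)
  finally show ?thesis by (simp only: mult_ac)
qed

section \<open>Plane-wave amplitudes of the graviton field and its derivatives\<close>

abbreviation eta_sign :: "4 \<Rightarrow> 'a::ring_1" where
  "eta_sign \<mu> \<equiv> if \<mu> = 0 then 1 else - 1"

lemma eta_contract_one: "(\<Sum>\<^sub>U \<nu>. eta $ \<mu> $ \<nu> * f \<nu>) = eta_sign \<mu> * (f \<mu> :: 'a::comm_ring_1)"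
proof -
  have "(\<Sum>\<^sub>U \<nu>. eta $ \<mu> $ \<nu> * f \<nu>) = (\<Sum>\<^sub>U \<nu>. if \<nu> = \<mu> then eta_sign \<mu> * f \<mu> else 0)"
    by (rule sum.cong) (auto simp: eta_def)
  then show ?thesis by simp
qed

lemma eta_mult_vec: "(eta *v x) $ \<mu> = eta_sign \<mu> * (x $ \<mu> :: 'a::comm_ring_1)"
  by (simp only: matrix_vector_mult_def vec_lambda_beta eta_contract_one)

lemma mdot_axis: "mdot P (axis \<mu> 1) = eta_sign \<mu> * P $ \<mu>"
proof -
  have "mdot P (axis \<mu> 1) = (\<Sum>\<^sub>U \<nu>. P $ \<nu> * (\<Sum>\<^sub>U \<sigma>. eta $ \<nu> $ \<sigma> * axis \<mu> 1 $ \<sigma>))"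
    by (simp add: mdot_def sum_distrib_left mult_ac)
  also have "\<dots> = (\<Sum>\<^sub>U \<nu>. if \<nu> = \<mu> then eta_sign \<mu> * P $ \<mu> else 0)"
    unfolding eta_contract_one by (rule sum.cong) (auto simp: axis_def)
  finally show ?thesis by simp
qed

text \<open>With V the string vector this is p^\<mu> (e V) - e^\<mu> (p V), the bivector of momentum
  p and polarization e contracted with V. All components are upper ones; \<open>eta_sign\<close>
  supplies the metric in the two contractions.\<close>

definition h_vector :: "(real^4 \<Rightarrow> real) \<Rightarrow> (real^3 \<Rightarrow> real^3) \<Rightarrow> 4 \<Rightarrow> mode \<Rightarrow> complex" where
  "h_vector c a \<mu> k =
     of_real (on_shell (fst k) $ \<mu>) * (\<Sum>\<^sub>U \<kappa>. eta_sign \<kappa> * polarization a k $ \<kappa> * string_vector c \<kappa> (on_shell (fst k)))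
     - polarization a k $ \<mu> * (\<Sum>\<^sub>U \<kappa>. eta_sign \<kappa> * of_real (on_shell (fst k) $ \<kappa>) * string_vector c \<kappa> (on_shell (fst k)))"

text \<open>The field strength of a plane wave is minus the tensor square of the bivector of p and
  e. The two string integrations contract one factor each, so the sum over \<kappa> and \<rho>
  factorizes.\<close>

lemma h_mode_plane_wave:
  "h_mode c a \<mu> \<nu> k = (\<lambda>x. - (h_vector c a \<mu> k * h_vector c a \<nu> k) * cis (- phase k x))"
proof
  fix x
  let ?P = "on_shell (fst k)"
  let ?p = "\<lambda>\<mu>. of_real ((eta *v ?P) $ \<mu>) :: complex" and ?e = "\<lambda>\<mu>. (eta *v polarization a k) $ \<mu>"
  let ?V = "\<lambda>\<kappa>. string_vector c \<kappa> ?P"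
  let ?w = "\<lambda>\<mu>. \<Sum>\<^sub>U \<kappa>. (?p \<mu> * ?e \<kappa> - ?p \<kappa> * ?e \<mu>) * ?V \<kappa>"
  have w: "?w \<mu> = eta_sign \<mu> * h_vector c a \<mu> k" for \<mu>
  proof -
    have "complex_of_real (eta_sign \<kappa>) = eta_sign \<kappa>" for \<kappa> by simp
    then show ?thesis
      by (simp add: h_vector_def eta_mult_vec algebra_simps sum_subtractf sum_distrib_left sum_negf)
  qed
  have F: "F_mode a \<mu> \<kappa> \<nu> \<rho> k = (\<lambda>x. - ((?p \<mu> * ?e \<kappa> - ?p \<kappa> * ?e \<mu>) * (?p \<nu> * ?e \<rho> - ?p \<rho> * ?e \<nu>)) * cis (- mdot ?P x))" for \<mu> \<kappa> \<nu> \<rho>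
    unfolding F_mode_def Let_def by (intro ext) (simp only: mult_minus_left mult.assoc)
  have "h_mode_lower c a \<mu> \<nu> k x = - (?w \<mu> * ?w \<nu>) * cis (- mdot ?P x)" for \<mu> \<nu>
  proof -
    have "h_mode_lower c a \<mu> \<nu> k x = (\<Sum>\<^sub>U \<kappa> \<rho>. - ((?p \<mu> * ?e \<kappa> - ?p \<kappa> * ?e \<mu>) * (?p \<nu> * ?e \<rho> - ?p \<rho> * ?e \<nu>)) * ?V \<rho> * ?V \<kappa> * cis (- mdot ?P x))"
      unfolding h_mode_lower_def F string_int_plane_wave ..
    also have "\<dots> = (\<Sum>\<^sub>U \<kappa> \<rho>. - cis (- mdot ?P x) *
       (((?p \<mu> * ?e \<kappa> - ?p \<kappa> * ?e \<mu>) * ?V \<kappa>) * ((?p \<nu> * ?e \<rho> - ?p \<rho> * ?e \<nu>) * ?V \<rho>)))"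
      by (intro sum.cong refl) (simp only: mult_minus_left mult_minus_right mult_ac)
    finally show ?thesis by (simp only: sum_product sum_distrib_left[symmetric]) (simp only: mult_minus_left mult_minus_right mult_ac)
  qed
  then have "h_mode c a \<mu> \<nu> k x = (\<Sum>\<^sub>U \<mu>'. eta $ \<mu> $ \<mu>' * (\<Sum>\<^sub>U \<nu>'. eta $ \<nu> $ \<nu>' * (- (?w \<mu>' * ?w \<nu>') * cis (- mdot ?P x))))"
    unfolding h_mode_def by (simp only: sum_distrib_left mult.assoc)
  also have "\<dots> = - (h_vector c a \<mu> k * h_vector c a \<nu> k) * cis (- phase k x)"
    unfolding eta_contract_one w by simp
  finally show "h_mode c a \<mu> \<nu> k x = - (h_vector c a \<mu> k * h_vector c a \<nu> k) * cis (- phase k x)" .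
qed

lemma partial_plane_wave:
  "partial \<alpha> (\<lambda>x. A * cis (- mdot P x)) = (\<lambda>x. (- \<i> * of_real (mdot P (axis \<alpha> 1)) * A) * cis (- mdot P x))"
proof
  fix x
  have lin: "bounded_linear (mdot P)"
    by (simp add: linear_conv_bounded_linear[symmetric] linear_iff mdot_add mdot_scaleR)
  have "((\<lambda>x. \<i> * of_real (- mdot P x)) has_derivative (\<lambda>v. \<i> * of_real (- mdot P v))) (at x)"
    by (intro has_derivative_mult_right has_derivative_of_real has_derivative_minus bounded_linear_imp_has_derivative[OF lin])
  from has_derivative_compose[OF this DERIV_exp[THEN has_field_derivative_imp_has_derivative]]
  have "((\<lambda>x. A * exp (\<i> * of_real (- mdot P x))) has_derivative
     (\<lambda>v. A * (exp (\<i> * of_real (- mdot P x)) * (\<i> * of_real (- mdot P v))))) (at x)"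
    by (rule has_derivative_mult_right)
  then have "((\<lambda>x. A * cis (- mdot P x)) has_derivative (\<lambda>v. (- \<i> * of_real (mdot P v) * A) * cis (- mdot P x))) (at x)"
    by (simp add: cis_conv_exp mult_ac)
  then show "partial \<alpha> (\<lambda>x. A * cis (- mdot P x)) x = (- \<i> * of_real (mdot P (axis \<alpha> 1)) * A) * cis (- mdot P x)"
    by (simp add: partial_def frechet_derivative_at[symmetric])
qed

text \<open>\<open>phase k (axis \<alpha> 1)\<close> is the lower component of the momentum, so
  every derivative multiplies by - \<i> times that component.\<close>

definition jet_amplitude :: "(real^4 \<Rightarrow> real) \<Rightarrow> (real^3 \<Rightarrow> real^3) \<Rightarrow> jet \<Rightarrow> mode \<Rightarrow> complex" where
  "jet_amplitude c a = (\<lambda>(\<alpha>s, \<mu>, \<nu>) k.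
     foldr (\<lambda>\<alpha> z. - \<i> * of_real (phase k (axis \<alpha> 1)) * z) \<alpha>s (- (h_vector c a \<mu> k * h_vector c a \<nu> k)))"

lemma quantum_jet_plane_wave:
  "quantum_jet c a x j = (\<lambda>k. jet_amplitude c a j k * cis (- phase k x))"
proof -
  obtain \<alpha>s \<mu> \<nu> where j: "j = (\<alpha>s, \<mu>, \<nu>)" by (cases j) auto
  have "partials \<alpha>s (h_mode c a \<mu> \<nu> k) = (\<lambda>x. jet_amplitude c a (\<alpha>s, \<mu>, \<nu>) k * cis (- phase k x))" for k
  proof (induction \<alpha>s)
    case Nil
    then show ?case by (simp add: partials_def jet_amplitude_def h_mode_plane_wave)
  next
    case (Cons \<alpha> \<alpha>s)
    have "partials (\<alpha> # \<alpha>s) (h_mode c a \<mu> \<nu> k) = partial \<alpha> (partials \<alpha>s (h_mode c a \<mu> \<nu> k))"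
      by (simp add: partials_def)
    then show ?case unfolding Cons partial_plane_wave by (simp add: jet_amplitude_def)
  qed
  then show ?thesis by (simp add: quantum_jet_def j)
qed

lemma quantum_jet_Cons:
  "quantum_jet c a x (\<alpha> # \<alpha>s, \<mu>, \<nu>) k = - \<i> * of_real (phase k (axis \<alpha> 1)) * quantum_jet c a x (\<alpha>s, \<mu>, \<nu>) k"
  by (simp add: quantum_jet_plane_wave jet_amplitude_def)

lemma on_shell_null:
  fixes p :: "real^3"
  shows "(on_shell p $ 0)\<^sup>2 - (on_shell p $ 1)\<^sup>2 - (on_shell p $ 2)\<^sup>2 - (on_shell p $ 3)\<^sup>2 = 0"
proof -
  have "(norm p)\<^sup>2 = (p $ 1)\<^sup>2 + (p $ 2)\<^sup>2 + (p $ 3)\<^sup>2"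
    by (simp only: power2_norm_eq_inner inner_vec_def sum_3) (simp add: power2_eq_square)
  then show ?thesis by (simp add: on_shell_def spatial_def axis_def)
qed

lemma quantum_jet_box: "(\<Sum>\<^sub>U \<rho> \<sigma>. eta $ \<rho> $ \<sigma> * quantum_jet c a x ([\<rho>, \<sigma>], \<mu>, \<nu>) k) = 0"
proof -
  let ?q = "\<lambda>\<rho>. - \<i> * of_real (phase k (axis \<rho> 1))"
  have "(\<Sum>\<^sub>U \<rho> \<sigma>. eta $ \<rho> $ \<sigma> * quantum_jet c a x ([\<rho>, \<sigma>], \<mu>, \<nu>) k) =
     (\<Sum>\<^sub>U \<rho> \<sigma>. eta $ \<rho> $ \<sigma> * ?q \<rho> * ?q \<sigma>) * quantum_jet c a x ([], \<mu>, \<nu>) k"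
    by (simp only: quantum_jet_Cons sum_distrib_right mult.assoc)
  also have "(\<Sum>\<^sub>U \<rho> \<sigma>. eta $ \<rho> $ \<sigma> * ?q \<rho> * ?q \<sigma>) = ?q 0 * ?q 0 - ?q 1 * ?q 1 - ?q 2 * ?q 2 - ?q 3 * ?q 3"
    by (rule eta_contract)
  also have "\<dots> = - of_real ((on_shell (fst k) $ 0)\<^sup>2 - (on_shell (fst k) $ 1)\<^sup>2 - (on_shell (fst k) $ 2)\<^sup>2 - (on_shell (fst k) $ 3)\<^sup>2)"
    by (simp add: mdot_axis power2_eq_square algebra_simps)
  finally show ?thesis by (simp only: on_shell_null) simp
qed

text \<open>The spatial part is (u \<plusminus> \<i> b) / sqrt 2 with u and b orthonormal and
  orthogonal to the momentum. Its square involves only |u|^2 - |b|^2 and u b, its product with the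
  momentum only p u and p b.\<close>

lemma polarization_null:
  assumes "transverse_frame a" "fst k \<noteq> 0"
  defines "e \<equiv> polarization a k" and "P \<equiv> \<lambda>\<mu>. complex_of_real (on_shell (fst k) $ \<mu>)"
  shows "e $ 0 * e $ 0 - e $ 1 * e $ 1 - e $ 2 * e $ 2 - e $ 3 * e $ 3 = 0"
    and "P 0 * e $ 0 - P 1 * e $ 1 - P 2 * e $ 2 - P 3 * e $ 3 = 0"
proof -
  let ?p = "fst k" and ?z = "if snd k then \<i> else - \<i>"
  define u where "u = a ?p"
  define b where "b = cross3 ((1 / norm ?p) *\<^sub>R ?p) u"
  have u: "u \<bullet> u = 1" "?p \<bullet> u = 0"
    using assms(1,2) unfolding transverse_frame_def u_def by (metis norm_eq_1, metis inner_commute)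
  have bb: "b \<bullet> b = 1"
  proof -
    have "(norm b)\<^sup>2 = 1"
      unfolding b_def norm_cross using u assms(2) by (simp add: power2_norm_eq_inner[of u])
    then show ?thesis by (simp add: power2_norm_eq_inner)
  qed
  have ub: "u \<bullet> b = 0" by (simp add: b_def dot_cross_self)
  have pb: "?p \<bullet> b = 0"
    by (simp add: b_def cross_mult_left dot_cross_self)
  have comp: "e $ 0 = 0" "e $ 1 = (of_real (u $ 1) + ?z * of_real (b $ 1)) / of_real (sqrt 2)"
     "e $ 2 = (of_real (u $ 2) + ?z * of_real (b $ 2)) / of_real (sqrt 2)" "e $ 3 = (of_real (u $ 3) + ?z * of_real (b $ 3)) / of_real (sqrt 2)"
    by (simp_all add: e_def polarization_def spatial_def u_def b_def case_prod_beta)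
  have zz: "?z * ?z = - 1" by simp
  have rr: "complex_of_real (sqrt 2) * complex_of_real (sqrt 2) = 2"
    by (simp flip: of_real_mult)
  have sq: "(x + z * y) / r * ((x + z * y) / r) = (x * x - y * y + 2 * z * (x * y)) / 2" if "z * z = - 1" "r * r = 2" for x y z r :: complex
  proof -
    have "(x + z * y) / r * ((x + z * y) / r) = ((x + z * y) * (x + z * y)) / (r * r)" by simp
    also have "(x + z * y) * (x + z * y) = x * x + (z * z) * (y * y) + 2 * z * (x * y)" by (simp add: algebra_simps)
    finally show ?thesis by (simp add: that)
  qed
  have in3: "x \<bullet> y = x $ 1 * y $ 1 + x $ 2 * y $ 2 + x $ 3 * y $ 3" for x y :: "real^3"
    by (simp add: inner_vec_def sum_3)
  have "e $ 0 * e $ 0 - e $ 1 * e $ 1 - e $ 2 * e $ 2 - e $ 3 * e $ 3 = - (of_real (u \<bullet> u) - of_real (b \<bullet> b) + 2 * ?z * of_real (u \<bullet> b)) / 2"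
    unfolding comp sq[OF zz rr] in3 of_real_add of_real_mult by (simp add: field_simps)
  then show "e $ 0 * e $ 0 - e $ 1 * e $ 1 - e $ 2 * e $ 2 - e $ 3 * e $ 3 = 0"
    by (simp add: u bb ub)
  have P: "P 1 = of_real (?p $ 1)" "P 2 = of_real (?p $ 2)" "P 3 = of_real (?p $ 3)"
    by (simp_all add: P_def on_shell_def spatial_def axis_def)
  have "P 0 * e $ 0 - P 1 * e $ 1 - P 2 * e $ 2 - P 3 * e $ 3 = - (of_real (?p \<bullet> u) + ?z * of_real (?p \<bullet> b)) / of_real (sqrt 2)"
    unfolding comp P in3 of_real_add of_real_mult by (simp add: add_divide_distrib diff_divide_distrib algebra_simps)
  then show "P 0 * e $ 0 - P 1 * e $ 1 - P 2 * e $ 2 - P 3 * e $ 3 = 0"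
    by (simp add: u pb)
qed

text \<open>The amplitude is a combination of two null vectors, momentum and polarization, which are
  orthogonal to each other.\<close>

lemma h_vector_null:
  assumes "transverse_frame a"
  shows "(\<Sum>\<^sub>U \<mu> \<nu>. eta $ \<mu> $ \<nu> * h_vector c a \<mu> k * h_vector c a \<nu> k) = 0"
proof (cases "fst k = 0")
  case True
  \<comment> \<open>The frame is constrained at nonzero momentum only, but at p = 0 both terms of
    \<open>h_vector\<close> contain a component of the momentum and vanish.\<close>
  have "on_shell 0 $ \<mu> = 0" for \<mu> by (simp add: on_shell_def spatial_def)
  then show ?thesis using True by (simp add: h_vector_def)
next
  case False
  let ?P = "\<lambda>\<mu>. complex_of_real (on_shell (fst k) $ \<mu>)" and ?e = "polarization a k"
  obtain E Q where h: "h_vector c a \<mu> k = ?P \<mu> * E - ?e $ \<mu> * Q" for \<mu>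
    unfolding h_vector_def by blast
  have "?P 0 * ?P 0 - ?P 1 * ?P 1 - ?P 2 * ?P 2 - ?P 3 * ?P 3 =
     of_real ((on_shell (fst k) $ 0)\<^sup>2 - (on_shell (fst k) $ 1)\<^sup>2 - (on_shell (fst k) $ 2)\<^sup>2 - (on_shell (fst k) $ 3)\<^sup>2)"
    by (simp add: power2_eq_square)
  then have PP: "?P 0 * ?P 0 - ?P 1 * ?P 1 - ?P 2 * ?P 2 - ?P 3 * ?P 3 = 0" by (simp only: on_shell_null of_real_0)
  have "(\<Sum>\<^sub>U \<mu> \<nu>. eta $ \<mu> $ \<nu> * h_vector c a \<mu> k * h_vector c a \<nu> k) =
     E * E * (?P 0 * ?P 0 - ?P 1 * ?P 1 - ?P 2 * ?P 2 - ?P 3 * ?P 3)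
     - 2 * E * Q * (?P 0 * ?e $ 0 - ?P 1 * ?e $ 1 - ?P 2 * ?e $ 2 - ?P 3 * ?e $ 3)
     + Q * Q * (?e $ 0 * ?e $ 0 - ?e $ 1 * ?e $ 1 - ?e $ 2 * ?e $ 2 - ?e $ 3 * ?e $ 3)"
    unfolding eta_contract h by (simp add: algebra_simps)
  then show ?thesis by (simp only: PP polarization_null[OF assms False]) simp
qed

lemma foldr_scale: "foldr (\<lambda>\<alpha> z. q \<alpha> * z) \<alpha>s (z :: 'a::comm_ring_1) = prod_list (map q \<alpha>s) * z"
  by (induction \<alpha>s) (simp_all add: mult_ac)

lemma quantum_jet_traceless:
  assumes "transverse_frame a"
  shows "(\<Sum>\<^sub>U \<mu> \<nu>. eta $ \<mu> $ \<nu> * quantum_jet c a x (\<alpha>s, \<mu>, \<nu>) k) = 0"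
proof -
  have "(\<Sum>\<^sub>U \<mu> \<nu>. eta $ \<mu> $ \<nu> * quantum_jet c a x (\<alpha>s, \<mu>, \<nu>) k) =
    - prod_list (map (\<lambda>\<alpha>. - \<i> * of_real (phase k (axis \<alpha> 1))) \<alpha>s) * cis (- phase k x) *
     (\<Sum>\<^sub>U \<mu> \<nu>. eta $ \<mu> $ \<nu> * h_vector c a \<mu> k * h_vector c a \<nu> k)"
    unfolding quantum_jet_plane_wave jet_amplitude_def sum_distrib_left
    by (intro sum.cong refl) (simp add: foldr_scale mult_ac)
  then show ?thesis by (simp only: h_vector_null[OF assms]) simp
qed

section \<open>Measurability and bounds of the amplitudes\<close>

lemma mode_bounded_on_shell: "mode_bounded (\<lambda>k. of_real (on_shell (fst k) $ \<mu>))"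
proof -
  have "complex_of_real (on_shell p $ \<mu>) = eta_sign \<mu> * of_real (mdot (on_shell p) (axis \<mu> 1))" for p
    by (simp add: mdot_axis)
  then show ?thesis
    by (simp only:) (intro mode_bounded_mult mode_bounded_const mode_bounded_phase)
qed

lemma abs_spatial_le: "\<bar>spatial v $ \<mu>\<bar> \<le> norm v"
  using component_le_norm_cart[of v] by (simp add: spatial_def)

lemma measurable_spatial: "(\<lambda>v. spatial v $ \<mu>) \<in> borel_measurable borel"
  unfolding spatial_def by (cases "\<mu> = 0 \<or> \<mu> = 1 \<or> \<mu> = 2") (auto intro!: borel_measurable_continuous_onI continuous_intros)

lemma mode_bounded_polarization:
  assumes a: "transverse_frame a"
  shows "mode_bounded (\<lambda>k. polarization a k $ \<mu>)"
proof -
  have pol: "polarization a k $ \<mu> = (of_real (spatial (a (fst k)) $ \<mu>)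
      + (if snd k then \<i> else - \<i>) * of_real (spatial (cross3 ((1 / norm (fst k)) *\<^sub>R fst k) (a (fst k))) $ \<mu>)) / of_real (sqrt 2)" for k
    by (simp add: polarization_def case_prod_beta)
  have am: "a \<in> borel_measurable borel" using a by (simp add: transverse_frame_def)
  have real_mode: "(\<lambda>k. complex_of_real (f (fst k))) \<in> borel_measurable shell_measure" if "f \<in> borel_measurable borel" for f :: "real^3 \<Rightarrow> real"
    using measurable_compose[OF measurable_compose[OF fst_measurable_shell that] borel_measurable_of_real] .
  have 1: "(\<lambda>p. ((1 / norm p) *\<^sub>R p, a p)) \<in> borel_measurable borel"
    by (intro borel_measurable_Pair borel_measurable_scaleR borel_measurable_divide borel_measurable_norm borel_measurable_const am) auto
  have 2: "(\<lambda>z. cross3 (fst z) (snd z)) \<in> borel_measurable borel"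
    by (intro borel_measurable_continuous_onI continuous_on_cross continuous_intros)
  have crossm: "(\<lambda>p. cross3 ((1 / norm p) *\<^sub>R p) (a p)) \<in> borel_measurable borel"
    using measurable_compose[OF 1 2] by simp
  have 3: "(\<lambda>b. if b then \<i> else - \<i>) \<in> borel_measurable (count_space UNIV)" by simp
  have "snd \<in> measurable shell_measure (count_space UNIV)"
    by measurable
  from measurable_compose[OF this 3]
  have helm: "(\<lambda>k. if snd k then \<i> else - \<i>) \<in> borel_measurable shell_measure" .
  have "(\<lambda>k. polarization a k $ \<mu>) \<in> borel_measurable shell_measure"
    unfolding pol
    by (intro borel_measurable_divide borel_measurable_add borel_measurable_times borel_measurable_const helm
        real_mode[OF measurable_compose[OF am measurable_spatial]] real_mode[OF measurable_compose[OF crossm measurable_spatial]])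
  moreover have "norm (polarization a k $ \<mu>) \<le> 2" if "0 < r" "k \<in> shell r R" for r R k
  proof -
    have p: "fst k \<noteq> 0" using that by (auto simp: shell_def)
    then have an: "norm (a (fst k)) = 1" using a by (simp add: transverse_frame_def)
    let ?b = "cross3 ((1 / norm (fst k)) *\<^sub>R fst k) (a (fst k))"
    have "(norm ?b)\<^sup>2 \<le> 1" unfolding norm_cross using an p by simp
    then have bn: "norm ?b \<le> 1" by (simp add: power_le_one_iff abs_square_le_1)
    have "norm (polarization a k $ \<mu>) \<le> (norm (a (fst k)) + 1 * norm ?b) / sqrt 2"
      unfolding pol norm_divide
      by (intro divide_mono order_refl norm_triangle_le add_mono)
         (auto simp: norm_mult intro: abs_spatial_le)
    also have "\<dots> \<le> (1 + 1) / 1" using an bn by (intro divide_mono) auto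
    finally show ?thesis by simp
  qed
  ultimately show ?thesis unfolding mode_bounded_def by blast
qed

lemma mode_bounded_string_vector:
  assumes c: "string_smearing c"
  shows "mode_bounded (\<lambda>k. string_vector c \<kappa> (on_shell (fst k)))"
proof -
  have [measurable]: "(\<lambda>e. c e * e $ \<kappa>) \<in> borel_measurable borel"
    using string_smearing_moment[OF c, of \<kappa>] by metis
  have cm: "(\<lambda>x. mdot (on_shell (fst (fst x))) (snd (fst x) *\<^sub>R snd x)) \<in> borel_measurable borel"
    unfolding mdot_def
    by (intro borel_measurable_continuous_onI continuous_intros continuous_on_compose2[OF continuous_on_shell]) auto
  have "(\<lambda>(z, e). of_real (c e * e $ \<kappa>) * cis (- mdot (on_shell (fst z)) (snd z *\<^sub>R e)))
      \<in> borel_measurable ((borel \<Otimes>\<^sub>M lborel) \<Otimes>\<^sub>M lborel)"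
  proof -
    have "(\<lambda>x. mdot (on_shell (fst (fst x))) (snd (fst x) *\<^sub>R snd x)) \<in> borel_measurable (((borel :: (real^3) measure) \<Otimes>\<^sub>M (lborel :: real measure)) \<Otimes>\<^sub>M (lborel :: (real^4) measure))"
      using cm by (simp add: borel_prod[symmetric] cong: measurable_cong_sets sets_pair_measure_cong)
    note [measurable] = this
    show ?thesis unfolding case_prod_beta by measurable
  qed
  from lborel.borel_measurable_lebesgue_integral[OF this]
  have [measurable]: "(\<lambda>z. LINT e|lborel. of_real (c e * e $ \<kappa>) * cis (- mdot (on_shell (fst z)) (snd z *\<^sub>R e))) \<in> borel_measurable ((borel :: (real^3) measure) \<Otimes>\<^sub>M lborel)" .
  have "(\<lambda>(p, s). indicator {0..} s *\<^sub>R (LINT e|lborel. of_real (c e * e $ \<kappa>) * cis (- mdot (on_shell p) (s *\<^sub>R e)))) \<in> borel_measurable ((borel :: (real^3) measure) \<Otimes>\<^sub>M lborel)"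
    unfolding case_prod_beta
    by (intro borel_measurable_scaleR measurable_compose[OF measurable_snd borel_measurable_indicator]) measurable
  then have "(\<lambda>p. string_vector c \<kappa> (on_shell p)) \<in> borel_measurable borel"
    unfolding string_vector_def set_lebesgue_integral_def by (rule lborel.borel_measurable_lebesgue_integral)
  from measurable_compose[OF fst_measurable_shell this]
  have "(\<lambda>k. string_vector c \<kappa> (on_shell (fst k))) \<in> borel_measurable shell_measure" .
  moreover have "\<exists>B. \<forall>k\<in>shell r R. norm (string_vector c \<kappa> (on_shell (fst k))) \<le> B" if "0 < r" for r R
    using norm_string_vector_le[OF c that, of \<kappa>] by (auto simp: shell_def)
  ultimately show ?thesis by (simp add: mode_bounded_def)
qed

lemma mode_bounded_minus: "mode_bounded u \<Longrightarrow> mode_bounded (\<lambda>k. - u k)"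
  using mode_bounded_mult[OF mode_bounded_const[of "- 1"]] by simp

lemma mode_bounded_h_vector:
  assumes "string_smearing c" "transverse_frame a"
  shows "mode_bounded (h_vector c a \<mu>)"
proof -
  have "mode_bounded (\<lambda>k. of_real (on_shell (fst k) $ \<mu>) * (\<Sum>\<^sub>U \<kappa>. eta_sign \<kappa> * polarization a k $ \<kappa> * string_vector c \<kappa> (on_shell (fst k)))
     + - (polarization a k $ \<mu> * (\<Sum>\<^sub>U \<kappa>. eta_sign \<kappa> * of_real (on_shell (fst k) $ \<kappa>) * string_vector c \<kappa> (on_shell (fst k)))))"
    by (intro mode_bounded_add mode_bounded_minus mode_bounded_mult mode_bounded_sum mode_bounded_const
        mode_bounded_on_shell mode_bounded_polarization mode_bounded_string_vector assms)
  then show ?thesis by (simp add: h_vector_def[abs_def])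
qed

lemma mode_bounded_jet_amplitude:
  assumes "string_smearing c" "transverse_frame a"
  shows "mode_bounded (jet_amplitude c a j)"
proof -
  obtain \<alpha>s \<mu> \<nu> where j: "j = (\<alpha>s, \<mu>, \<nu>)" by (cases j) auto
  have "mode_bounded (\<lambda>k. foldr (\<lambda>\<alpha> z. - \<i> * of_real (phase k (axis \<alpha> 1)) * z) \<alpha>s (- (h_vector c a \<mu> k * h_vector c a \<nu> k)))"
  proof (induction \<alpha>s)
    case Nil
    show ?case by (simp, intro mode_bounded_minus mode_bounded_mult mode_bounded_h_vector assms)
  next
    case (Cons \<alpha> \<alpha>s)
    then show ?case
      by (simp only: foldr.simps comp_def) (intro mode_bounded_mult mode_bounded_const mode_bounded_phase)
  qed
  then show ?thesis by (simp add: jet_amplitude_def j)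
qed

lemma mode_bounded_quantum_jet:
  assumes "string_smearing c" "transverse_frame a"
  shows "mode_bounded (quantum_jet c a x j)"
  unfolding quantum_jet_plane_wave
  by (intro mode_bounded_mult mode_bounded_jet_amplitude mode_bounded_cis_phase assms)

subsection \<open>Functionals on jet polynomials\<close>

text \<open>Classical evaluation, Wick evaluation and the total derivative are all of this form,
  with \<open>f m\<close> additive.\<close>

definition poly_sum :: "('m \<Rightarrow> real \<Rightarrow> 'b::comm_monoid_add) \<Rightarrow> ('m \<Rightarrow>\<^sub>0 real) \<Rightarrow> 'b" where
  "poly_sum f P = (\<Sum>m\<in>Poly_Mapping.keys P. f m (Poly_Mapping.lookup P m))"

locale poly_additive =
  fixes f :: "'m \<Rightarrow> real \<Rightarrow> 'b::ab_group_add"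
  assumes add: "f m (r + s) = f m r + f m s"
begin

lemma zero: "f m 0 = 0"
  using add[of m 0 0] by simp

lemma poly_sum_add: "poly_sum f (P + Q) = poly_sum f P + poly_sum f Q"
  unfolding poly_sum_def by (rule setsum_keys_plus_distrib) (simp_all add: zero add)

lemma poly_sum_zero: "poly_sum f 0 = 0"
  by (simp add: poly_sum_def)

lemma poly_sum_minus: "poly_sum f (- P) = - poly_sum f P"
  using poly_sum_add[of P "- P"] by (simp add: poly_sum_zero add_eq_0_iff)

lemma poly_sum_diff: "poly_sum f (P - Q) = poly_sum f P - poly_sum f Q"
  using poly_sum_add[of P "- Q"] by (simp add: poly_sum_minus)

lemma poly_sum_sum: "poly_sum f (\<Sum>i\<in>I. P i) = (\<Sum>i\<in>I. poly_sum f (P i))"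
  by (induction I rule: infinite_finite_induct) (simp_all add: poly_sum_zero poly_sum_add)

lemma poly_sum_single: "poly_sum f (Poly_Mapping.single m r) = f m r"
  by (simp add: poly_sum_def zero)

end

text \<open>Later proofs replace a polynomial by this sum, argue on monomials by additivity, and
  fold the sum back.\<close>

lemma sum_monomials: "(\<Sum>m\<in>Poly_Mapping.keys P. Poly_Mapping.single m (Poly_Mapping.lookup P m)) = P"
proof (rule poly_mapping_eqI)
  fix k
  have "Poly_Mapping.lookup (\<Sum>m\<in>Poly_Mapping.keys P. Poly_Mapping.single m (Poly_Mapping.lookup P m)) k =
    (\<Sum>m\<in>Poly_Mapping.keys P. if m = k then Poly_Mapping.lookup P m else 0)"
    by (simp add: lookup_sum lookup_single when_def)
  also have "\<dots> = Poly_Mapping.lookup P k"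
    by (simp add: in_keys_iff)
  finally show "Poly_Mapping.lookup (\<Sum>m\<in>Poly_Mapping.keys P. Poly_Mapping.single m (Poly_Mapping.lookup P m)) k = Poly_Mapping.lookup P k" .
qed

lemma poly_mult_monomials:
  "P * Q = (\<Sum>m\<in>Poly_Mapping.keys P. \<Sum>n\<in>Poly_Mapping.keys Q.
     Poly_Mapping.single (m + n) (Poly_Mapping.lookup P m * Poly_Mapping.lookup Q n))"
proof -
  have "P * Q = (\<Sum>m\<in>Poly_Mapping.keys P. Poly_Mapping.single m (Poly_Mapping.lookup P m)) *
     (\<Sum>n\<in>Poly_Mapping.keys Q. Poly_Mapping.single n (Poly_Mapping.lookup Q n))"
    by (simp only: sum_monomials)
  then show ?thesis by (simp only: sum_product mult_single)
qed

lemma jconst_mult: "jconst r * Poly_Mapping.single m s = Poly_Mapping.single m (r * s)"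
  by (simp add: jconst_def mult_single)

lemma jconst_add: "jconst (r + s) = jconst r + jconst s"
  by (simp add: jconst_def single_add)

lemma jconst_0: "jconst 0 = 0" by (simp add: jconst_def)

lemma jconst_1: "jconst 1 = 1"
  by (simp add: jconst_def flip: single_one)

lemma eta_jconst: "(eta $ \<mu> $ \<nu> :: jet_poly) = jconst (eta $ \<mu> $ \<nu>)"
proof -
  have "jconst (- 1) = - 1" using jconst_add[of 1 "- 1"] by (simp add: jconst_0 jconst_1 add_eq_0_iff)
  then show ?thesis by (simp add: eta_def jconst_0 jconst_1)
qed

lemma two_jconst: "(2 :: jet_poly) = jconst 2"
  using jconst_add[of 1 1] by (simp add: jconst_1)

subsection \<open>Classical evaluation\<close>

interpretation classical: poly_additive "\<lambda>m r. r * prod_mset (image_mset (classical_jet h x) m)" for h x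
  by unfold_locales (simp add: distrib_right)

lemma classical_value_poly_sum:
  "classical_value P h x = poly_sum (\<lambda>m r. r * prod_mset (image_mset (classical_jet h x) m)) P"
  by (simp add: classical_value_def poly_sum_def)

lemma classical_value_mult: "classical_value (P * Q) h x = classical_value P h x * classical_value Q h x"
  unfolding classical_value_poly_sum poly_mult_monomials[of P Q] classical.poly_sum_sum classical.poly_sum_single
  by (simp add: poly_sum_def sum_product mult_ac)

lemma classical_value_jconst: "classical_value (jconst r) h x = r"
  by (simp add: classical_value_poly_sum jconst_def classical.poly_sum_single)

lemma classical_value_jvar: "classical_value (jvar j) h x = classical_jet h x j"
  by (simp add: classical_value_poly_sum jvar_def classical.poly_sum_single)

lemmas classical_value_arith =
  classical.poly_sum_add[of h x for h x, folded classical_value_poly_sum]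
  classical.poly_sum_minus[of h x for h x, folded classical_value_poly_sum]
  classical.poly_sum_diff[of h x for h x, folded classical_value_poly_sum]
  classical.poly_sum_sum[of h x for h x, folded classical_value_poly_sum]
  classical_value_mult classical_value_jconst

definition classical_matrix :: "(real^4 \<Rightarrow> real^4^4) \<Rightarrow> real^4 \<Rightarrow> jet_poly^4^4 \<Rightarrow> real^4^4" where
  "classical_matrix h x A = (\<chi> i j. classical_value (A $ i $ j) h x)"

lemma classical_matrix_component: "classical_value (A $ i $ j) h x = classical_matrix h x A $ i $ j"
  by (simp add: classical_matrix_def)

lemma classical_value_eta: "classical_value (eta $ \<mu> $ \<nu>) h x = eta $ \<mu> $ \<nu>"
  by (simp add: eta_jconst classical_value_jconst)

lemma classical_matrix_eta: "classical_matrix h x eta = eta"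
  by (simp add: classical_matrix_def classical_value_eta vec_eq_iff)

lemma classical_matrix_tprod: "classical_matrix h x (A \<diamondop> B) = classical_matrix h x A ** eta ** classical_matrix h x B"
  by (simp add: classical_matrix_def tprod_def matrix_matrix_mult_def classical_value_arith classical_value_eta)

lemma classical_matrix_hvar: "classical_matrix h x hvar = h x"
  by (simp add: classical_matrix_def hvar_def classical_value_jvar classical_jet_def partials_def vec_eq_iff)

lemma classical_matrix_dhvar: "classical_matrix h x (dhvar \<alpha>) = partial_matrix \<alpha> h x"
  by (simp add: classical_matrix_def dhvar_def classical_value_jvar classical_jet_def partials_def vec_eq_iff partial_matrix_def)

lemma classical_value_ttrace: "classical_value (ttrace A) h x = trace (eta ** classical_matrix h x A)"
proof -
  have "trace (eta ** B) = (\<Sum>\<^sub>U \<mu> \<nu>. eta $ \<mu> $ \<nu> * B $ \<mu> $ \<nu>)" for B :: "real^4^4"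
    unfolding trace_mult_conv by (intro sum.cong refl) (auto simp: eta_def)
  then show ?thesis
    by (simp add: ttrace_def classical_value_arith classical_matrix_eta classical_matrix_component)
qed

lemmas classical_value_simps = classical_value_arith classical_value_eta classical_value_ttrace
  classical_matrix_tprod classical_matrix_hvar classical_matrix_dhvar classical_matrix_eta

subsection \<open>The classical quartic interaction\<close>

text \<open>The three summands are the Leibniz terms of the undifferentiated factors in the
  divergence of tr (hhh \<partial>h). Kept separate, they match
  \<open>divergence_current_deriv\<close> literally.\<close>

definition divergence_part :: jet_poly where
  "divergence_part = (\<Sum>\<^sub>U \<rho> \<sigma>. eta $ \<rho> $ \<sigma> *
     (ttrace (dhvar \<rho> \<diamondop> hvar \<diamondop> hvar \<diamondop> dhvar \<sigma>) + ttrace (hvar \<diamondop> dhvar \<rho> \<diamondop> hvar \<diamondop> dhvar \<sigma>)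
      + ttrace (hvar \<diamondop> hvar \<diamondop> dhvar \<rho> \<diamondop> dhvar \<sigma>)))"

text \<open>The contributions of the product of traces in which one factor is tr (\<partial>h)
  itself; the remaining one, tr (h \<partial>h) tr (h \<partial>h), belongs to
  \<open>L2_poly\<close>.\<close>

definition trace_part :: jet_poly where
  "trace_part = (\<Sum>\<^sub>U \<rho> \<sigma>. (hvar $ \<rho> $ \<sigma> * ttrace (hvar \<diamondop> dhvar \<sigma>) - eta $ \<rho> $ \<sigma> * ttrace (hvar \<diamondop> hvar \<diamondop> dhvar \<sigma>)) * ttrace (dhvar \<rho>))"

text \<open>Both sides are reduced to the invariants \<open>X1\<close> to \<open>X6\<close>: 1, 2
  and 3 do this for the double trace term, the product of traces and the untraced term of the
  expansion.\<close>

lemma is_classical_L2_full: "is_classical_L2 (L2_poly + divergence_part + trace_part)"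
  unfolding is_classical_L2_def
proof (intro allI impI)
  fix h :: "real^4 \<Rightarrow> real^4^4" and x
  assume h: "smooth h" and sym: "\<forall>y. transpose (h y) = h y"
  have "h differentiable (at x)" using smooth_partials_differentiable[OF h, of "[]"] by (simp add: partials_def)
  define A where "A = h x"
  define H where "H = (\<lambda>a. partial_matrix a h x)"
  have As: "A $ a $ b = A $ b $ a" for a b unfolding A_def by (rule transpose_eq_self[OF sym[rule_format]])
  have es: "(eta :: real^4^4) $ a $ b = eta $ b $ a" for a b by (simp add: eta_def)
  let ?G1 = "- (eta ** A ** eta)" and ?G2 = "eta ** A ** eta ** A ** eta"
  let ?t0 = "\<lambda>a. trace (eta ** H a)" and ?t1 = "\<lambda>a. trace (eta ** A ** eta ** H a)" and ?t2 = "\<lambda>a. trace (eta ** A ** eta ** A ** eta ** H a)"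
  let ?S = "\<lambda>f. \<Sum>a\<in>(UNIV::4 set). \<Sum>b\<in>(UNIV::4 set). (f a b :: real)"
  obtain d where d: "has_kappa_expansion (\<lambda>\<kappa>. einstein_lagrangian \<kappa> h x) d" and d2: "d 2 = 1 / 2 *
    (?S (\<lambda>a b. eta $ a $ b * (trace (?G2 ** H a ** eta ** H b) + trace (?G1 ** H a ** ?G1 ** H b) + trace (eta ** H a ** ?G2 ** H b))
        + A $ a $ b * (trace (?G1 ** H a ** eta ** H b) + trace (eta ** H a ** ?G1 ** H b)))
      - 1 / 2 * ?S (\<lambda>a b. eta $ a $ b * (trace (eta ** H a) * trace (?G2 ** H b)
            + trace (?G1 ** H a) * trace (?G1 ** H b) + trace (?G2 ** H a) * trace (eta ** H b))
          + A $ a $ b * (trace (eta ** H a) * trace (?G1 ** H b) + trace (?G1 ** H a) * trace (eta ** H b)))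
      - 2 * ?S (\<lambda>a b. (H a ** ?G2 ** H b) $ b $ a))"
    using einstein_lagrangian_expansion[OF \<open>h differentiable (at x)\<close> sym[rule_format]] unfolding A_def H_def by blast
  \<comment> \<open>Under a symmetric coefficient the labels a and b may be exchanged; together with
    the cyclic invariance \<open>cyc\<close> this merges mirror-image terms of the
    expansion.\<close>
  have swapA: "?S (\<lambda>a b. A $ a $ b * f b a) = ?S (\<lambda>a b. A $ a $ b * f a b)" for f
    by (subst sum.swap, intro sum.cong refl) (simp add: As)
  have swape: "?S (\<lambda>a b. eta $ a $ b * f b a) = ?S (\<lambda>a b. eta $ a $ b * f a b)" for f
    by (subst sum.swap, intro sum.cong refl) (simp add: es)
  have cyc: "trace (eta ** H a ** (eta ** A ** eta) ** H b) = trace (eta ** A ** eta ** H b ** eta ** H a)" for a b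
    using trace_mul_sym[of "eta ** H a" "eta ** A ** eta ** H b"] by (simp add: matrix_mul_assoc)
  define X1 where "X1 = ?S (\<lambda>a b. (H b ** ?G2 ** H a) $ a $ b)"
  define X2 where "X2 = ?S (\<lambda>a b. eta $ a $ b * (?t1 a * ?t1 b))"
  define X3 where "X3 = ?S (\<lambda>a b. A $ a $ b * trace (eta ** A ** eta ** H a ** eta ** H b))"
  define X4 where "X4 = ?S (\<lambda>a b. eta $ a $ b * (trace (eta ** H a ** ?G2 ** H b) + trace (eta ** A ** eta ** H a ** (eta ** A ** eta) ** H b) + trace (?G2 ** H a ** eta ** H b)))"
  define X5 where "X5 = ?S (\<lambda>a b. A $ a $ b * (?t0 a * ?t1 b))"
  define X6 where "X6 = ?S (\<lambda>a b. eta $ a $ b * (?t0 a * ?t2 b))"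
  have 1: "?S (\<lambda>a b. eta $ a $ b * (trace (?G2 ** H a ** eta ** H b) + trace (?G1 ** H a ** ?G1 ** H b) + trace (eta ** H a ** ?G2 ** H b))
        + A $ a $ b * (trace (?G1 ** H a ** eta ** H b) + trace (eta ** H a ** ?G1 ** H b))) = X4 - 2 * X3"
  proof -
    have "?S (\<lambda>a b. A $ a $ b * trace (eta ** A ** eta ** H b ** eta ** H a)) = X3"
      unfolding X3_def by (rule swapA)
    then have "?S (\<lambda>a b. A $ a $ b * (trace (?G1 ** H a ** eta ** H b) + trace (eta ** H a ** ?G1 ** H b))) = - 2 * X3"
      by (simp add: matrix_mul_uminus trace_uminus cyc right_diff_distrib sum_subtractf sum_negf X3_def)
    moreover have "?S (\<lambda>a b. eta $ a $ b * (trace (?G2 ** H a ** eta ** H b) + trace (?G1 ** H a ** ?G1 ** H b) + trace (eta ** H a ** ?G2 ** H b))) = X4"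
      by (simp add: matrix_mul_uminus trace_uminus X4_def add_ac)
    ultimately show ?thesis by (simp only: sum.distrib)
  qed
  have 2: "?S (\<lambda>a b. eta $ a $ b * (trace (eta ** H a) * trace (?G2 ** H b)
            + trace (?G1 ** H a) * trace (?G1 ** H b) + trace (?G2 ** H a) * trace (eta ** H b))
          + A $ a $ b * (trace (eta ** H a) * trace (?G1 ** H b) + trace (?G1 ** H a) * trace (eta ** H b))) = 2 * X6 + X2 - 2 * X5"
  proof -
    have "?S (\<lambda>a b. eta $ a $ b * (?t2 a * ?t0 b)) = X6"
      unfolding X6_def using swape[of "\<lambda>a b. ?t0 a * ?t2 b"] by (simp add: mult.commute)
    moreover have "?S (\<lambda>a b. A $ a $ b * (?t1 a * ?t0 b)) = X5"
      unfolding X5_def using swapA[of "\<lambda>a b. ?t0 a * ?t1 b"] by (simp add: mult.commute)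
    ultimately show ?thesis
      by (simp add: matrix_mul_uminus trace_uminus distrib_left right_diff_distrib sum.distrib sum_subtractf sum_negf X2_def X5_def X6_def)
  qed
  have 3: "?S (\<lambda>a b. (H a ** ?G2 ** H b) $ b $ a) = X1"
    unfolding X1_def by (rule sum.swap)
  have "classical_value (L2_poly + divergence_part + trace_part) h x =
     - 2 * X1 - 1 / 2 * X2 - 2 * X3 + X4 + (X5 - X6)"
  proof -
    have "classical_value L2_poly h x = - 2 * X1 - 1 / 2 * X2 - 2 * X3"
      unfolding L2_poly_def two_jconst
      by (simp add: classical_value_simps classical_matrix_component matrix_mul_assoc A_def H_def X1_def X2_def X3_def mult_ac)
    moreover have "classical_value divergence_part h x = X4"
      unfolding divergence_part_def
      by (simp add: classical_value_simps matrix_mul_assoc A_def H_def X4_def)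
    moreover have "classical_value trace_part h x = X5 - X6"
      unfolding trace_part_def
      by (simp add: classical_value_simps classical_matrix_component matrix_mul_assoc A_def H_def X5_def X6_def algebra_simps sum_subtractf)
    ultimately show ?thesis by (simp add: classical_value_arith)
  qed
  \<comment> \<open>The factor 2 undoes the \<kappa>^2 / 2 in
    \<open>is_classical_L2\<close>.\<close>
  also have "\<dots> = 2 * d 2" unfolding d2 1 2 3 by (simp add: field_simps)
  finally show "\<exists>a. has_kappa_expansion (\<lambda>\<kappa>. einstein_lagrangian \<kappa> h x) a \<and>
      (\<forall>\<kappa>. \<kappa>\<^sup>2 / 2 * classical_value (L2_poly + divergence_part + trace_part) h x = a 2 * \<kappa>\<^sup>2)"
    using d by (intro exI[of _ d]) simp
qed

subsection \<open>Wick evaluation\<close>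

interpretation wick: poly_additive "\<lambda>m r. of_real r * wick_form (map (quantum_jet c a x) (SOME js. mset js = m)) \<phi> \<psi>" for c a x \<phi> \<psi>
  by unfold_locales (simp add: distrib_right)

lemma wick_value_poly_sum:
  "wick_value c a P x \<phi> \<psi> = poly_sum (\<lambda>m r. of_real r * wick_form (map (quantum_jet c a x) (SOME js. mset js = m)) \<phi> \<psi>) P"
  by (simp add: wick_value_def poly_sum_def)

lemmas wick_value_arith =
  wick.poly_sum_add[of c a x \<phi> \<psi> for c a x \<phi> \<psi>, folded wick_value_poly_sum]
  wick.poly_sum_diff[of c a x \<phi> \<psi> for c a x \<phi> \<psi>, folded wick_value_poly_sum]
  wick.poly_sum_sum[of c a x \<phi> \<psi> for c a x \<phi> \<psi>, folded wick_value_poly_sum]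

fun jet_deriv :: "4 \<Rightarrow> jet \<Rightarrow> jet" where
  "jet_deriv \<rho> (\<alpha>s, \<mu>, \<nu>) = (\<rho> # \<alpha>s, \<mu>, \<nu>)"

text \<open>The sum runs over occurrences, so a repeated factor counts with its
  multiplicity.\<close>

definition monomial_deriv :: "4 \<Rightarrow> jet multiset \<Rightarrow> jet_poly" where
  "monomial_deriv \<rho> m = (\<Sum>j\<in>#m. Poly_Mapping.single (m - {#j#} + {#jet_deriv \<rho> j#}) 1)"

text \<open>The formal derivation of the jet ring that prepends an index to a jet;
  \<open>wick_value_has_derivative\<close> identifies it with the analytic derivative.\<close>

definition total_deriv :: "4 \<Rightarrow> jet_poly \<Rightarrow> jet_poly" where
  "total_deriv \<rho> = poly_sum (\<lambda>m r. jconst r * monomial_deriv \<rho> m)"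

interpretation deriv: poly_additive "\<lambda>m r. jconst r * monomial_deriv \<rho> m" for \<rho>
  by unfold_locales (simp add: jconst_add distrib_right)

lemmas total_deriv_arith =
  deriv.poly_sum_add[of \<rho> for \<rho>, folded total_deriv_def]
  deriv.poly_sum_sum[of \<rho> for \<rho>, folded total_deriv_def]

lemma total_deriv_single: "total_deriv \<rho> (Poly_Mapping.single m r) = jconst r * monomial_deriv \<rho> m"
  by (simp add: total_deriv_def deriv.poly_sum_single)

lemma total_deriv_jconst: "total_deriv \<rho> (jconst r) = 0"
  by (simp add: jconst_def[of r] total_deriv_single monomial_deriv_def)

lemma total_deriv_jvar: "total_deriv \<rho> (jvar j) = jvar (jet_deriv \<rho> j)"
  by (simp add: jvar_def total_deriv_single monomial_deriv_def jconst_1)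

lemma monomial_deriv_add:
  "monomial_deriv \<rho> (m + n) = monomial_deriv \<rho> m * Poly_Mapping.single n 1 + Poly_Mapping.single m 1 * monomial_deriv \<rho> n"
proof -
  have 1: "(\<Sum>j\<in>#m. Poly_Mapping.single (m + n - {#j#} + {#jet_deriv \<rho> j#}) (1::real)) = monomial_deriv \<rho> m * Poly_Mapping.single n 1" for m n
    unfolding monomial_deriv_def sum_mset_distrib_right
    by (intro arg_cong[where f = sum_mset] image_mset_cong) (simp add: mult_single)
  show ?thesis
    using 1[of m n] 1[of n m] unfolding monomial_deriv_def[of \<rho> "m + n"] by (simp add: add.commute mult.commute)
qed

lemma total_deriv_mult: "total_deriv \<rho> (P * Q) = total_deriv \<rho> P * Q + P * total_deriv \<rho> Q"
proof -
  let ?p = "Poly_Mapping.lookup P" and ?q = "Poly_Mapping.lookup Q"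
  have s: "Poly_Mapping.single m r = jconst r * Poly_Mapping.single m 1" for m :: "jet multiset" and r
    by (simp add: jconst_mult)
  have jm: "jconst (r * t) = jconst r * jconst t" for r t
    by (simp add: jconst_def mult_single)
  have "total_deriv \<rho> (P * Q) = (\<Sum>m\<in>Poly_Mapping.keys P. \<Sum>n\<in>Poly_Mapping.keys Q.
     (jconst (?p m) * monomial_deriv \<rho> m) * Poly_Mapping.single n (?q n) + Poly_Mapping.single m (?p m) * (jconst (?q n) * monomial_deriv \<rho> n))"
    unfolding poly_mult_monomials[of P Q] total_deriv_arith total_deriv_single monomial_deriv_add
    by (intro sum.cong refl) (simp only: s[of _ "?p _"] s[of _ "?q _"] jm distrib_left mult_ac)
  also have "\<dots> = total_deriv \<rho> P * (\<Sum>n\<in>Poly_Mapping.keys Q. Poly_Mapping.single n (?q n)) +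
     (\<Sum>m\<in>Poly_Mapping.keys P. Poly_Mapping.single m (?p m)) * total_deriv \<rho> Q"
    unfolding total_deriv_def poly_sum_def sum_product sum.distrib ..
  finally show ?thesis by (simp only: sum_monomials)
qed

lemma mset_some_list: "mset (SOME js. mset js = m) = m"
  using someI_ex[OF ex_mset[of m]] .

locale string_field =
  fixes c :: "real^4 \<Rightarrow> real" and a :: "real^3 \<Rightarrow> real^3"
  assumes smearing: "string_smearing c" and frame: "transverse_frame a"
begin

lemma quantum_jet_bounded: "mode_bounded (quantum_jet c a x j)"
  by (rule mode_bounded_quantum_jet[OF smearing frame])

lemma wick_value_single:
  assumes "\<phi> \<in> fock_domain" "\<psi> \<in> fock_domain"
  shows "wick_value c a (Poly_Mapping.single (mset js) r) x \<phi> \<psi> = of_real r * wick_form (map (quantum_jet c a x) js) \<phi> \<psi>"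
proof -
  have "wick_form (map (quantum_jet c a x) (SOME is. mset is = mset js)) \<phi> \<psi> = wick_form (map (quantum_jet c a x) js) \<phi> \<psi>"
    using assms by (intro wick_form_mset) (auto simp: mset_some_list quantum_jet_bounded)
  then show ?thesis by (simp add: wick_value_poly_sum wick.poly_sum_single)
qed

text \<open>The recursion of \<open>wick_form\<close>, with j listed first, lifted to polynomials. A
  factor \<open>jvar j\<close> changes only the two Fock vectors and leaves P untouched.\<close>

lemma wick_value_jvar_mult:
  assumes "\<phi> \<in> fock_domain" "\<psi> \<in> fock_domain"
  shows "wick_value c a (jvar j * P) x \<phi> \<psi> =
    wick_value c a P x (annihilate (quantum_jet c a x j) \<phi>) \<psi> + wick_value c a P x \<phi> (annihilate (quantum_jet c a x j) \<psi>)"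
proof -
  let ?u = "quantum_jet c a x j"
  have m: "wick_value c a (jvar j * Poly_Mapping.single m r) x \<phi> \<psi> =
     wick_value c a (Poly_Mapping.single m r) x (annihilate ?u \<phi>) \<psi> + wick_value c a (Poly_Mapping.single m r) x \<phi> (annihilate ?u \<psi>)" for m r
  proof -
    obtain js where m: "m = mset js" by (metis ex_mset)
    have "jvar j * Poly_Mapping.single m r = Poly_Mapping.single (mset (j # js)) r"
      by (simp add: jvar_def mult_single m)
    then show ?thesis
      unfolding m using assms annihilate_in_fock_domain[OF quantum_jet_bounded]
      by (simp add: wick_value_single distrib_left del: mset.simps)
  qed
  have "wick_value c a (jvar j * (\<Sum>m\<in>Poly_Mapping.keys P. Poly_Mapping.single m (Poly_Mapping.lookup P m))) x \<phi> \<psi> =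
    wick_value c a (\<Sum>m\<in>Poly_Mapping.keys P. Poly_Mapping.single m (Poly_Mapping.lookup P m)) x (annihilate ?u \<phi>) \<psi>
    + wick_value c a (\<Sum>m\<in>Poly_Mapping.keys P. Poly_Mapping.single m (Poly_Mapping.lookup P m)) x \<phi> (annihilate ?u \<psi>)"
    unfolding sum_distrib_left wick_value_arith m sum.distrib ..
  then show ?thesis by (simp only: sum_monomials)
qed

text \<open>All jets at a point carry the same plane-wave phase, so on a monomial
  \<open>wick_form_has_derivative\<close> applies to the amplitudes. The differentiated mode in
  position i is the jet with one more index, by \<open>quantum_jet_Cons\<close>.\<close>

lemma wick_value_has_derivative:
  assumes \<phi>: "\<phi> \<in> fock_domain" and \<psi>: "\<psi> \<in> fock_domain"
  shows "\<exists>D. ((\<lambda>y. wick_value c a P y \<phi> \<psi>) has_derivative D) (at x) \<and> (\<forall>\<rho>. D (axis \<rho> 1) = wick_value c a (total_deriv \<rho> P) x \<phi> \<psi>)"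
proof -
  have mono: "\<exists>D. ((\<lambda>y. wick_value c a (Poly_Mapping.single m r) y \<phi> \<psi>) has_derivative D) (at x) \<and>
     (\<forall>\<rho>. D (axis \<rho> 1) = wick_value c a (total_deriv \<rho> (Poly_Mapping.single m r)) x \<phi> \<psi>)" for m r
  proof -
    obtain js where m: "m = mset js" by (metis ex_mset)
    let ?q = "\<lambda>y. map (quantum_jet c a y) js"
    have q: "?q y = map (\<lambda>u k. u k * cis (- phase k y)) (map (jet_amplitude c a) js)" for y
      by (simp add: quantum_jet_plane_wave)
    let ?D = "\<lambda>v. \<Sum>i<length js. wick_form ((?q x)[i := (\<lambda>k. - \<i> * of_real (phase k v) * quantum_jet c a x (js ! i) k)]) \<phi> \<psi>"
    have "((\<lambda>y. wick_form (?q y) \<phi> \<psi>) has_derivative ?D) (at x)"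
    proof -
      have "((\<lambda>y. wick_form (map (\<lambda>u k. u k * cis (- phase k y)) (map (jet_amplitude c a) js)) \<phi> \<psi>) has_derivative
        (\<lambda>v. \<Sum>i<length (map (jet_amplitude c a) js). wick_form ((map (\<lambda>u k. u k * cis (- phase k x)) (map (jet_amplitude c a) js))
        [i := (\<lambda>k. - \<i> * of_real (phase k v) * ((map (jet_amplitude c a) js ! i) k * cis (- phase k x)))]) \<phi> \<psi>)) (at x)"
        by (rule wick_form_has_derivative) (use assms mode_bounded_jet_amplitude[OF smearing frame] in auto)
      then show ?thesis unfolding q[symmetric] by (simp add: quantum_jet_plane_wave)
    qed
    then have "((\<lambda>y. of_real r * wick_form (?q y) \<phi> \<psi>) has_derivative (\<lambda>v. of_real r * ?D v)) (at x)"
      by (rule has_derivative_mult_right)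
    moreover have "of_real r * ?D (axis \<rho> 1) = wick_value c a (total_deriv \<rho> (Poly_Mapping.single m r)) x \<phi> \<psi>" for \<rho>
    proof -
      have "?D (axis \<rho> 1) = (\<Sum>i<length js. wick_form (map (quantum_jet c a x) (js[i := jet_deriv \<rho> (js ! i)])) \<phi> \<psi>)"
      proof (intro sum.cong refl)
        fix i
        have "(\<lambda>k. - \<i> * of_real (phase k (axis \<rho> 1)) * quantum_jet c a x (js ! i) k) = quantum_jet c a x (jet_deriv \<rho> (js ! i))"
          by (cases "js ! i") (simp only: jet_deriv.simps quantum_jet_Cons fun_eq_iff, simp)
        then show "wick_form ((?q x)[i := (\<lambda>k. - \<i> * of_real (phase k (axis \<rho> 1)) * quantum_jet c a x (js ! i) k)]) \<phi> \<psi> =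
          wick_form (map (quantum_jet c a x) (js[i := jet_deriv \<rho> (js ! i)])) \<phi> \<psi>"
          by (simp only: map_update)
      qed
      also have "of_real r * \<dots> = (\<Sum>i<length js. wick_value c a (Poly_Mapping.single (mset js - {#js ! i#} + {#jet_deriv \<rho> (js ! i)#}) r) x \<phi> \<psi>)"
        unfolding sum_distrib_left
        by (intro sum.cong refl) (simp add: wick_value_single[OF \<phi> \<psi>, symmetric] mset_update)
      also have "\<dots> = wick_value c a (\<Sum>i<length js. Poly_Mapping.single (mset js - {#js ! i#} + {#jet_deriv \<rho> (js ! i)#}) r) x \<phi> \<psi>"
        by (simp only: wick_value_arith)
      also have "(\<Sum>i<length js. Poly_Mapping.single (mset js - {#js ! i#} + {#jet_deriv \<rho> (js ! i)#}) r) = total_deriv \<rho> (Poly_Mapping.single m r)"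
      proof -
        \<comment> \<open>Occurrences in the multiset correspond to positions in the list.\<close>
        have "monomial_deriv \<rho> (mset js) = (\<Sum>i<length js. Poly_Mapping.single (mset js - {#js ! i#} + {#jet_deriv \<rho> (js ! i)#}) 1)"
          unfolding monomial_deriv_def mset_map[symmetric] sum_mset_sum_list sum_list_sum_nth
          by (simp add: atLeast0LessThan)
        then show ?thesis by (simp add: m total_deriv_single sum_distrib_left jconst_mult)
      qed
      finally show ?thesis .
    qed
    ultimately show ?thesis unfolding m wick_value_single[OF \<phi> \<psi>] by blast
  qed
  then obtain D where D: "\<And>m r. ((\<lambda>y. wick_value c a (Poly_Mapping.single m r) y \<phi> \<psi>) has_derivative D m r) (at x)"
     "\<And>m r \<rho>. D m r (axis \<rho> 1) = wick_value c a (total_deriv \<rho> (Poly_Mapping.single m r)) x \<phi> \<psi>"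
    by metis
  let ?s = "\<lambda>m. Poly_Mapping.single m (Poly_Mapping.lookup P m)"
  have "((\<lambda>y. wick_value c a (\<Sum>m\<in>Poly_Mapping.keys P. ?s m) y \<phi> \<psi>) has_derivative (\<lambda>v. \<Sum>m\<in>Poly_Mapping.keys P. D m (Poly_Mapping.lookup P m) v)) (at x)"
    unfolding wick_value_arith by (intro has_derivative_sum D(1))
  moreover have "(\<Sum>m\<in>Poly_Mapping.keys P. D m (Poly_Mapping.lookup P m) (axis \<rho> 1)) = wick_value c a (total_deriv \<rho> (\<Sum>m\<in>Poly_Mapping.keys P. ?s m)) x \<phi> \<psi>" for \<rho>
    unfolding total_deriv_arith wick_value_arith D(2) ..
  ultimately show ?thesis unfolding sum_monomials by blast
qed

lemma wick_value_partial:
  assumes "\<phi> \<in> fock_domain" "\<psi> \<in> fock_domain"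
  shows "(\<lambda>y. wick_value c a P y \<phi> \<psi>) differentiable (at x)"
    and "partial \<rho> (\<lambda>y. wick_value c a P y \<phi> \<psi>) x = wick_value c a (total_deriv \<rho> P) x \<phi> \<psi>"
proof -
  obtain D where D: "((\<lambda>y. wick_value c a P y \<phi> \<psi>) has_derivative D) (at x)" "D (axis \<rho> 1) = wick_value c a (total_deriv \<rho> P) x \<phi> \<psi>"
    using wick_value_has_derivative[OF assms] by blast
  show "(\<lambda>y. wick_value c a P y \<phi> \<psi>) differentiable (at x)" using D(1) by (rule differentiableI)
  show "partial \<rho> (\<lambda>y. wick_value c a P y \<phi> \<psi>) x = wick_value c a (total_deriv \<rho> P) x \<phi> \<psi>"
    using partialI[OF D(1)] D(2) by simp
qed

text \<open>Asking for all vectors of the domain makes these polynomials an ideal: a further jet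
  factor only replaces the vectors by annihilated ones, which lie in the domain again.\<close>

definition wick_null :: "jet_poly \<Rightarrow> bool" where
  "wick_null P \<longleftrightarrow> (\<forall>\<phi>\<in>fock_domain. \<forall>\<psi>\<in>fock_domain. \<forall>x. wick_value c a P x \<phi> \<psi> = 0)"

lemma wick_null_sum: "(\<And>i. i \<in> I \<Longrightarrow> wick_null (P i)) \<Longrightarrow> wick_null (\<Sum>i\<in>I. P i)"
  by (simp add: wick_null_def wick_value_arith)

lemma wick_null_jvar_mult: "wick_null P \<Longrightarrow> wick_null (jvar j * P)"
  by (simp add: wick_null_def wick_value_jvar_mult annihilate_in_fock_domain quantum_jet_bounded)

lemma wick_null_jconst_mult:
  assumes "wick_null P"
  shows "wick_null (jconst r * P)"
proof -
  have "wick_value c a (jconst r * (\<Sum>m\<in>Poly_Mapping.keys P. Poly_Mapping.single m (Poly_Mapping.lookup P m))) x \<phi> \<psi> =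
    of_real r * wick_value c a (\<Sum>m\<in>Poly_Mapping.keys P. Poly_Mapping.single m (Poly_Mapping.lookup P m)) x \<phi> \<psi>" for x \<phi> \<psi>
    unfolding sum_distrib_left wick_value_arith jconst_mult
    by (simp add: wick_value_poly_sum wick.poly_sum_single sum_distrib_left mult.assoc)
  with assms show ?thesis unfolding sum_monomials by (simp add: wick_null_def)
qed

text \<open>Each monomial of R is built up by factors \<open>jvar j\<close>, and every such factor
  preserves vanishing.\<close>

lemma wick_null_mult:
  assumes P: "wick_null P"
  shows "wick_null (R * P)"
proof -
  have "wick_null (Poly_Mapping.single m r * P)" for m r
  proof (induction m)
    case empty
    then show ?case using wick_null_jconst_mult[OF P, of r] by (simp add: jconst_def)
  next
    case (add j m)
    have "Poly_Mapping.single (add_mset j m) r * P = jvar j * (Poly_Mapping.single m r * P)"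
      by (simp add: jvar_def mult_single flip: mult.assoc)
    with wick_null_jvar_mult[OF add, of j] show ?case by simp
  qed
  then have "wick_null ((\<Sum>m\<in>Poly_Mapping.keys R. Poly_Mapping.single m (Poly_Mapping.lookup R m)) * P)"
    unfolding sum_distrib_right by (intro wick_null_sum)
  then show ?thesis by (simp only: sum_monomials)
qed

text \<open>\<open>wick_form\<close> is additive and real-homogeneous in a mode, and eta is real. A
  linear relation between mode functions thus becomes a relation between fields.\<close>

lemma wick_null_eta_sum:
  assumes "\<And>x k. (\<Sum>\<^sub>U \<mu> \<nu>. eta $ \<mu> $ \<nu> * quantum_jet c a x (j \<mu> \<nu>) k) = 0"
  shows "wick_null (\<Sum>\<^sub>U \<mu> \<nu>. eta $ \<mu> $ \<nu> * jvar (j \<mu> \<nu>))"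
  unfolding wick_null_def
proof (intro ballI allI)
  fix \<phi> \<psi> x assume dom: "\<phi> \<in> fock_domain" "\<psi> \<in> fock_domain"
  let ?u = "\<lambda>i. quantum_jet c a x (j (fst i) (snd i))" and ?e = "\<lambda>i. (eta :: real^4^4) $ fst i $ snd i"
  have "wick_value c a (\<Sum>\<^sub>U \<mu> \<nu>. eta $ \<mu> $ \<nu> * jvar (j \<mu> \<nu>)) x \<phi> \<psi> =
    (\<Sum>\<^sub>U \<mu> \<nu>. of_real (eta $ \<mu> $ \<nu>) * wick_form [quantum_jet c a x (j \<mu> \<nu>)] \<phi> \<psi>)"
  proof -
    have "wick_value c a (eta $ \<mu> $ \<nu> * jvar i) x \<phi> \<psi> = of_real (eta $ \<mu> $ \<nu>) * wick_form [quantum_jet c a x i] \<phi> \<psi>" for \<mu> \<nu> i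
      using wick_value_single[OF dom, of "[i]" "eta $ \<mu> $ \<nu>"] by (simp add: eta_jconst jvar_def jconst_mult)
    then show ?thesis by (simp only: wick_value_arith)
  qed
  also have "\<dots> = (\<Sum>\<^sub>U i. of_real (?e i) * wick_form [?u i] \<phi> \<psi>)"
    by (simp only: sum.cartesian_product UNIV_Times_UNIV case_prod_beta')
  also have "\<dots> = wick_form [\<lambda>k. \<Sum>\<^sub>U i. of_real (?e i) * ?u i k] \<phi> \<psi>"
    by (rule wick_form_Cons_sum[symmetric]) (auto simp: quantum_jet_bounded dom)
  \<comment> \<open>The zero mode is written as a product so that
    \<open>wick_form_Cons_scale\<close> extracts the factor 0.\<close>
  also have "(\<lambda>k. \<Sum>\<^sub>U i. of_real (?e i) * ?u i k) = (\<lambda>k. of_real 0 * 0)"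
  proof
    fix k
    have "complex_of_real (eta $ \<mu> $ \<nu>) = eta $ \<mu> $ \<nu>" for \<mu> \<nu> by (simp add: eta_def)
    then have "(\<Sum>\<^sub>U i. of_real (?e i) * ?u i k) = (\<Sum>\<^sub>U i. eta $ fst i $ snd i * ?u i k)" by simp
    also have "\<dots> = (\<Sum>\<^sub>U \<mu> \<nu>. eta $ \<mu> $ \<nu> * quantum_jet c a x (j \<mu> \<nu>) k)"
      by (simp only: sum.cartesian_product UNIV_Times_UNIV case_prod_beta')
    finally show "(\<Sum>\<^sub>U i. of_real (?e i) * ?u i k) = of_real 0 * 0" by (simp only: assms) simp
  qed
  also have "wick_form [\<lambda>k. of_real 0 * 0] \<phi> \<psi> = 0"
    using wick_form_Cons_scale[of "[]" "\<lambda>_. 0" \<phi> \<psi> 0] dom mode_bounded_const by simp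
  finally show "wick_value c a (\<Sum>\<^sub>U \<mu> \<nu>. eta $ \<mu> $ \<nu> * jvar (j \<mu> \<nu>)) x \<phi> \<psi> = 0" .
qed

lemma wick_null_trace: "wick_null (ttrace (dhvar \<rho>))"
  unfolding ttrace_def dhvar_def using wick_null_eta_sum[of "\<lambda>\<mu> \<nu>. ([\<rho>], \<mu>, \<nu>)"] quantum_jet_traceless[OF frame]
  by simp

lemma wick_null_box: "wick_null (\<Sum>\<^sub>U \<rho> \<sigma>. eta $ \<rho> $ \<sigma> * jvar ([\<rho>, \<sigma>], \<mu>, \<nu>))"
  by (rule wick_null_eta_sum) (rule quantum_jet_box)

end

subsection \<open>The divergence\<close>

definition ddhvar :: "4 \<Rightarrow> 4 \<Rightarrow> jet_poly^4^4" where
  "ddhvar \<rho> \<sigma> = (\<chi> \<mu> \<nu>. jvar ([\<rho>, \<sigma>], \<mu>, \<nu>))"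

definition divergence_current :: "4 \<Rightarrow> jet_poly" where
  "divergence_current \<rho> = (\<Sum>\<^sub>U \<sigma>. eta $ \<rho> $ \<sigma> * ttrace (hvar \<diamondop> hvar \<diamondop> hvar \<diamondop> dhvar \<sigma>))"

definition box_part :: jet_poly where
  "box_part = (\<Sum>\<^sub>U \<rho> \<sigma>. eta $ \<rho> $ \<sigma> * ttrace (hvar \<diamondop> hvar \<diamondop> hvar \<diamondop> ddhvar \<rho> \<sigma>))"

definition deriv_matrix :: "4 \<Rightarrow> jet_poly^4^4 \<Rightarrow> jet_poly^4^4" where
  "deriv_matrix \<rho> A = (\<chi> i j. total_deriv \<rho> (A $ i $ j))"

lemma total_deriv_eta: "total_deriv \<rho> (eta $ \<mu> $ \<nu>) = 0"
  by (simp add: eta_jconst total_deriv_jconst)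

lemma deriv_matrix_tprod: "deriv_matrix \<rho> (A \<diamondop> B) = deriv_matrix \<rho> A \<diamondop> B + A \<diamondop> deriv_matrix \<rho> B"
  by (simp add: deriv_matrix_def tprod_def matrix_matrix_mult_def vec_eq_iff total_deriv_arith total_deriv_mult total_deriv_eta
      sum.distrib)

lemma total_deriv_ttrace: "total_deriv \<rho> (ttrace A) = ttrace (deriv_matrix \<rho> A)"
  by (simp add: ttrace_def deriv_matrix_def total_deriv_arith total_deriv_mult total_deriv_eta)

lemma deriv_matrix_hvar: "deriv_matrix \<rho> hvar = dhvar \<rho>"
  by (simp add: deriv_matrix_def hvar_def dhvar_def total_deriv_jvar)

lemma deriv_matrix_dhvar: "deriv_matrix \<rho> (dhvar \<sigma>) = ddhvar \<rho> \<sigma>"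
  by (simp add: deriv_matrix_def dhvar_def ddhvar_def total_deriv_jvar)

lemma tprod_add: "(A + B) \<diamondop> C = A \<diamondop> C + B \<diamondop> C"
  by (simp add: tprod_def matrix_add_right_distrib)

lemma ttrace_add: "ttrace (A + B) = ttrace A + ttrace B"
  by (simp add: ttrace_def distrib_left sum.distrib)

text \<open>An identity in the free jet ring. The wave equation enters only when
  \<open>box_part\<close>, the Leibniz term with the second derivative, is evaluated on the
  field.\<close>

lemma divergence_current_deriv:
  "(\<Sum>\<^sub>U \<rho>. total_deriv \<rho> (divergence_current \<rho>)) = divergence_part + box_part"
  by (simp add: divergence_current_def divergence_part_def box_part_def total_deriv_arith total_deriv_mult total_deriv_eta
      total_deriv_ttrace deriv_matrix_tprod deriv_matrix_hvar deriv_matrix_dhvar tprod_add ttrace_add distrib_left sum.distrib add_ac)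

context string_field
begin

text \<open>Moving the sums over \<rho> and \<sigma> inside isolates the wave operator on a single
  component as a factor, and the ideal property does the rest.\<close>

lemma wick_null_box_part: "wick_null box_part"
proof -
  let ?X = "hvar \<diamondop> hvar \<diamondop> hvar ** eta"
  have "box_part = (\<Sum>\<^sub>U \<rho> \<sigma> \<mu> \<nu> \<kappa>. eta $ \<mu> $ \<nu> * ?X $ \<mu> $ \<kappa> * (eta $ \<rho> $ \<sigma> * jvar ([\<rho>, \<sigma>], \<kappa>, \<nu>)))"
  proof -
    have "(Y \<diamondop> ddhvar \<rho> \<sigma>) $ \<mu> $ \<nu> = (\<Sum>\<^sub>U \<kappa>. (Y ** eta) $ \<mu> $ \<kappa> * jvar ([\<rho>, \<sigma>], \<kappa>, \<nu>))" for Y \<rho> \<sigma> \<mu> \<nu>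
      by (simp add: tprod_def ddhvar_def sum_contract[symmetric])
    then show ?thesis by (simp add: box_part_def ttrace_def sum_distrib_left mult_ac)
  qed
  also have "\<dots> = (\<Sum>(\<rho>, \<sigma>, \<mu>, \<nu>, \<kappa>)\<in>UNIV. eta $ \<mu> $ \<nu> * ?X $ \<mu> $ \<kappa> * (eta $ \<rho> $ \<sigma> * jvar ([\<rho>, \<sigma>], \<kappa>, \<nu>)))"
    by (simp only: sum.cartesian_product UNIV_Times_UNIV)
  also have "\<dots> = (\<Sum>(\<mu>, \<nu>, \<kappa>, \<rho>, \<sigma>)\<in>UNIV. eta $ \<mu> $ \<nu> * ?X $ \<mu> $ \<kappa> * (eta $ \<rho> $ \<sigma> * jvar ([\<rho>, \<sigma>], \<kappa>, \<nu>)))"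
    by (rule sum.reindex_bij_witness[of _ "\<lambda>(\<mu>, \<nu>, \<kappa>, \<rho>, \<sigma>). (\<rho>, \<sigma>, \<mu>, \<nu>, \<kappa>)" "\<lambda>(\<rho>, \<sigma>, \<mu>, \<nu>, \<kappa>). (\<mu>, \<nu>, \<kappa>, \<rho>, \<sigma>)"]) auto
  also have "\<dots> = (\<Sum>\<^sub>U \<mu> \<nu> \<kappa> \<rho> \<sigma>. eta $ \<mu> $ \<nu> * ?X $ \<mu> $ \<kappa> * (eta $ \<rho> $ \<sigma> * jvar ([\<rho>, \<sigma>], \<kappa>, \<nu>)))"
    by (simp only: sum.cartesian_product UNIV_Times_UNIV)
  also have "\<dots> = (\<Sum>\<^sub>U \<mu> \<nu> \<kappa>. eta $ \<mu> $ \<nu> * ?X $ \<mu> $ \<kappa> * (\<Sum>\<^sub>U \<rho> \<sigma>. eta $ \<rho> $ \<sigma> * jvar ([\<rho>, \<sigma>], \<kappa>, \<nu>)))"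
    by (simp only: sum_distrib_left)
  finally show ?thesis
    by (rule ssubst[where P = wick_null]) (intro wick_null_sum wick_null_mult wick_null_box)
qed

lemma wick_null_trace_part: "wick_null trace_part"
  unfolding trace_part_def by (intro wick_null_sum wick_null_mult wick_null_trace)

lemma equal_up_to_divergence_full: "equal_up_to_divergence c a (L2_poly + divergence_part + trace_part) L2_poly"
  unfolding equal_up_to_divergence_def
proof (intro exI[of _ divergence_current] ballI allI conjI)
  fix \<phi> \<psi> x \<mu> assume dom: "\<phi> \<in> fock_domain" "\<psi> \<in> fock_domain"
  show "(\<lambda>y. wick_value c a (divergence_current \<mu>) y \<phi> \<psi>) differentiable (at x)"
    by (rule wick_value_partial(1)[OF dom])
  have "(\<Sum>\<^sub>U \<mu>. partial \<mu> (\<lambda>y. wick_value c a (divergence_current \<mu>) y \<phi> \<psi>) x) =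
    wick_value c a (divergence_part + box_part) x \<phi> \<psi>"
    by (simp only: wick_value_partial(2)[OF dom] divergence_current_deriv[symmetric] wick_value_arith)
  \<comment> \<open>The left side is the value of \<open>divergence_part + trace_part\<close>, the
    right side that of \<open>divergence_part + box_part\<close>; both additional parts are
    null.\<close>
  then show "wick_value c a (L2_poly + divergence_part + trace_part) x \<phi> \<psi> - wick_value c a L2_poly x \<phi> \<psi> =
    (\<Sum>\<^sub>U \<mu>. partial \<mu> (\<lambda>y. wick_value c a (divergence_current \<mu>) y \<phi> \<psi>) x)"
    using wick_null_box_part wick_null_trace_part dom by (simp add: wick_value_arith wick_null_def)
qed

end

theorem theorem3p6:
  shows "\<exists>L2h. is_classical_L2 L2h \<and>
    (\<forall>c a. string_smearing c \<longrightarrow> transverse_frame a \<longrightarrow> equal_up_to_divergence c a L2h L2_poly)"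
  using is_classical_L2_full string_field.equal_up_to_divergence_full string_field.intro by blast

end
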